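(* The pullback of an ${}^H\mathcal{S}$-Zariski covering family $\{f_i : X_{A[s_i^{-1}]}\to X_A\}$ along any ${}^H\mathcal{S}$-morphism $g : X_B\to X_A$ is an ${}^H\mathcal{S}$-Zariski covering family. That is, the projections $X_B\times_{X_A} X_{A[s_i^{-1}]}\to X_B$ of the pullbacks of $f_i : X_{A[s_i^{-1}]}\to X_A$ along $g : X_B\to X_A$ define an ${}^H\mathcal{S}$-Zariski covering family of $X_B$ (pullbacks being understood up to canonical isomorphism over $X_B$).
   Context: Fix a field $\mathbb{K}$ and a positive integer $n$; $\otimes$ denotes $\otimes_{\mathbb{K}}$. $H=\mathcal{O}(\mathbb{T}^n)$ is the Hopf algebra over $\mathbb{K}$ with vector space basis $\{t_{\mathbf{m}} : \mathbf{m}\in\mathbb{Z}^n\}$, product $t_{\mathbf{m}}t_{\mathbf{m}'}=t_{\mathbf{m}+\mathbf{m}'}$, unit $1_H=t_{\mathbf{0}}$, coproduct $\Delta(t_{\mathbf{m}})=t_{\mathbf{m}}\otimes t_{\mathbf{m}}$, counit $\epsilon(t_{\mathbf{m}})=1$, antipode $S(t_{\mathbf{m}})=t_{-\mathbf{m}}$. Fix a cotriangular structure on $H$, i.e. a linear map $R:H\otimes H\to\mathbb{K}$ with $R(fg\otimes h)=R(f\otimes h_{(1)})R(g\otimes h_{(2)})$, $R(f\otimes gh)=R(f_{(1)}\otimes h)R(f_{(2)}\otimes g)$ and $\epsilon(h)\epsilon(g)=R(h_{(1)}\otimes g_{(1)})R(g_{(2)}\otimes h_{(2)})$ (Sweedler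 notation). ${}^H\mathcal{M}$ is the category of left $H$-comodules $(V,\rho^V)$, $\rho^V(v)=v_{(-1)}\otimes v_{(0)}$, with $H$-equivariant linear maps; it is monoidal with $\rho^{V\otimes W}(v\otimes w)=v_{(-1)}w_{(-1)}\otimes v_{(0)}\otimes w_{(0)}$ and unit $\mathbb{K}$ with trivial coaction $c\mapsto 1_H\otimes c$, and symmetric with $\tau_{V,W}(v\otimes w)=R(w_{(-1)}\otimes v_{(-1)})\,w_{(0)}\otimes v_{(0)}$. ${}^H\mathcal{A}$ is the category of (associative unital) algebra objects $A$ in ${}^H\mathcal{M}$ satisfying $a\,a'=R(a'_{(-1)}\otimes a_{(-1)})\,a'_{(0)}a_{(0)}$ for all $a,a'\in A$; morphisms are the ${}^H\mathcal{M}$-morphisms preserving products and units. An ${}^H\mathcal{A}$-ideal is a two-sided ideal stable under the coaction. $F_{\mathbf{m}_1,\dots,\mathbf{m}_N}$ (with $\mathbf{m}_i\in\mathbb{Z}^n$) is the free ${}^H\mathcal{A}$-algebra on generators $x_1,\dots,x_N$ with coaction $x_i\mapsto t_{\mathbf{m}_i}\otimes x_i$, i.e. the algebra generated by the $x_i$ subject to $x_ix_j=R(t_{\mathbf{m}_j}\otimes t_{\mathbf{m}_i})x_jx_i$. An object of ${}^H\mathcal{A}$ is finitely presented if it is isomorphic to $F_{\mathbf{m}_1,\dots,\mathbf{m}_N}/(f_k)$ for finitely many elements $f_k$ with $f_k\mapsto t_{\mathbf{n}_k}\otimes f_k$ for some $\mathbf{n}_k\in\mathbb{Z}^n$. ${}^H\mathcal{A}_{\mathrm{fp}}$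 is the full subcategory of finitely presented objects. The coproduct $A\sqcup B$ in ${}^H\mathcal{A}$ and in ${}^H\mathcal{A}_{\mathrm{fp}}$ is $A\otimes B$ with product $(a\otimes b)(a'\otimes b')=R(a'_{(-1)}\otimes b_{(-1)})\,(a\,a'_{(0)})\otimes(b_{(0)}\,b')$ and unit $1_A\otimes 1_B$. Pushouts exist in ${}^H\mathcal{A}_{\mathrm{fp}}$: for $\kappa:C\to A$, $\zeta:C\to B$, $A\sqcup_C B=A\sqcup B/I$ with $I$ generated by $\kappa(c)\otimes 1_B-1_A\otimes\zeta(c)$, $c\in C$. For an $H$-coinvariant $s\in A$ (i.e. $\rho^A(s)=1_H\otimes s$) the localization is $A[s^{-1}]:=(A\sqcup F_{\mathbf{0}})/(s\otimes x-1)$, where $x$ is the generator of $F_{\mathbf{0}}$, with $\ell_s:A\to A[s^{-1}]$, $a\mapsto[a\otimes 1]$; it is universal among ${}^H\mathcal{A}$-morphisms out of $A$ making $s$ invertible. ${}^H\mathcal{S}:=({}^H\mathcal{A}_{\mathrm{fp}})^{\mathrm{op}}$ is the category of toric noncommutative spaces; its objects are written $X_A$, and a morphism $f:X_B\to X_A$ corresponds to an ${}^H\mathcal{A}_{\mathrm{fp}}$-morphism $f^*:A\to B$. Pullbacks are $X_A\times_{X_C}X_B=X_{A\sqcup_C B}$. An ${}^H\mathcal{S}$-Zariski covering family is a finite family of ${}^H\mathcal{S}$-morphisms $\{f_i:X_{A[s_i^{-1}]}\to X_A\}$ where (i) each $s_i\in A$ is $H$-coinvariant; (ii) $f_i^*=\ell_{s_i}:A\to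 A[s_i^{-1}]$ for all $i$; (iii) there exist $a_i\in A$ with $\sum_i a_i s_i=1_A$. *)

theory Defs
  imports
    "HOL-Algebra.Algebraic_Closure_Type"
    "HOL-Algebra.QuotRing"
    "HOL-Algebra.Module"
    "HOL-Library.Poly_Mapping"
    "HOL-Analysis.Finite_Cartesian_Product"
begin

text \<open>
  The ground field is an arbitrary type \<open>'k\<close> of class \<^class>\<open>field\<close>; \<open>\<int>\<^sup>n\<close> is \<^typ>\<open>int ^ 'n\<close>
  with \<open>'n\<close> an arbitrary finite (nonempty) type, so that \<open>n = CARD('n) \<ge> 1\<close>.
  Vector spaces and algebras are records in the sense of HOL-Algebra, with explicit carriers.
\<close>

section \<open>Vector spaces and their tensor products\<close>

definition ground :: "('k::field, 'k) module" where
  "ground = ring.extend ring_of_type_algebra (module.fields (*))"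

abbreviation vspace :: "('k::field, 'v, 'x) module_scheme \<Rightarrow> bool" where
  "vspace V \<equiv> module (ring_of_type_algebra :: 'k ring) V"

definition linear_maps ::
  "('k::field, 'v, 'x) module_scheme \<Rightarrow> ('k, 'w, 'y) module_scheme \<Rightarrow> ('v \<Rightarrow> 'w) set" where
  "linear_maps V W = {f \<in> carrier V \<rightarrow> carrier W.
     (\<forall>v\<in>carrier V. \<forall>v'\<in>carrier V. f (v \<oplus>\<^bsub>V\<^esub> v') = f v \<oplus>\<^bsub>W\<^esub> f v') \<and>
     (\<forall>c. \<forall>v\<in>carrier V. f (c \<odot>\<^bsub>V\<^esub> v) = c \<odot>\<^bsub>W\<^esub> f v)}"

text \<open>
  \<open>V \<otimes> W\<close> is the free vector space on \<open>carrier V \<times> carrier W\<close> modulo the subspace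
  generated by the bilinearity relations; its elements are the cosets of that subspace.
\<close>

type_synonym ('k, 'v, 'w) tensor = "('v \<times> 'w \<Rightarrow>\<^sub>0 'k) set"

inductive_set tensor_null ::
  "('k::field, 'v, 'x) module_scheme \<Rightarrow> ('k, 'w, 'y) module_scheme \<Rightarrow> ('v \<times> 'w \<Rightarrow>\<^sub>0 'k) set"
  for V W where
  add_left: "\<lbrakk>v \<in> carrier V; v' \<in> carrier V; w \<in> carrier W\<rbrakk> \<Longrightarrow>
    Poly_Mapping.single (v \<oplus>\<^bsub>V\<^esub> v', w) 1
      - Poly_Mapping.single (v, w) 1 - Poly_Mapping.single (v', w) 1 \<in> tensor_null V W"
| add_right: "\<lbrakk>v \<in> carrier V; w \<in> carrier W; w' \<in> carrier W\<rbrakk> \<Longrightarrow>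
    Poly_Mapping.single (v, w \<oplus>\<^bsub>W\<^esub> w') 1
      - Poly_Mapping.single (v, w) 1 - Poly_Mapping.single (v, w') 1 \<in> tensor_null V W"
| smult_left: "\<lbrakk>v \<in> carrier V; w \<in> carrier W\<rbrakk> \<Longrightarrow>
    Poly_Mapping.single (c \<odot>\<^bsub>V\<^esub> v, w) 1 - Poly_Mapping.single (v, w) c \<in> tensor_null V W"
| smult_right: "\<lbrakk>v \<in> carrier V; w \<in> carrier W\<rbrakk> \<Longrightarrow>
    Poly_Mapping.single (v, c \<odot>\<^bsub>W\<^esub> w) 1 - Poly_Mapping.single (v, w) c \<in> tensor_null V W"
| zero: "0 \<in> tensor_null V W"
| add: "\<lbrakk>p \<in> tensor_null V W; q \<in> tensor_null V W\<rbrakk> \<Longrightarrow> p + q \<in> tensor_null V W"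
| scale: "p \<in> tensor_null V W \<Longrightarrow> Poly_Mapping.map ((*) c) p \<in> tensor_null V W"

definition tensor_class ::
  "('k::field, 'v, 'x) module_scheme \<Rightarrow> ('k, 'w, 'y) module_scheme \<Rightarrow> ('v \<times> 'w \<Rightarrow>\<^sub>0 'k)
    \<Rightarrow> ('k, 'v, 'w) tensor" where
  "tensor_class V W p = {p + r |r. r \<in> tensor_null V W}"

definition pure_tensor ::
  "('k::field, 'v, 'x) module_scheme \<Rightarrow> ('k, 'w, 'y) module_scheme \<Rightarrow> 'v \<Rightarrow> 'w
    \<Rightarrow> ('k, 'v, 'w) tensor" where
  "pure_tensor V W v w = tensor_class V W (Poly_Mapping.single (v, w) 1)"

text \<open>Only a vector space: the ring multiplication and unit of the record are left unspecified.\<close>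

definition tensor ::
  "('k::field, 'v, 'x) module_scheme \<Rightarrow> ('k, 'w, 'y) module_scheme
    \<Rightarrow> ('k, ('k, 'v, 'w) tensor) module" where
  "tensor V W =
    \<lparr>carrier = {tensor_class V W p |p. Poly_Mapping.keys p \<subseteq> carrier V \<times> carrier W},
     monoid.mult = undefined, one = undefined,
     ring.zero = tensor_null V W,
     add = (\<lambda>S S'. {x + y |x y. x \<in> S \<and> y \<in> S'}),
     module.smult = (\<lambda>c S. \<Union>x\<in>S. tensor_class V W (Poly_Mapping.map ((*) c) x))\<rparr>"

text \<open>
  \<open>sweedler U S f\<close> is \<open>\<Sum>\<^sub>i c\<^sub>i f(v\<^sub>i, w\<^sub>i)\<close>, computed in \<open>U\<close>, where \<open>S = \<Sum>\<^sub>i c\<^sub>i v\<^sub>i \<otimes> w\<^sub>i\<close>: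
  the value at \<open>S\<close> of the linear map \<open>V \<otimes> W \<rightarrow> U\<close> induced by a bilinear \<open>f\<close>.
  It renders Sweedler notation; it is only meant for bilinear \<open>f\<close>, for which the chosen
  representative of \<open>S\<close> does not matter.
\<close>

definition sweedler ::
  "('k::field, 'u, 'z) module_scheme \<Rightarrow> ('k, 'v, 'w) tensor \<Rightarrow> ('v \<Rightarrow> 'w \<Rightarrow> 'u) \<Rightarrow> 'u" where
  "sweedler U S f = (let p = (SOME p. p \<in> S) in
     \<Oplus>\<^bsub>U\<^esub>x\<in>Poly_Mapping.keys p. Poly_Mapping.lookup p x \<odot>\<^bsub>U\<^esub> f (fst x) (snd x))"


section \<open>The Hopf algebra of the torus and its cotriangular structures\<close>

text \<open>
  The group algebra of \<open>\<int>\<^sup>n\<close>: finitely supported functions with the convolution product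
  provided by Poly_Mapping; \<open>t\<^sub>m\<close> is the indicator of \<open>m\<close>.
\<close>

type_synonym ('k, 'n) torus = "(int ^ 'n) \<Rightarrow>\<^sub>0 'k"

definition torus :: "('k::field, ('k, 'n::finite) torus) module" where
  "torus = ring.extend ring_of_type_algebra (module.fields (\<lambda>c. Poly_Mapping.map ((*) c)))"

definition tbasis :: "int ^ 'n \<Rightarrow> ('k::field, 'n::finite) torus" where
  "tbasis m = Poly_Mapping.single m 1"

definition coproduct_H ::
  "('k::field, 'n::finite) torus \<Rightarrow> ('k, ('k, 'n) torus, ('k, 'n) torus) tensor" where
  "coproduct_H h = (\<Oplus>\<^bsub>tensor torus torus\<^esub>m\<in>Poly_Mapping.keys h.
     Poly_Mapping.lookup h m \<odot>\<^bsub>tensor torus torus\<^esub> pure_tensor torus torus (tbasis m) (tbasis m))"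

definition counit_H :: "('k::field, 'n::finite) torus \<Rightarrow> 'k" where
  "counit_H h = (\<Sum>m\<in>Poly_Mapping.keys h. Poly_Mapping.lookup h m)"

type_synonym ('k, 'n) braiding = "('k, ('k, 'n) torus, ('k, 'n) torus) tensor \<Rightarrow> 'k"

abbreviation HH :: "('k::field, 'n::finite) torus \<Rightarrow> ('k, 'n) torus
    \<Rightarrow> ('k, ('k, 'n) torus, ('k, 'n) torus) tensor" where
  "HH \<equiv> pure_tensor torus torus"

definition cotriangular :: "('k::field, 'n::finite) braiding \<Rightarrow> bool" where
  "cotriangular R \<longleftrightarrow>
     R \<in> linear_maps (tensor torus torus) ground \<and>
     (\<forall>f g h. R (HH (f * g) h) =
        sweedler ground (coproduct_H h) (\<lambda>h1 h2. R (HH f h1) * R (HH g h2))) \<and>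
     (\<forall>f g h. R (HH f (g * h)) =
        sweedler ground (coproduct_H f) (\<lambda>f1 f2. R (HH f1 h) * R (HH f2 g))) \<and>
     (\<forall>g h. counit_H h * counit_H g =
        sweedler ground (coproduct_H h) (\<lambda>h1 h2.
          sweedler ground (coproduct_H g) (\<lambda>g1 g2. R (HH h1 g1) * R (HH g2 h2))))"


section \<open>Comodules and the category of braided commutative algebras\<close>

record (overloaded) ('k, 'n, 'a) halg = "('k, 'a) module" +
  coact :: "'a \<Rightarrow> ('k, ('k, 'n) torus, 'a) tensor"

definition comodule :: "('k::field, 'n::finite, 'a, 'x) halg_scheme \<Rightarrow> bool" where
  "comodule V \<longleftrightarrow>
     vspace V \<and>
     coact V \<in> linear_maps V (tensor torus V) \<and>
     (\<forall>v\<in>carrier V. let U = tensor torus (tensor torus V) in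
        sweedler U (coact V v) (\<lambda>h v0. sweedler U (coproduct_H h)
          (\<lambda>h1 h2. pure_tensor torus (tensor torus V) h1 (pure_tensor torus V h2 v0)))
        = sweedler U (coact V v) (\<lambda>h v0. pure_tensor torus (tensor torus V) h (coact V v0))) \<and>
     (\<forall>v\<in>carrier V. sweedler V (coact V v) (\<lambda>h v0. counit_H h \<odot>\<^bsub>V\<^esub> v0) = v)"

definition equivariant_maps ::
  "('k::field, 'n::finite, 'a, 'x) halg_scheme \<Rightarrow> ('k, 'n, 'b, 'y) halg_scheme
    \<Rightarrow> ('a \<Rightarrow> 'b) set" where
  "equivariant_maps V W = {f \<in> linear_maps V W. \<forall>v\<in>carrier V.
     coact W (f v) =
       sweedler (tensor torus W) (coact V v) (\<lambda>h v0. pure_tensor torus W h (f v0))}"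

text \<open>Algebra objects: product and unit are bilinear, resp. linear, and equivariant.\<close>

definition comodule_algebra :: "('k::field, 'n::finite, 'a, 'x) halg_scheme \<Rightarrow> bool" where
  "comodule_algebra A \<longleftrightarrow>
     comodule A \<and> ring A \<and>
     (\<forall>c. \<forall>a\<in>carrier A. \<forall>b\<in>carrier A.
        (c \<odot>\<^bsub>A\<^esub> a) \<otimes>\<^bsub>A\<^esub> b = c \<odot>\<^bsub>A\<^esub> (a \<otimes>\<^bsub>A\<^esub> b) \<and> a \<otimes>\<^bsub>A\<^esub> (c \<odot>\<^bsub>A\<^esub> b) = c \<odot>\<^bsub>A\<^esub> (a \<otimes>\<^bsub>A\<^esub> b)) \<and>
     (\<forall>a\<in>carrier A. \<forall>b\<in>carrier A. coact A (a \<otimes>\<^bsub>A\<^esub> b) =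
        sweedler (tensor torus A) (coact A a) (\<lambda>h a0.
          sweedler (tensor torus A) (coact A b) (\<lambda>g b0.
            pure_tensor torus A (h * g) (a0 \<otimes>\<^bsub>A\<^esub> b0)))) \<and>
     coact A \<one>\<^bsub>A\<^esub> = pure_tensor torus A 1 \<one>\<^bsub>A\<^esub>"

definition HA_obj ::
  "('k::field, 'n::finite) braiding \<Rightarrow> ('k, 'n, 'a, 'x) halg_scheme \<Rightarrow> bool" where
  "HA_obj R A \<longleftrightarrow> comodule_algebra A \<and>
     (\<forall>a\<in>carrier A. \<forall>a'\<in>carrier A. a \<otimes>\<^bsub>A\<^esub> a' =
        sweedler A (coact A a') (\<lambda>h' a0'. sweedler A (coact A a) (\<lambda>h a0.
          R (HH h' h) \<odot>\<^bsub>A\<^esub> (a0' \<otimes>\<^bsub>A\<^esub> a0))))"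

definition HA_hom ::
  "('k::field, 'n::finite, 'a, 'x) halg_scheme \<Rightarrow> ('k, 'n, 'b, 'y) halg_scheme
    \<Rightarrow> ('a \<Rightarrow> 'b) set" where
  "HA_hom A B = equivariant_maps A B \<inter> ring_hom A B"

definition HA_iso ::
  "('k::field, 'n::finite, 'a, 'x) halg_scheme \<Rightarrow> ('k, 'n, 'b, 'y) halg_scheme
    \<Rightarrow> ('a \<Rightarrow> 'b) set" where
  "HA_iso A B = {\<phi> \<in> HA_hom A B. bij_betw \<phi> (carrier A) (carrier B)}"

definition homogeneous :: "('k::field, 'n::finite, 'a, 'x) halg_scheme \<Rightarrow> int ^ 'n \<Rightarrow> 'a set" where
  "homogeneous A m = {a \<in> carrier A. coact A a = pure_tensor torus A (tbasis m) a}"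

definition coinvariants :: "('k::field, 'n::finite, 'a, 'x) halg_scheme \<Rightarrow> 'a set" where
  "coinvariants A = {a \<in> carrier A. coact A a = pure_tensor torus A 1 a}"


section \<open>Quotients\<close>

text \<open>
  Quotient by a two-sided ideal. Every ideal used below is generated by homogeneous elements
  or by a subcomodule, hence is stable under the coaction, so that the induced coaction does
  not depend on the chosen representative.
\<close>

definition quotient_vspace ::
  "('k::field, 'a, 'x) module_scheme \<Rightarrow> 'a set \<Rightarrow> ('k, 'a set) module" where
  "quotient_vspace A I = ring.extend (A Quot I)
     (module.fields (\<lambda>c S. \<Union>x\<in>S. I +>\<^bsub>A\<^esub> (c \<odot>\<^bsub>A\<^esub> x)))"

definition quotient ::
  "('k::field, 'n::finite, 'a, 'x) halg_scheme \<Rightarrow> 'a set \<Rightarrow> ('k, 'n, 'a set) halg" where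
  "quotient A I = module.extend (quotient_vspace A I) (halg.fields
     (\<lambda>S. sweedler (tensor torus (quotient_vspace A I)) (coact A (SOME x. x \<in> S))
        (\<lambda>h a. pure_tensor torus (quotient_vspace A I) h (I +>\<^bsub>A\<^esub> a))))"


section \<open>Free algebras and finite presentation\<close>

text \<open>Words in the letters \<open>x\<^sub>0, x\<^sub>1, \<dots>\<close> form a monoid under concatenation, written additively so
  that Poly_Mapping provides the product of noncommutative polynomials.\<close>

datatype word = Word (letters: "nat list")

instantiation word :: monoid_add
begin
definition zero_word :: word where "zero_word = Word []"
definition plus_word :: "word \<Rightarrow> word \<Rightarrow> word" where
  "plus_word u v = Word (letters u @ letters v)"
instance
  by standard (simp_all add: zero_word_def plus_word_def)
end

type_synonym 'k ncpoly = "word \<Rightarrow>\<^sub>0 'k"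

definition assoc_vspace :: "nat \<Rightarrow> ('k::field, 'k ncpoly) module" where
  "assoc_vspace N = ring.extend
     (ring_of_type_algebra
        \<lparr>carrier := {p. \<forall>w\<in>Poly_Mapping.keys p. \<forall>i\<in>set (letters w). i < N}\<rparr>)
     (module.fields (\<lambda>c. Poly_Mapping.map ((*) c)))"

definition var :: "nat \<Rightarrow> 'k::field ncpoly" where
  "var i = Poly_Mapping.single (Word [i]) 1"

text \<open>The free associative algebra on \<open>x\<^sub>0, \<dots>, x\<^bsub>N-1\<^esub>\<close> with coaction
  \<open>x\<^sub>i \<mapsto> t\<^bsub>m\<^sub>i\<^esub> \<otimes> x\<^sub>i\<close> extended multiplicatively.\<close>

definition assoc_algebra :: "(int ^ 'n) list \<Rightarrow> ('k::field, 'n::finite, 'k ncpoly) halg" where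
  "assoc_algebra ms = (let T = assoc_vspace (length ms); U = tensor torus T in
     module.extend T (halg.fields
       (\<lambda>p. \<Oplus>\<^bsub>U\<^esub>w\<in>Poly_Mapping.keys p. Poly_Mapping.lookup p w \<odot>\<^bsub>U\<^esub>
          pure_tensor torus T (tbasis (\<Sum>i\<leftarrow>letters w. ms ! i)) (Poly_Mapping.single w 1))))"

definition free_ideal ::
  "('k::field, 'n::finite) braiding \<Rightarrow> (int ^ 'n) list \<Rightarrow> 'k ncpoly set" where
  "free_ideal R ms =
     Idl\<^bsub>assoc_algebra ms :: ('k, 'n, 'k ncpoly) halg\<^esub>
       {var i * var j
          - Poly_Mapping.map ((*) (R (HH (tbasis (ms ! j)) (tbasis (ms ! i))))) (var j * var i)
        |i j. i < length ms \<and> j < length ms}"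

definition free_HA ::
  "('k::field, 'n::finite) braiding \<Rightarrow> (int ^ 'n) list \<Rightarrow> ('k, 'n, 'k ncpoly set) halg" where
  "free_HA R ms = quotient (assoc_algebra ms) (free_ideal R ms)"

definition gen ::
  "('k::field, 'n::finite) braiding \<Rightarrow> (int ^ 'n) list \<Rightarrow> nat \<Rightarrow> 'k ncpoly set" where
  "gen R ms i = free_ideal R ms +>\<^bsub>assoc_algebra ms :: ('k, 'n, 'k ncpoly) halg\<^esub> var i"

definition finitely_presented ::
  "('k::field, 'n::finite) braiding \<Rightarrow> ('k, 'n, 'a) halg \<Rightarrow> bool" where
  "finitely_presented R A \<longleftrightarrow> (\<exists>ms F. finite F \<and>
     (\<forall>f\<in>F. \<exists>m. f \<in> homogeneous (free_HA R ms) m) \<and>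
     HA_iso A (quotient (free_HA R ms) (Idl\<^bsub>free_HA R ms\<^esub> F)) \<noteq> {})"


section \<open>Coproducts, pushouts and localizations\<close>

definition coproduct_coact ::
  "('k::field, 'n::finite, 'a) halg \<Rightarrow> ('k, 'n, 'b) halg
    \<Rightarrow> ('k, 'a, 'b) tensor \<Rightarrow> ('k, ('k, 'n) torus, ('k, 'a, 'b) tensor) tensor" where
  "coproduct_coact A B S = (let U = tensor torus (tensor A B) in
     sweedler U S (\<lambda>a b. sweedler U (coact A a) (\<lambda>h a0. sweedler U (coact B b) (\<lambda>g b0.
       pure_tensor torus (tensor A B) (h * g) (pure_tensor A B a0 b0)))))"

definition coproduct_mult ::
  "('k::field, 'n::finite) braiding \<Rightarrow> ('k, 'n, 'a) halg \<Rightarrow> ('k, 'n, 'b) halg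
    \<Rightarrow> ('k, 'a, 'b) tensor \<Rightarrow> ('k, 'a, 'b) tensor \<Rightarrow> ('k, 'a, 'b) tensor" where
  "coproduct_mult R A B S S' = (let U = tensor A B in
     sweedler U S (\<lambda>a b. sweedler U S' (\<lambda>a' b'.
       sweedler U (coact A a') (\<lambda>h a0'. sweedler U (coact B b) (\<lambda>g b0.
         R (HH h g) \<odot>\<^bsub>U\<^esub> pure_tensor A B (a \<otimes>\<^bsub>A\<^esub> a0') (b0 \<otimes>\<^bsub>B\<^esub> b'))))))"

definition coproduct ::
  "('k::field, 'n::finite) braiding \<Rightarrow> ('k, 'n, 'a) halg \<Rightarrow> ('k, 'n, 'b) halg
    \<Rightarrow> ('k, 'n, ('k, 'a, 'b) tensor) halg" where
  "coproduct R A B = module.extend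
     ((tensor A B)\<lparr>monoid.mult := coproduct_mult R A B, one := pure_tensor A B \<one>\<^bsub>A\<^esub> \<one>\<^bsub>B\<^esub>\<rparr>)
     (halg.fields (coproduct_coact A B))"

definition pushout_ideal ::
  "('k::field, 'n::finite) braiding \<Rightarrow> ('k, 'n, 'c) halg \<Rightarrow> ('k, 'n, 'a) halg \<Rightarrow> ('k, 'n, 'b) halg
    \<Rightarrow> ('c \<Rightarrow> 'a) \<Rightarrow> ('c \<Rightarrow> 'b) \<Rightarrow> ('k, 'a, 'b) tensor set" where
  "pushout_ideal R C A B \<kappa> \<zeta> = Idl\<^bsub>coproduct R A B\<^esub>
     {pure_tensor A B (\<kappa> c) \<one>\<^bsub>B\<^esub> \<ominus>\<^bsub>coproduct R A B\<^esub> pure_tensor A B \<one>\<^bsub>A\<^esub> (\<zeta> c) |c. c \<in> carrier C}"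

definition pushout ::
  "('k::field, 'n::finite) braiding \<Rightarrow> ('k, 'n, 'c) halg \<Rightarrow> ('k, 'n, 'a) halg \<Rightarrow> ('k, 'n, 'b) halg
    \<Rightarrow> ('c \<Rightarrow> 'a) \<Rightarrow> ('c \<Rightarrow> 'b) \<Rightarrow> ('k, 'n, ('k, 'a, 'b) tensor set) halg" where
  "pushout R C A B \<kappa> \<zeta> = quotient (coproduct R A B) (pushout_ideal R C A B \<kappa> \<zeta>)"

definition pushout_inl ::
  "('k::field, 'n::finite) braiding \<Rightarrow> ('k, 'n, 'c) halg \<Rightarrow> ('k, 'n, 'a) halg \<Rightarrow> ('k, 'n, 'b) halg
    \<Rightarrow> ('c \<Rightarrow> 'a) \<Rightarrow> ('c \<Rightarrow> 'b) \<Rightarrow> 'a \<Rightarrow> ('k, 'a, 'b) tensor set" where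
  "pushout_inl R C A B \<kappa> \<zeta> a =
     pushout_ideal R C A B \<kappa> \<zeta> +>\<^bsub>coproduct R A B\<^esub> pure_tensor A B a \<one>\<^bsub>B\<^esub>"

type_synonym ('k, 'a) loc = "('k, 'a, 'k ncpoly set) tensor set"

definition loc_ideal ::
  "('k::field, 'n::finite) braiding \<Rightarrow> ('k, 'n, 'a) halg \<Rightarrow> 'a
    \<Rightarrow> ('k, 'a, 'k ncpoly set) tensor set" where
  "loc_ideal R A s = Idl\<^bsub>coproduct R A (free_HA R [0])\<^esub>
     {pure_tensor A (free_HA R [0]) s (gen R [0] 0)
        \<ominus>\<^bsub>coproduct R A (free_HA R [0])\<^esub> \<one>\<^bsub>coproduct R A (free_HA R [0])\<^esub>}"

definition localization ::
  "('k::field, 'n::finite) braiding \<Rightarrow> ('k, 'n, 'a) halg \<Rightarrow> 'a \<Rightarrow> ('k, 'n, ('k, 'a) loc) halg" where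
  "localization R A s = quotient (coproduct R A (free_HA R [0])) (loc_ideal R A s)"

definition loc_map ::
  "('k::field, 'n::finite) braiding \<Rightarrow> ('k, 'n, 'a) halg \<Rightarrow> 'a \<Rightarrow> 'a \<Rightarrow> ('k, 'a) loc" where
  "loc_map R A s a = loc_ideal R A s +>\<^bsub>coproduct R A (free_HA R [0])\<^esub>
     pure_tensor A (free_HA R [0]) a \<one>\<^bsub>free_HA R [0]\<^esub>"


section \<open>Toric noncommutative spaces and Zariski covering families\<close>

text \<open>
  The space \<open>X\<^sub>A\<close> is represented by the algebra \<open>A\<close>. A morphism \<open>f : X\<^sub>B \<rightarrow> X\<^sub>A\<close> is represented by
  \<open>f\<^sup>* : A \<rightarrow> B\<close>; thus \<open>HS_hom R B A\<close> consists of maps from \<open>A\<close> to \<open>B\<close>.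
\<close>

definition HS_obj :: "('k::field, 'n::finite) braiding \<Rightarrow> ('k, 'n, 'a) halg \<Rightarrow> bool" where
  "HS_obj R A \<longleftrightarrow> HA_obj R A \<and> finitely_presented R A"

definition HS_hom ::
  "('k::field, 'n::finite) braiding \<Rightarrow> ('k, 'n, 'b) halg \<Rightarrow> ('k, 'n, 'a) halg \<Rightarrow> ('a \<Rightarrow> 'b) set" where
  "HS_hom R B A = {f \<in> HA_hom A B. HS_obj R A \<and> HS_obj R B}"

text \<open>The pullback of \<open>\<zeta> : X\<^sub>B \<rightarrow> X\<^sub>C\<close> along \<open>\<kappa> : X\<^sub>A \<rightarrow> X\<^sub>C\<close> and its projection to \<open>X\<^sub>A\<close>.\<close>

abbreviation pullback ::
  "('k::field, 'n::finite) braiding \<Rightarrow> ('k, 'n, 'c) halg \<Rightarrow> ('k, 'n, 'a) halg \<Rightarrow> ('k, 'n, 'b) halg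
    \<Rightarrow> ('c \<Rightarrow> 'a) \<Rightarrow> ('c \<Rightarrow> 'b) \<Rightarrow> ('k, 'n, ('k, 'a, 'b) tensor set) halg" where
  "pullback \<equiv> pushout"

abbreviation pullback_proj ::
  "('k::field, 'n::finite) braiding \<Rightarrow> ('k, 'n, 'c) halg \<Rightarrow> ('k, 'n, 'a) halg \<Rightarrow> ('k, 'n, 'b) halg
    \<Rightarrow> ('c \<Rightarrow> 'a) \<Rightarrow> ('c \<Rightarrow> 'b) \<Rightarrow> 'a \<Rightarrow> ('k, 'a, 'b) tensor set" where
  "pullback_proj \<equiv> pushout_inl"

definition zariski_covering_family ::
  "('k::field, 'n::finite) braiding \<Rightarrow> ('k, 'n, 'a) halg
    \<Rightarrow> 'i set \<Rightarrow> ('i \<Rightarrow> ('k, 'n, ('k, 'a) loc) halg) \<Rightarrow> ('i \<Rightarrow> 'a \<Rightarrow> ('k, 'a) loc) \<Rightarrow> bool" where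
  "zariski_covering_family R A I Y f \<longleftrightarrow>
     HS_obj R A \<and> finite I \<and> (\<forall>i\<in>I. f i \<in> HS_hom R (Y i) A) \<and>
     (\<exists>s. (\<forall>i\<in>I. s i \<in> coinvariants A \<and> Y i = localization R A (s i) \<and>
              (\<forall>a\<in>carrier A. f i a = loc_map R A (s i) a)) \<and>
          (\<exists>a. (\<forall>i\<in>I. a i \<in> carrier A) \<and> (\<Oplus>\<^bsub>A\<^esub>i\<in>I. a i \<otimes>\<^bsub>A\<^esub> s i) = \<one>\<^bsub>A\<^esub>))"

text \<open>\<open>p : X\<^sub>P \<rightarrow> X\<^sub>B\<close> and \<open>q : X\<^sub>Q \<rightarrow> X\<^sub>B\<close> are isomorphic as spaces over \<open>X\<^sub>B\<close>.\<close>

definition HS_iso_over ::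
  "('k::field, 'n::finite) braiding \<Rightarrow> ('k, 'n, 'b) halg
    \<Rightarrow> ('k, 'n, 'p) halg \<Rightarrow> ('b \<Rightarrow> 'p) \<Rightarrow> ('k, 'n, 'q) halg \<Rightarrow> ('b \<Rightarrow> 'q) \<Rightarrow> bool" where
  "HS_iso_over R B P p Q q \<longleftrightarrow>
     p \<in> HS_hom R P B \<and> q \<in> HS_hom R Q B \<and>
     (\<exists>\<phi>\<in>HA_iso Q P. \<forall>b\<in>carrier B. \<phi> (q b) = p b)"

end

theory Submission
  imports Defs
begin

text \<open>
  A comodule over the torus is the same thing as a vector space spanned by homogeneous elements
  \<open>v\<close>, i.e. elements with coaction \<open>v \<mapsto> t\<^sub>m \<otimes> v\<close>; all multilinear identities are therefore
  checked on homogeneous elements, where \<open>R\<close> only enters through the bicharacter \<open>R(t\<^sub>m \<otimes> t\<^sub>n)\<close>.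

  For coinvariant \<open>s \<in> A\<close> and \<open>g : A \<rightarrow> B\<close>, the universal properties of localizations and pushouts
  give mutually inverse morphisms between \<open>B[g(s)\<^sup>-\<^sup>1]\<close> and the pushout of \<open>A[s\<^sup>-\<^sup>1]\<close> along \<open>g\<close>, under
  \<open>B\<close>; and \<open>\<Sum>\<^sub>i g(a\<^sub>i) g(s\<^sub>i) = 1\<close>. If \<open>B\<close> is \<open>F/(f\<^sub>k)\<close> with \<open>F\<close> free, then \<open>B[s\<^sup>-\<^sup>1]\<close> is the quotient
  of the free algebra with one more generator \<open>x\<close> of degree \<open>0\<close> by the \<open>f\<^sub>k\<close> and \<open>s' x - 1\<close>, where
  \<open>s'\<close> is a coinvariant lift of \<open>s\<close>; so \<open>B[s\<^sup>-\<^sup>1]\<close> is again finitely presented.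
\<close>

text \<open>Coactions, braided products and induced maps are Sweedler sums evaluated at a
  representative of a tensor chosen by \<open>SOME\<close>. Such a sum has a meaning only for a
  multilinear summand, so multilinearity is established for each summand before it is evaluated;
  once the values on pure tensors are known (\<open>sweedler_pure\<close>, \<open>dbl_pure\<close>),
  the chosen representatives disappear. The passage to homogeneous elements rests on the coefficient
  functionals of the torus: they are dual to a basis of grouplike elements and cut a comodule into
  its degrees. In the same spirit, stability of an ideal under the coaction is rendered as being
  spanned by homogeneous elements (\<open>hom_ideal\<close>); this is what makes the coaction of a
  quotient well defined. An isomorphism over \<open>B\<close> is one between finitely presented
  objects; the pushout inherits its presentation through the isomorphism with the localization of
  \<open>B\<close>. Coinvariance of \<open>s\<close> matters because \<open>r 0 n = 1\<close>:
  elements of degree 0 are exchanged without a factor, and \<open>s x - 1\<close> is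
  homogeneous.\<close>

lemma ring_of_type_algebra_simps [simp]:
  "carrier ring_of_type_algebra = UNIV"
  "monoid.mult ring_of_type_algebra = (*)"
  "one ring_of_type_algebra = 1"
  "ring.zero ring_of_type_algebra = 0"
  "add ring_of_type_algebra = (+)"
  by (simp_all add: ring_of_type_algebra_def fun_eq_iff)

section \<open>Finitely supported functions: scalar multiples and induction\<close>

abbreviation pscale :: "'k::mult_zero \<Rightarrow> ('i \<Rightarrow>\<^sub>0 'k) \<Rightarrow> ('i \<Rightarrow>\<^sub>0 'k)" where
  "pscale c \<equiv> Poly_Mapping.map ((*) c)"

lemma lookup_pscale [simp]: "Poly_Mapping.lookup (pscale c p) x = c * Poly_Mapping.lookup p x"
  by (transfer) (auto simp: when_def)

lemma keys_pscale: "Poly_Mapping.keys (pscale c p) \<subseteq> Poly_Mapping.keys p"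
  by (auto simp: in_keys_iff)

lemma pscale_add: "pscale c (p + q) = pscale c p + pscale (c::'k::field) q"
  by (rule poly_mapping_eqI) (simp add: lookup_add algebra_simps)

lemma pscale_pscale: "pscale c (pscale d p) = pscale (c * d) (p :: 'i \<Rightarrow>\<^sub>0 'k::field)"
  by (rule poly_mapping_eqI) (simp add: algebra_simps)

lemma pscale_add_left: "pscale (c + d) p = pscale c p + pscale d (p :: 'i \<Rightarrow>\<^sub>0 'k::field)"
  by (rule poly_mapping_eqI) (simp add: lookup_add algebra_simps)

lemma pscale_one [simp]: "pscale 1 p = (p :: 'i \<Rightarrow>\<^sub>0 'k::field)"
  by (rule poly_mapping_eqI) simp

lemma pscale_minus_one: "pscale (- 1) p = - (p :: 'i \<Rightarrow>\<^sub>0 'k::field)"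
  by (rule poly_mapping_eqI) simp

lemma pscale_zero [simp]: "pscale c 0 = (0 :: 'i \<Rightarrow>\<^sub>0 'k::field)"
  by (rule poly_mapping_eqI) simp

lemma pscale_single [simp]:
  "pscale c (Poly_Mapping.single x d) = Poly_Mapping.single x (c * (d::'k::field))"
  by (rule poly_mapping_eqI) (simp add: lookup_single when_def)

lemma keys_minus': "Poly_Mapping.keys (- p) = Poly_Mapping.keys (p :: 'i \<Rightarrow>\<^sub>0 'k::field)"
  by (auto simp: in_keys_iff)

lemma keys_diff': "Poly_Mapping.keys (p - q) \<subseteq> Poly_Mapping.keys p \<union> Poly_Mapping.keys (q :: 'i \<Rightarrow>\<^sub>0 'k::field)"
  by (auto simp: in_keys_iff lookup_minus)

text \<open>Every \<open>p\<close> is the finite sum of its \<open>single\<close> terms. The support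
  condition is passed on to the \<open>add\<close> case because linear extensions are additive only
  on supports where the extended function takes values in the carrier.\<close>

lemma poly_mapping_keys_induct [consumes 1, case_names zero single add]:
  fixes p :: "'i \<Rightarrow>\<^sub>0 'k::field"
  assumes "Poly_Mapping.keys p \<subseteq> D"
    and zero: "P 0"
    and single: "\<And>x c. x \<in> D \<Longrightarrow> P (Poly_Mapping.single x c)"
    and add: "\<And>p q. \<lbrakk>Poly_Mapping.keys p \<subseteq> D; Poly_Mapping.keys q \<subseteq> D; P p; P q\<rbrakk> \<Longrightarrow> P (p + q)"
  shows "P p"
proof -
  have *: "Poly_Mapping.keys (\<Sum>x\<in>S. Poly_Mapping.single x (Poly_Mapping.lookup p x)) \<subseteq> D \<and>
      P (\<Sum>x\<in>S. Poly_Mapping.single x (Poly_Mapping.lookup p x))" if "finite S" "S \<subseteq> D" for S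
    using that
  proof (induction S rule: finite_induct)
    case empty
    show ?case using zero by simp
  next
    case (insert x S)
    have "Poly_Mapping.keys (Poly_Mapping.single x (Poly_Mapping.lookup p x)) \<subseteq> D"
      using insert.prems by auto
    moreover have "P (Poly_Mapping.single x (Poly_Mapping.lookup p x))"
      using insert.prems by (auto intro: single)
    ultimately show ?case
      using insert keys_add[of "Poly_Mapping.single x (Poly_Mapping.lookup p x)"
          "\<Sum>x\<in>S. Poly_Mapping.single x (Poly_Mapping.lookup p x)"]
      by (auto intro!: add)
  qed
  have "p = (\<Sum>x\<in>Poly_Mapping.keys p. Poly_Mapping.single x (Poly_Mapping.lookup p x))"
    by (rule poly_mapping_eqI)
      (auto simp: lookup_sum lookup_single when_def in_keys_iff sum.delta)
  then show ?thesis using *[of "Poly_Mapping.keys p"] assms(1) by simp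
qed

lemma poly_mapping_additive_induct [case_names zero single add]:
  fixes p :: "'i \<Rightarrow>\<^sub>0 'k::field"
  assumes "P 0" "\<And>x c. P (Poly_Mapping.single x c)" "\<And>p q. P p \<Longrightarrow> P q \<Longrightarrow> P (p + q)"
  shows "P p"
  using subset_UNIV assms by (rule poly_mapping_keys_induct)

subsection \<open>Vector spaces\<close>

text \<open>Scalars form a whole type here, so the module laws are restated with the type class
  operations of the field; the record operations of \<open>ring_of_type_algebra\<close> then never
  appear in later goals.\<close>

locale vsp = module ring_of_type_algebra V
  for V :: "('k::field, 'v, 'x) module_scheme" (structure)
begin

lemma smult_cl [simp, intro]: "x \<in> carrier V \<Longrightarrow> c \<odot> x \<in> carrier V"
  by simp

lemma smult_ladd: "x \<in> carrier V \<Longrightarrow> (c + d) \<odot> x = c \<odot> x \<oplus> d \<odot> x"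
  using smult_l_distr[of c d x] by simp

lemma smult_radd: "x \<in> carrier V \<Longrightarrow> y \<in> carrier V \<Longrightarrow> c \<odot> (x \<oplus> y) = c \<odot> x \<oplus> c \<odot> y"
  using smult_r_distr[of c x y] by simp

lemma smult_mult: "x \<in> carrier V \<Longrightarrow> (c * d) \<odot> x = c \<odot> (d \<odot> x)"
  using smult_assoc1[of c d x] by simp

lemma smult_1 [simp]: "x \<in> carrier V \<Longrightarrow> 1 \<odot> x = x"
  using smult_one[of x] by simp

lemma smult_0l [simp]: "x \<in> carrier V \<Longrightarrow> 0 \<odot> x = \<zero>"
  using smult_l_null[of x] by simp

lemma smult_0r [simp]: "c \<odot> \<zero> = \<zero>"
  using smult_r_null[of c] by simp

lemma smult_m1: "x \<in> carrier V \<Longrightarrow> (- 1) \<odot> x = \<ominus> x"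
proof -
  assume x: "x \<in> carrier V"
  have "(- 1) \<odot> x \<oplus> x = (- 1 + 1) \<odot> x"
    using x by (subst smult_ladd) auto
  then show ?thesis using x by (simp add: minus_equality)
qed

lemma minus_smult: "x \<in> carrier V \<Longrightarrow> y \<in> carrier V \<Longrightarrow> x \<ominus> y = x \<oplus> (- 1) \<odot> y"
  by (simp add: smult_m1 a_minus_def)

end

lemma (in vsp) minus_eq_zeroD:
  assumes "x \<in> carrier V" "y \<in> carrier V" "x \<ominus> y = \<zero>" shows "x = y"
proof -
  have "x \<ominus> y \<oplus> y = x" using assms(1,2) by (simp add: a_minus_def a_assoc l_neg)
  then show ?thesis using assms by simp
qed

text \<open>Records of different types often carry one and the same vector space:
  \<open>quotient_vspace\<close> and \<open>quotient\<close>, \<open>assoc_vspace\<close> and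
  \<open>assoc_algebra\<close>, \<open>tensor\<close> and \<open>coproduct\<close>. Tensor products
  see only these four fields, so such records may be exchanged inside them. This matters because a
  coaction has to be defined before the record containing it exists.\<close>

definition same_vs :: "('k, 'v, 'x) module_scheme \<Rightarrow> ('k, 'v, 'y) module_scheme \<Rightarrow> bool" where
  "same_vs V W \<longleftrightarrow> carrier V = carrier W \<and> add V = add W \<and> ring.zero V = ring.zero W \<and>
     module.smult V = module.smult W"

lemma vspaceI:
  fixes V :: "('k::field, 'v, 'x) module_scheme" (structure)
  assumes "abelian_group V"
    and "\<And>c x. x \<in> carrier V \<Longrightarrow> c \<odot> x \<in> carrier V"
    and "\<And>c d x. x \<in> carrier V \<Longrightarrow> (c + d) \<odot> x = c \<odot> x \<oplus> d \<odot> x"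
    and "\<And>c x y. x \<in> carrier V \<Longrightarrow> y \<in> carrier V \<Longrightarrow> c \<odot> (x \<oplus> y) = c \<odot> x \<oplus> c \<odot> y"
    and "\<And>c d x. x \<in> carrier V \<Longrightarrow> (c * d) \<odot> x = c \<odot> (d \<odot> x)"
    and "\<And>x. x \<in> carrier V \<Longrightarrow> 1 \<odot> x = x"
  shows "vspace V"
  using assms by (intro moduleI) (auto intro: cring_from_type_algebra)

lemma same_vs_vspace:
  assumes "same_vs V W" "vspace V" shows "vspace W"
proof -
  interpret V: vsp V by (rule vsp.intro) fact
  have eq: "carrier W = carrier V" "add W = add V" "ring.zero W = ring.zero V"
      "module.smult W = module.smult V"
    using assms(1) by (simp_all add: same_vs_def)
  have "abelian_group W"
    by (rule abelian_groupI; unfold eq)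
      (simp_all add: V.a_assoc V.add.l_inv_ex, simp add: V.a_comm)
  then show ?thesis
    by (rule vspaceI; unfold eq)
      (simp_all add: V.smult_ladd V.smult_radd V.smult_mult)
qed

lemma same_vs_linear_maps:
  "same_vs V V' \<Longrightarrow> same_vs W W' \<Longrightarrow> linear_maps V W = linear_maps V' W'"
  by (simp add: linear_maps_def same_vs_def)

lemma same_vs_tensor_null_subset:
  assumes "p \<in> tensor_null V W" "same_vs V V'" "same_vs W W'"
  shows "p \<in> tensor_null V' W'"
  using assms
proof (induction rule: tensor_null.induct)
  case (add_left v v' w)
  then show ?case using tensor_null.add_left[of v V' v' w W'] by (simp add: same_vs_def)
next
  case (add_right v w w')
  then show ?case using tensor_null.add_right[of v V' w W' w'] by (simp add: same_vs_def)
next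
  case (smult_left v w c)
  then show ?case using tensor_null.smult_left[of v V' w W' c] by (simp add: same_vs_def)
next
  case (smult_right v w c)
  then show ?case using tensor_null.smult_right[of v V' w W' c] by (simp add: same_vs_def)
qed (auto intro: tensor_null.intros)

lemma same_vs_refl [simp, intro]: "same_vs V V"
  by (simp add: same_vs_def)

lemma same_vs_sym: "same_vs V W \<Longrightarrow> same_vs W V"
  by (simp add: same_vs_def)

lemma same_vs_tensor_null:
  "same_vs V V' \<Longrightarrow> same_vs W W' \<Longrightarrow> tensor_null V W = tensor_null V' W'"
  using same_vs_tensor_null_subset[of _ V W V' W'] same_vs_tensor_null_subset[of _ V' W' V W]
  by (blast intro: same_vs_sym)

lemma same_vs_pure_tensor:
  "same_vs V V' \<Longrightarrow> same_vs W W' \<Longrightarrow> pure_tensor V W = pure_tensor V' W'"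
  by (simp add: pure_tensor_def tensor_class_def fun_eq_iff same_vs_tensor_null)

lemma same_vs_tensor:
  assumes "same_vs V V'" "same_vs W W'" shows "tensor V W = tensor V' W'"
proof -
  have "tensor_class V W = tensor_class V' W'"
    by (simp add: fun_eq_iff tensor_class_def same_vs_tensor_null[OF assms])
  then show ?thesis
    using assms same_vs_tensor_null[OF assms] by (simp add: tensor_def same_vs_def)
qed

subsection \<open>Linear maps and linear extension\<close>

lemma linear_mapsI:
  assumes "\<And>v. v \<in> carrier V \<Longrightarrow> f v \<in> carrier W"
    and "\<And>v v'. v \<in> carrier V \<Longrightarrow> v' \<in> carrier V \<Longrightarrow> f (v \<oplus>\<^bsub>V\<^esub> v') = f v \<oplus>\<^bsub>W\<^esub> f v'"
    and "\<And>c v. v \<in> carrier V \<Longrightarrow> f (c \<odot>\<^bsub>V\<^esub> v) = c \<odot>\<^bsub>W\<^esub> f v"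
  shows "f \<in> linear_maps V W"
  using assms by (auto simp: linear_maps_def)

lemma linear_maps_closed: "f \<in> linear_maps V W \<Longrightarrow> v \<in> carrier V \<Longrightarrow> f v \<in> carrier W"
  by (auto simp: linear_maps_def)

lemma linear_maps_add:
  "f \<in> linear_maps V W \<Longrightarrow> v \<in> carrier V \<Longrightarrow> v' \<in> carrier V \<Longrightarrow> f (v \<oplus>\<^bsub>V\<^esub> v') = f v \<oplus>\<^bsub>W\<^esub> f v'"
  by (auto simp: linear_maps_def)

lemma linear_maps_smult:
  "f \<in> linear_maps V W \<Longrightarrow> v \<in> carrier V \<Longrightarrow> f (c \<odot>\<^bsub>V\<^esub> v) = c \<odot>\<^bsub>W\<^esub> f v"
  by (auto simp: linear_maps_def)

lemma linear_maps_zero: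
  assumes "vspace V" "vspace W" "f \<in> linear_maps V W"
  shows "f \<zero>\<^bsub>V\<^esub> = \<zero>\<^bsub>W\<^esub>"
proof -
  interpret V: vsp V by (rule vsp.intro) fact
  interpret W: vsp W by (rule vsp.intro) fact
  have "f (0 \<odot>\<^bsub>V\<^esub> \<zero>\<^bsub>V\<^esub>) = 0 \<odot>\<^bsub>W\<^esub> f \<zero>\<^bsub>V\<^esub>"
    using assms(3) by (intro linear_maps_smult) auto
  then show ?thesis using linear_maps_closed[OF assms(3), of "\<zero>\<^bsub>V\<^esub>"] by simp
qed

lemma linear_maps_minus:
  assumes "vspace V" "vspace W" "f \<in> linear_maps V W" "v \<in> carrier V" "v' \<in> carrier V"
  shows "f (v \<ominus>\<^bsub>V\<^esub> v') = f v \<ominus>\<^bsub>W\<^esub> f v'"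
proof -
  interpret V: vsp V by (rule vsp.intro) fact
  interpret W: vsp W by (rule vsp.intro) fact
  show ?thesis using assms linear_maps_closed[OF assms(3)]
    by (simp add: V.minus_smult W.minus_smult linear_maps_add linear_maps_smult)
qed

lemma linear_maps_comp:
  "f \<in> linear_maps V W \<Longrightarrow> g \<in> linear_maps W U \<Longrightarrow> (\<lambda>v. g (f v)) \<in> linear_maps V U"
  by (rule linear_mapsI) (simp_all add: linear_maps_closed linear_maps_add linear_maps_smult)

lemma linear_maps_id: "(\<lambda>v. v) \<in> linear_maps V V"
  by (auto simp: linear_maps_def)

lemma linear_maps_cong:
  assumes "f \<in> linear_maps V W" "\<And>v. v \<in> carrier V \<Longrightarrow> f v = g v" "vspace V"
  shows "g \<in> linear_maps V W"
proof -
  interpret V: vsp V by (rule vsp.intro) fact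
  show ?thesis using assms(1) assms(2)
    by (intro linear_mapsI) (metis linear_maps_closed, metis linear_maps_add V.add.m_closed,
        metis linear_maps_smult V.smult_cl)
qed

lemma linear_maps_smult_left:
  assumes "vspace V" "vspace U" "f \<in> linear_maps V U"
  shows "(\<lambda>v. c \<odot>\<^bsub>U\<^esub> f v) \<in> linear_maps V U"
proof -
  interpret U: vsp U by (rule vsp.intro) fact
  show ?thesis using linear_maps_closed[OF assms(3)] assms(3)
    by (intro linear_mapsI)
      (auto simp: linear_maps_add linear_maps_smult U.smult_radd U.smult_mult[symmetric] mult.commute)
qed

lemma linear_maps_smult_right:
  assumes "vspace V" "vspace U" "f \<in> linear_maps V ground" "u \<in> carrier U"
  shows "(\<lambda>v. f v \<odot>\<^bsub>U\<^esub> u) \<in> linear_maps V U"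
proof -
  interpret U: vsp U by (rule vsp.intro) fact
  show ?thesis using assms(3,4)
    by (intro linear_mapsI)
      (auto simp: linear_maps_add linear_maps_smult U.smult_ladd U.smult_mult ground_def ring.defs module.defs)
qed

text \<open>The common shape of \<open>sweedler\<close>, \<open>coproduct_H\<close> and the coaction
  of \<open>assoc_algebra\<close>: the linear map out of a free vector space prescribed by
  \<open>f\<close> on its basis.\<close>

definition lext :: "('k::field, 'u, 'z) module_scheme \<Rightarrow> ('i \<Rightarrow> 'u) \<Rightarrow> ('i \<Rightarrow>\<^sub>0 'k) \<Rightarrow> 'u" where
  "lext U f p = (\<Oplus>\<^bsub>U\<^esub>x\<in>Poly_Mapping.keys p. Poly_Mapping.lookup p x \<odot>\<^bsub>U\<^esub> f x)"

context vsp
begin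

text \<open>Cancellation may make the support of a sum smaller than the union of the supports;
  padding with zero terms puts all sums over a common index set.\<close>

lemma lext_superset:
  assumes "finite S" "Poly_Mapping.keys p \<subseteq> S" "f \<in> S \<rightarrow> carrier V"
  shows "lext V f p = (\<Oplus>x\<in>S. Poly_Mapping.lookup p x \<odot> f x)"
  unfolding lext_def finsum_def using assms
  by (intro add.finprod_mono_neutral_cong_left[unfolded finsum_def]) (auto simp: in_keys_iff Pi_iff)

lemma lext_closed:
  assumes "Poly_Mapping.keys p \<subseteq> D" "f \<in> D \<rightarrow> carrier V"
  shows "lext V f p \<in> carrier V"
  unfolding lext_def using assms by (intro finsum_closed) auto

lemma lext_add:
  assumes "Poly_Mapping.keys p \<subseteq> D" "Poly_Mapping.keys q \<subseteq> D" "f \<in> D \<rightarrow> carrier V"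
  shows "lext V f (p + q) = lext V f p \<oplus> lext V f q"
proof -
  let ?S = "Poly_Mapping.keys p \<union> Poly_Mapping.keys q"
  have S: "?S \<subseteq> D" and f: "f \<in> ?S \<rightarrow> carrier V" using assms by auto
  have "lext V f (p + q) = (\<Oplus>x\<in>?S. Poly_Mapping.lookup (p + q) x \<odot> f x)"
    using f keys_add[of p q] by (intro lext_superset) auto
  also have "\<dots> = (\<Oplus>x\<in>?S. Poly_Mapping.lookup p x \<odot> f x \<oplus> Poly_Mapping.lookup q x \<odot> f x)"
    by (rule finsum_cong') (use f in \<open>auto simp: lookup_add smult_ladd Pi_iff\<close>)
  also have "\<dots> = lext V f p \<oplus> lext V f q"
    using f by (subst (1 2) lext_superset[of ?S]) (auto intro!: finsum_addf)
  finally show ?thesis .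
qed

lemma lext_single:
  assumes "f x \<in> carrier V"
  shows "lext V f (Poly_Mapping.single x c) = c \<odot> f x"
  using assms by (subst lext_superset[of "{x}"]) auto

lemma lext_zero [simp]: "lext V f 0 = \<zero>"
  by (simp add: lext_def)

lemma lext_pscale:
  assumes "Poly_Mapping.keys p \<subseteq> D" "f \<in> D \<rightarrow> carrier V"
  shows "lext V f (pscale c p) = c \<odot> lext V f p"
  using assms(1)
proof (induction p rule: poly_mapping_keys_induct)
  case zero
  then show ?case by simp
next
  case (single x d)
  then show ?case using assms(2) by (auto simp: lext_single smult_mult Pi_iff)
next
  case (add p q)
  have "lext V f (pscale c p + pscale c q) = lext V f (pscale c p) \<oplus> lext V f (pscale c q)"
    using add.hyps keys_pscale[of c p] keys_pscale[of c q] assms(2)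
    by (intro lext_add[of _ D]) auto
  then show ?case
    using add assms(2) lext_closed[of p D f] lext_closed[of q D f]
    by (simp add: pscale_add lext_add[of _ D] smult_radd)
qed

end

subsection \<open>Tensor products\<close>

definition bilinear_maps ::
  "('k::field, 'v, 'x) module_scheme \<Rightarrow> ('k, 'w, 'y) module_scheme \<Rightarrow> ('k, 'u, 'z) module_scheme
    \<Rightarrow> ('v \<Rightarrow> 'w \<Rightarrow> 'u) set" where
  "bilinear_maps V W U = {f. (\<forall>w\<in>carrier W. (\<lambda>v. f v w) \<in> linear_maps V U) \<and>
     (\<forall>v\<in>carrier V. f v \<in> linear_maps W U)}"

lemma bilinear_mapsI:
  assumes "\<And>w. w \<in> carrier W \<Longrightarrow> (\<lambda>v. f v w) \<in> linear_maps V U"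
    and "\<And>v. v \<in> carrier V \<Longrightarrow> f v \<in> linear_maps W U"
  shows "f \<in> bilinear_maps V W U"
  using assms by (auto simp: bilinear_maps_def)

lemma bilinear_maps_left: "f \<in> bilinear_maps V W U \<Longrightarrow> w \<in> carrier W \<Longrightarrow> (\<lambda>v. f v w) \<in> linear_maps V U"
  by (auto simp: bilinear_maps_def)

lemma bilinear_maps_right: "f \<in> bilinear_maps V W U \<Longrightarrow> v \<in> carrier V \<Longrightarrow> f v \<in> linear_maps W U"
  by (auto simp: bilinear_maps_def)

lemma bilinear_maps_closed:
  "f \<in> bilinear_maps V W U \<Longrightarrow> v \<in> carrier V \<Longrightarrow> w \<in> carrier W \<Longrightarrow> f v w \<in> carrier U"
  using bilinear_maps_right linear_maps_closed by metis

lemma bilinear_maps_comp: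
  assumes "f \<in> bilinear_maps V W U" "L \<in> linear_maps U U'"
  shows "(\<lambda>v w. L (f v w)) \<in> bilinear_maps V W U'"
  using assms
  by (intro bilinear_mapsI)
    (auto intro: linear_maps_comp[OF bilinear_maps_left] linear_maps_comp[OF bilinear_maps_right])

section \<open>Tensors as cosets: vector space laws and induction on pure tensors\<close>

locale tens = V: vsp V + W: vsp W
  for V :: "('k::field, 'v, 'x) module_scheme" and W :: "('k, 'w, 'y) module_scheme"
begin

abbreviation cc :: "('v \<times> 'w) set" where "cc \<equiv> carrier V \<times> carrier W"

text \<open>Keeps all representatives of a tensor supported on pairs of carrier elements. Outside
  these pairs nothing is known about a bilinear map, so its linear extension could not be controlled
  there.\<close>

lemma null_keys: "p \<in> tensor_null V W \<Longrightarrow> Poly_Mapping.keys p \<subseteq> cc"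
proof (induction rule: tensor_null.induct)
  case (add_left v v' w)
  let ?s = "\<lambda>v w. Poly_Mapping.single (v, w) (1::'k)"
  show ?case
    using add_left keys_diff'[of "?s (v \<oplus>\<^bsub>V\<^esub> v') w - ?s v w" "?s v' w"] keys_diff'[of "?s (v \<oplus>\<^bsub>V\<^esub> v') w" "?s v w"]
    by auto
next
  case (add_right v w w')
  let ?s = "\<lambda>v w. Poly_Mapping.single (v, w) (1::'k)"
  show ?case
    using add_right keys_diff'[of "?s v (w \<oplus>\<^bsub>W\<^esub> w') - ?s v w" "?s v w'"] keys_diff'[of "?s v (w \<oplus>\<^bsub>W\<^esub> w')" "?s v w"]
    by auto
next
  case (smult_left v w c)
  then show ?case
    using keys_diff'[of "Poly_Mapping.single (c \<odot>\<^bsub>V\<^esub> v, w) 1" "Poly_Mapping.single (v, w) c"]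
    by (auto split: if_splits)
next
  case (smult_right v w c)
  then show ?case
    using keys_diff'[of "Poly_Mapping.single (v, c \<odot>\<^bsub>W\<^esub> w) 1" "Poly_Mapping.single (v, w) c"]
    by (auto split: if_splits)
next
  case (add p q)
  then show ?case using keys_add[of p q] by auto
next
  case (scale p c)
  then show ?case using keys_pscale[of c p] by auto
qed auto

lemma null_uminus: "p \<in> tensor_null V W \<Longrightarrow> - p \<in> tensor_null V W"
  using tensor_null.scale[of p V W "- 1"] by (simp add: pscale_minus_one)

lemma null_diff: "p \<in> tensor_null V W \<Longrightarrow> q \<in> tensor_null V W \<Longrightarrow> p - q \<in> tensor_null V W"
  using tensor_null.add[of p V W "- q"] null_uminus[of q] by simp

lemma mem_class: "x \<in> tensor_class V W p \<longleftrightarrow> x - p \<in> tensor_null V W"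
proof
  assume "x - p \<in> tensor_null V W"
  then show "x \<in> tensor_class V W p" by (auto simp: tensor_class_def intro!: exI[of _ "x - p"])
qed (auto simp: tensor_class_def)

lemma self_class: "p \<in> tensor_class V W p"
  by (simp add: mem_class tensor_null.zero)

lemma class_eq_iff: "tensor_class V W p = tensor_class V W q \<longleftrightarrow> p - q \<in> tensor_null V W"
proof
  assume "tensor_class V W p = tensor_class V W q"
  then show "p - q \<in> tensor_null V W" using self_class[of p] by (simp add: mem_class)
next
  assume pq: "p - q \<in> tensor_null V W"
  have "x - p \<in> tensor_null V W \<longleftrightarrow> x - q \<in> tensor_null V W" for x
    using tensor_null.add[OF _ pq, of "x - p"] null_diff[OF _ pq, of "x - q"] by auto
  then show "tensor_class V W p = tensor_class V W q" by (auto simp: mem_class)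
qed

lemma tensor_carrierE:
  assumes "S \<in> carrier (tensor V W)"
  obtains p where "S = tensor_class V W p" "Poly_Mapping.keys p \<subseteq> cc"
  using assms by (auto simp: tensor_def)

lemma class_carrier: "Poly_Mapping.keys p \<subseteq> cc \<Longrightarrow> tensor_class V W p \<in> carrier (tensor V W)"
  by (auto simp: tensor_def)

lemma class_add: "tensor_class V W p \<oplus>\<^bsub>tensor V W\<^esub> tensor_class V W q = tensor_class V W (p + q)"
proof -
  have "z \<in> tensor_class V W (p + q) \<longleftrightarrow> (\<exists>x y. z = x + y \<and> x \<in> tensor_class V W p \<and> y \<in> tensor_class V W q)" for z
  proof
    assume "z \<in> tensor_class V W (p + q)"
    then show "\<exists>x y. z = x + y \<and> x \<in> tensor_class V W p \<and> y \<in> tensor_class V W q"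
      by (rule_tac exI[of _ "z - q"], rule_tac exI[of _ q])
        (simp add: mem_class tensor_null.zero diff_diff_eq2 add.commute diff_diff_eq)
  next
    assume "\<exists>x y. z = x + y \<and> x \<in> tensor_class V W p \<and> y \<in> tensor_class V W q"
    then obtain x y where "z = x + y" "x - p \<in> tensor_null V W" "y - q \<in> tensor_null V W"
      by (auto simp: mem_class)
    then show "z \<in> tensor_class V W (p + q)"
      using tensor_null.add[of "x - p" V W "y - q"] by (simp add: mem_class algebra_simps)
  qed
  then show ?thesis by (auto simp: tensor_def)
qed

lemma class_smult: "c \<odot>\<^bsub>tensor V W\<^esub> tensor_class V W p = tensor_class V W (pscale c p)"
proof -
  have "tensor_class V W (pscale c x) = tensor_class V W (pscale c p)" if "x \<in> tensor_class V W p" for x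
  proof -
    have "pscale c x - pscale c p = pscale c (x - p)"
      by (rule poly_mapping_eqI) (simp add: lookup_minus algebra_simps)
    then show ?thesis using that tensor_null.scale[of "x - p" V W c]
      by (simp add: class_eq_iff mem_class)
  qed
  then have "(\<Union>x\<in>tensor_class V W p. tensor_class V W (pscale c x)) = tensor_class V W (pscale c p)"
    using self_class[of p] by blast
  then show ?thesis by (simp add: tensor_def)
qed

lemma class_zero: "\<zero>\<^bsub>tensor V W\<^esub> = tensor_class V W 0"
  by (auto simp: tensor_def mem_class)

lemma vspace_tensor: "vspace (tensor V W)"
proof (rule vspaceI)
  show "abelian_group (tensor V W)"
  proof (rule abelian_groupI)
    fix S T assume "S \<in> carrier (tensor V W)" "T \<in> carrier (tensor V W)"
    then obtain p q where "S = tensor_class V W p" "T = tensor_class V W q"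
      "Poly_Mapping.keys p \<subseteq> cc" "Poly_Mapping.keys q \<subseteq> cc" by (metis tensor_carrierE)
    then show "S \<oplus>\<^bsub>tensor V W\<^esub> T \<in> carrier (tensor V W)"
        and "S \<oplus>\<^bsub>tensor V W\<^esub> T = T \<oplus>\<^bsub>tensor V W\<^esub> S"
      using keys_add[of p q] by (auto simp: class_add add.commute intro!: class_carrier)
  next
    show "\<zero>\<^bsub>tensor V W\<^esub> \<in> carrier (tensor V W)"
      by (auto simp: class_zero intro!: class_carrier)
  next
    fix S assume "S \<in> carrier (tensor V W)"
    then obtain p where p: "S = tensor_class V W p" "Poly_Mapping.keys p \<subseteq> cc" by (metis tensor_carrierE)
    then show "\<zero>\<^bsub>tensor V W\<^esub> \<oplus>\<^bsub>tensor V W\<^esub> S = S" by (simp add: class_zero class_add)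
    show "\<exists>T\<in>carrier (tensor V W). T \<oplus>\<^bsub>tensor V W\<^esub> S = \<zero>\<^bsub>tensor V W\<^esub>"
      using p by (intro bexI[of _ "tensor_class V W (- p)"])
        (auto simp: class_zero class_add keys_minus' intro!: class_carrier)
  next
    fix S T Z assume "S \<in> carrier (tensor V W)" "T \<in> carrier (tensor V W)" "Z \<in> carrier (tensor V W)"
    then show "S \<oplus>\<^bsub>tensor V W\<^esub> T \<oplus>\<^bsub>tensor V W\<^esub> Z = S \<oplus>\<^bsub>tensor V W\<^esub> (T \<oplus>\<^bsub>tensor V W\<^esub> Z)"
      by (auto elim!: tensor_carrierE simp: class_add add.assoc)
  qed
next
  fix c d S assume "S \<in> carrier (tensor V W)"
  then obtain p where p: "S = tensor_class V W p" "Poly_Mapping.keys p \<subseteq> cc" by (metis tensor_carrierE)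
  then show "c \<odot>\<^bsub>tensor V W\<^esub> S \<in> carrier (tensor V W)"
    using keys_pscale[of c p] by (auto simp: class_smult intro!: class_carrier)
  show "(c + d) \<odot>\<^bsub>tensor V W\<^esub> S = c \<odot>\<^bsub>tensor V W\<^esub> S \<oplus>\<^bsub>tensor V W\<^esub> d \<odot>\<^bsub>tensor V W\<^esub> S"
    by (simp add: p class_smult class_add pscale_add_left)
  show "(c * d) \<odot>\<^bsub>tensor V W\<^esub> S = c \<odot>\<^bsub>tensor V W\<^esub> (d \<odot>\<^bsub>tensor V W\<^esub> S)"
    by (simp add: p class_smult pscale_pscale)
  show "1 \<odot>\<^bsub>tensor V W\<^esub> S = S"
    by (simp add: p class_smult)
next
  fix c S T assume "S \<in> carrier (tensor V W)" "T \<in> carrier (tensor V W)"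
  then show "c \<odot>\<^bsub>tensor V W\<^esub> (S \<oplus>\<^bsub>tensor V W\<^esub> T) = c \<odot>\<^bsub>tensor V W\<^esub> S \<oplus>\<^bsub>tensor V W\<^esub> c \<odot>\<^bsub>tensor V W\<^esub> T"
    by (auto elim!: tensor_carrierE simp: class_add class_smult pscale_add)
qed

lemma pure_tensor_closed: "v \<in> carrier V \<Longrightarrow> w \<in> carrier W \<Longrightarrow> pure_tensor V W v w \<in> carrier (tensor V W)"
  by (auto simp: pure_tensor_def intro!: class_carrier)

lemma pure_tensor_bilinear: "pure_tensor V W \<in> bilinear_maps V W (tensor V W)"
proof (intro bilinear_mapsI linear_mapsI)
  fix v v' w assume *: "v \<in> carrier V" "v' \<in> carrier V" "w \<in> carrier W"
  show "pure_tensor V W (v \<oplus>\<^bsub>V\<^esub> v') w = pure_tensor V W v w \<oplus>\<^bsub>tensor V W\<^esub> pure_tensor V W v' w"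
    using tensor_null.add_left[OF *] by (simp add: pure_tensor_def class_add class_eq_iff diff_diff_eq)
next
  fix v w w' assume *: "v \<in> carrier V" "w \<in> carrier W" "w' \<in> carrier W"
  show "pure_tensor V W v (w \<oplus>\<^bsub>W\<^esub> w') = pure_tensor V W v w \<oplus>\<^bsub>tensor V W\<^esub> pure_tensor V W v w'"
    using tensor_null.add_right[OF *] by (simp add: pure_tensor_def class_add class_eq_iff diff_diff_eq)
next
  fix v w c assume *: "v \<in> carrier V" "w \<in> carrier W"
  show "pure_tensor V W (c \<odot>\<^bsub>V\<^esub> v) w = c \<odot>\<^bsub>tensor V W\<^esub> pure_tensor V W v w"
    using tensor_null.smult_left[OF *] by (simp add: pure_tensor_def class_smult class_eq_iff)
  show "pure_tensor V W v (c \<odot>\<^bsub>W\<^esub> w) = c \<odot>\<^bsub>tensor V W\<^esub> pure_tensor V W v w"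
    using tensor_null.smult_right[OF *] by (simp add: pure_tensor_def class_smult class_eq_iff)
qed (auto intro: pure_tensor_closed)

lemmas pure_left = bilinear_maps_left[OF pure_tensor_bilinear]
text \<open>A scalar can be absorbed into the left factor, and zero is itself a pure tensor; hence
  neither a scalar case nor a zero case is needed.\<close>

lemma tensor_induct [consumes 1, case_names pure add]:
  assumes "S \<in> carrier (tensor V W)"
    and pure: "\<And>v w. v \<in> carrier V \<Longrightarrow> w \<in> carrier W \<Longrightarrow> P (pure_tensor V W v w)"
    and add: "\<And>S T. \<lbrakk>S \<in> carrier (tensor V W); T \<in> carrier (tensor V W); P S; P T\<rbrakk>
      \<Longrightarrow> P (S \<oplus>\<^bsub>tensor V W\<^esub> T)"
  shows "P S"
proof -
  have single: "P (tensor_class V W (Poly_Mapping.single x c))" if cc: "x \<in> cc" for x c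
  proof -
    obtain v w where x: "x = (v, w)" "v \<in> carrier V" "w \<in> carrier W" using cc by auto
    then have "tensor_class V W (Poly_Mapping.single x c) = pure_tensor V W (c \<odot>\<^bsub>V\<^esub> v) w"
      using linear_maps_smult[OF pure_left[OF x(3)] x(2), of c]
      by (simp add: pure_tensor_def class_smult)
    then show ?thesis using x by (auto intro: pure)
  qed
  have "P (tensor_class V W p)" if "Poly_Mapping.keys p \<subseteq> cc" for p
    using that
  proof (induction p rule: poly_mapping_keys_induct)
    case zero
    show ?case using single[of "(\<zero>\<^bsub>V\<^esub>, \<zero>\<^bsub>W\<^esub>)" 0] by simp
  next
    case (add p q)
    then show ?case using assms(3)[of "tensor_class V W p" "tensor_class V W q"]
      by (simp add: class_add class_carrier)
  qed (rule single)
  then show ?thesis using assms(1) by (auto elim!: tensor_carrierE)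
qed

lemma linear_maps_tensor_eqI:
  assumes "S \<in> carrier (tensor V W)" "f \<in> linear_maps (tensor V W) U" "g \<in> linear_maps (tensor V W) U"
    and "\<And>v w. v \<in> carrier V \<Longrightarrow> w \<in> carrier W \<Longrightarrow> f (pure_tensor V W v w) = g (pure_tensor V W v w)"
  shows "f S = g S"
  using assms(1) by (induction rule: tensor_induct)
    (simp_all add: assms linear_maps_add[OF assms(2)] linear_maps_add[OF assms(3)])

end

section \<open>The universal property of the tensor product and the meaning of Sweedler sums\<close>

locale tens3 = tens V W + U: vsp U
  for V :: "('k::field, 'v, 'x) module_scheme" and W :: "('k, 'w, 'y) module_scheme"
    and U :: "('k, 'u, 'z) module_scheme"
begin

text \<open>Each generator of \<open>tensor_null\<close> is an instance of a bilinearity law, so a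
  bilinear map sends it to zero; sums and multiples follow by linearity. This is the universal
  property of the tensor product.\<close>

lemma lext_null:
  assumes f: "f \<in> bilinear_maps V W U" and p: "p \<in> tensor_null V W"
  shows "lext U (\<lambda>x. f (fst x) (snd x)) p = \<zero>\<^bsub>U\<^esub>"
proof -
  let ?f = "\<lambda>x. f (fst x) (snd x)"
  have fc: "?f \<in> cc \<rightarrow> carrier U"
    by (auto intro: bilinear_maps_closed[OF f])
  have diff: "lext U ?f (p - q) = lext U ?f p \<ominus>\<^bsub>U\<^esub> lext U ?f q"
    if "Poly_Mapping.keys p \<subseteq> cc" "Poly_Mapping.keys q \<subseteq> cc" for p q
  proof -
    have "p - q = p + pscale (- 1) q" by (simp add: pscale_minus_one)
    then have "lext U ?f (p - q) = lext U ?f p \<oplus>\<^bsub>U\<^esub> lext U ?f (pscale (- 1) q)"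
      using that keys_pscale[of "- 1" q] fc by (simp only:) (intro U.lext_add[of _ cc], auto)
    then show ?thesis using that fc U.lext_closed[OF that(1) fc] U.lext_closed[OF that(2) fc]
      by (simp add: U.lext_pscale[of _ cc] U.minus_smult)
  qed
  have s: "lext U ?f (Poly_Mapping.single (v, w) c) = c \<odot>\<^bsub>U\<^esub> f v w"
    if "v \<in> carrier V" "w \<in> carrier W" for v w c
    using that bilinear_maps_closed[OF f] by (subst U.lext_single) auto
  have k: "Poly_Mapping.keys (Poly_Mapping.single (v, w) (c::'k)) \<subseteq> cc"
    if "v \<in> carrier V" "w \<in> carrier W" for v w c using that by auto
  have kd: "Poly_Mapping.keys (p - q) \<subseteq> cc" if "Poly_Mapping.keys p \<subseteq> cc" "Poly_Mapping.keys q \<subseteq> cc"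
    for p q :: "'v \<times> 'w \<Rightarrow>\<^sub>0 'k" using that keys_diff'[of p q] by auto
  note c = bilinear_maps_closed[OF f]
  have cancel: "a \<oplus>\<^bsub>U\<^esub> b \<ominus>\<^bsub>U\<^esub> a \<ominus>\<^bsub>U\<^esub> b = \<zero>\<^bsub>U\<^esub>" if "a \<in> carrier U" "b \<in> carrier U" for a b
    using that by (simp add: a_minus_def U.a_comm[of a b] U.a_assoc U.r_neg)
  from p show ?thesis
  proof (induction rule: tensor_null.induct)
    case (add_left v v' w)
    then show ?case using linear_maps_add[OF bilinear_maps_left[OF f]] c
      by (simp add: diff k kd s cancel)
  next
    case (add_right v w w')
    then show ?case using linear_maps_add[OF bilinear_maps_right[OF f]] c
      by (simp add: diff k kd s cancel)
  next
    case (smult_left v w b)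
    then show ?case using linear_maps_smult[OF bilinear_maps_left[OF f]] c
      by (simp add: diff k kd s a_minus_def U.r_neg)
  next
    case (smult_right v w b)
    then show ?case using linear_maps_smult[OF bilinear_maps_right[OF f]] c
      by (simp add: diff k kd s a_minus_def U.r_neg)
  next
    case (add p q)
    then show ?case using fc null_keys by (simp add: U.lext_add[of _ cc])
  next
    case (scale p b)
    then show ?case using fc null_keys by (simp add: U.lext_pscale[of _ cc])
  qed auto
qed

text \<open>The representative chosen by \<open>SOME\<close> differs from \<open>p\<close> by an
  element of \<open>tensor_null\<close>, on which the linear extension vanishes by
  \<open>lext_null\<close>.\<close>

lemma sweedler_class:
  assumes f: "f \<in> bilinear_maps V W U" and p: "Poly_Mapping.keys p \<subseteq> cc"
  shows "sweedler U (tensor_class V W p) f = lext U (\<lambda>x. f (fst x) (snd x)) p"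
proof -
  let ?f = "\<lambda>x. f (fst x) (snd x)"
  have fc: "?f \<in> cc \<rightarrow> carrier U"
    by (auto intro: bilinear_maps_closed[OF f])
  define q where "q = (SOME q. q \<in> tensor_class V W p)"
  have "q \<in> tensor_class V W p" unfolding q_def using self_class[of p] by (rule someI)
  then have n: "q - p \<in> tensor_null V W" by (simp add: mem_class)
  have "lext U ?f (p + (q - p)) = lext U ?f p \<oplus>\<^bsub>U\<^esub> lext U ?f (q - p)"
    using p null_keys[OF n] fc by (intro U.lext_add[of _ cc])
  then have "lext U ?f q = lext U ?f p"
    using lext_null[OF f n] U.lext_closed[OF p fc] by simp
  then show ?thesis by (simp add: sweedler_def q_def lext_def Let_def)
qed

lemma sweedler_pure:
  assumes f: "f \<in> bilinear_maps V W U" and "v \<in> carrier V" "w \<in> carrier W"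
  shows "sweedler U (pure_tensor V W v w) f = f v w"
  unfolding pure_tensor_def using assms bilinear_maps_closed[OF f]
  by (subst sweedler_class) (auto simp: U.lext_single)

lemma sweedler_linear:
  assumes f: "f \<in> bilinear_maps V W U"
  shows "(\<lambda>S. sweedler U S f) \<in> linear_maps (tensor V W) U"
proof -
  let ?f = "\<lambda>x. f (fst x) (snd x)"
  have fc: "?f \<in> cc \<rightarrow> carrier U"
    by (auto intro: bilinear_maps_closed[OF f])
  show ?thesis
  proof (rule linear_mapsI)
    fix S assume "S \<in> carrier (tensor V W)"
    then show "sweedler U S f \<in> carrier U"
      using U.lext_closed[OF _ fc] by (auto elim!: tensor_carrierE simp: sweedler_class[OF f])
  next
    fix S T assume "S \<in> carrier (tensor V W)" "T \<in> carrier (tensor V W)"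
    then obtain p q where "S = tensor_class V W p" "T = tensor_class V W q"
      "Poly_Mapping.keys p \<subseteq> cc" "Poly_Mapping.keys q \<subseteq> cc" by (metis tensor_carrierE)
    moreover from this have "Poly_Mapping.keys (p + q) \<subseteq> cc" using keys_add[of p q] by auto
    ultimately show "sweedler U (S \<oplus>\<^bsub>tensor V W\<^esub> T) f = sweedler U S f \<oplus>\<^bsub>U\<^esub> sweedler U T f"
      using fc by (simp add: class_add sweedler_class[OF f] U.lext_add[of _ cc])
  next
    fix c S assume "S \<in> carrier (tensor V W)"
    then obtain p where "S = tensor_class V W p" "Poly_Mapping.keys p \<subseteq> cc" by (metis tensor_carrierE)
    moreover from this have "Poly_Mapping.keys (pscale c p) \<subseteq> cc" using keys_pscale[of c p] by auto
    ultimately show "sweedler U (c \<odot>\<^bsub>tensor V W\<^esub> S) f = c \<odot>\<^bsub>U\<^esub> sweedler U S f"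
      using fc by (simp add: class_smult sweedler_class[OF f] U.lext_pscale[of _ cc])
  qed
qed

end

section \<open>Calculus of Sweedler sums with explicit vector space hypotheses\<close>

lemma vspace_tensor: "vspace V \<Longrightarrow> vspace W \<Longrightarrow> vspace (tensor V W)"
  by (intro tens.vspace_tensor tens.intro vsp.intro)

lemma pure_tensor_bilinear:
  "vspace V \<Longrightarrow> vspace W \<Longrightarrow> pure_tensor V W \<in> bilinear_maps V W (tensor V W)"
  by (intro tens.pure_tensor_bilinear tens.intro vsp.intro)

lemma pure_tensor_closed:
  "vspace V \<Longrightarrow> vspace W \<Longrightarrow> v \<in> carrier V \<Longrightarrow> w \<in> carrier W \<Longrightarrow>
    pure_tensor V W v w \<in> carrier (tensor V W)"
  by (intro tens.pure_tensor_closed tens.intro vsp.intro)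

lemma sweedler_pure:
  assumes "vspace V" "vspace W" "vspace U" "f \<in> bilinear_maps V W U" "v \<in> carrier V" "w \<in> carrier W"
  shows "sweedler U (pure_tensor V W v w) f = f v w"
proof -
  interpret tens3 V W U
    using assms by (intro tens3.intro tens.intro vsp.intro)
  show ?thesis using assms(4-) by (rule sweedler_pure)
qed

lemma sweedler_linear:
  assumes "vspace V" "vspace W" "vspace U" "f \<in> bilinear_maps V W U"
  shows "(\<lambda>S. sweedler U S f) \<in> linear_maps (tensor V W) U"
proof -
  interpret tens3 V W U
    using assms by (intro tens3.intro tens.intro vsp.intro)
  show ?thesis using assms(4-) by (rule sweedler_linear)
qed

lemma sweedler_closed:
  assumes "vspace V" "vspace W" "vspace U" "f \<in> bilinear_maps V W U" "S \<in> carrier (tensor V W)"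
  shows "sweedler U S f \<in> carrier U"
  using sweedler_linear[OF assms(1-4)] assms(5) by (rule linear_maps_closed)

text \<open>Both sides are linear in \<open>S\<close> and agree on pure tensors. This moves linear
  maps in and out of Sweedler notation.\<close>

lemma sweedler_commute:
  assumes "vspace V" "vspace W" "vspace U" "vspace U'" "f \<in> bilinear_maps V W U"
    "L \<in> linear_maps U U'" "S \<in> carrier (tensor V W)"
  shows "L (sweedler U S f) = sweedler U' S (\<lambda>v w. L (f v w))"
proof -
  interpret tens V W
    using assms by (intro tens.intro vsp.intro)
  note b = bilinear_maps_comp[OF assms(5,6)]
  show ?thesis
    using assms(7) linear_maps_comp[OF sweedler_linear[OF assms(1,2,3,5)] assms(6)]
      sweedler_linear[OF assms(1,2,4) b]
    by (rule linear_maps_tensor_eqI) (simp add: sweedler_pure[OF assms(1,2,3,5)] sweedler_pure[OF assms(1,2,4) b])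
qed

text \<open>Linearity in a parameter of the summand, with the tensor \<open>S\<close> fixed;
  \<open>sweedler_linear\<close> is the complementary statement. Nested Sweedler sums need both.
  Induction on \<open>S\<close> reduces the claim to pure tensors, where the sum is a single value
  \<open>f x v w\<close>.\<close>

lemma linear_maps_sweedler_fun:
  assumes "vspace V" "vspace W" "vspace U" "vspace Y" "S \<in> carrier (tensor V W)"
    and f: "\<And>x. x \<in> carrier Y \<Longrightarrow> f x \<in> bilinear_maps V W U"
    and l: "\<And>v w. v \<in> carrier V \<Longrightarrow> w \<in> carrier W \<Longrightarrow> (\<lambda>x. f x v w) \<in> linear_maps Y U"
  shows "(\<lambda>x. sweedler U S (f x)) \<in> linear_maps Y U"
proof -
  interpret tens V W
    using assms by (intro tens.intro vsp.intro)
  interpret U: vsp U using assms by (intro vsp.intro)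
  interpret Y: vsp Y using assms by (intro vsp.intro)
  have s: "sweedler U (pure_tensor V W v w) (f x) = f x v w"
    if "x \<in> carrier Y" "v \<in> carrier V" "w \<in> carrier W" for x v w
    using assms f that by (intro sweedler_pure)
  have lin: "(\<lambda>S. sweedler U S (f x)) \<in> linear_maps (tensor V W) U" if "x \<in> carrier Y" for x
    using assms f that by (intro sweedler_linear)
  show ?thesis
  proof (rule linear_mapsI)
    fix x assume "x \<in> carrier Y"
    then show "sweedler U S (f x) \<in> carrier U"
      using assms f by (intro sweedler_closed)
  next
    fix x y assume xy: "x \<in> carrier Y" "y \<in> carrier Y"
    from assms(5) show "sweedler U S (f (x \<oplus>\<^bsub>Y\<^esub> y)) = sweedler U S (f x) \<oplus>\<^bsub>U\<^esub> sweedler U S (f y)"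
    proof (induction rule: tensor_induct)
      case (pure v w)
      then show ?case using xy s linear_maps_add[OF l] by simp
    next
      case (add S T)
      have *: "\<And>z R. z \<in> carrier Y \<Longrightarrow> R \<in> carrier (tensor V W) \<Longrightarrow> sweedler U R (f z) \<in> carrier U"
        using linear_maps_closed[OF lin] .
      show ?case using xy add *[of x] *[of y]
        by (simp add: linear_maps_add[OF lin] U.add.m_ac)
    qed
  next
    fix c x assume x: "x \<in> carrier Y"
    from assms(5) show "sweedler U S (f (c \<odot>\<^bsub>Y\<^esub> x)) = c \<odot>\<^bsub>U\<^esub> sweedler U S (f x)"
    proof (induction rule: tensor_induct)
      case (pure v w)
      then show ?case using x s linear_maps_smult[OF l] by simp
    next
      case (add S T)
      then show ?case using x linear_maps_closed[OF lin]
        by (simp add: linear_maps_add[OF lin] U.smult_radd)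
    qed
  qed
qed

lemma linear_maps_sweedler_arg:
  assumes "vspace V" "vspace W" "vspace U" "f \<in> bilinear_maps V W U" "L \<in> linear_maps Y (tensor V W)"
  shows "(\<lambda>x. sweedler U (L x) f) \<in> linear_maps Y U"
  using linear_maps_comp[OF assms(5) sweedler_linear[OF assms(1-4)]] .

lemma bilinear_maps_smult: 
  assumes "vspace V" "vspace U" "\<phi> \<in> linear_maps V ground" "L \<in> linear_maps W U" "vspace W"
  shows "(\<lambda>v w. \<phi> v \<odot>\<^bsub>U\<^esub> L w) \<in> bilinear_maps V W U"
  using assms
  by (intro bilinear_mapsI linear_maps_smult_right linear_maps_smult_left) (auto intro: linear_maps_closed)

text \<open>Only agreement on the carriers is available when a summand is rewritten; bilinearity of
  \<open>g\<close> is then inherited from \<open>f\<close>.\<close>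

lemma sweedler_cong:
  assumes "vspace V" "vspace W" "vspace U" "f \<in> bilinear_maps V W U" "S \<in> carrier (tensor V W)"
    and eq: "\<And>v w. v \<in> carrier V \<Longrightarrow> w \<in> carrier W \<Longrightarrow> f v w = g v w"
  shows "sweedler U S f = sweedler U S g"
proof -
  interpret tens V W using assms by (intro tens.intro vsp.intro)
  have g: "g \<in> bilinear_maps V W U"
  proof (rule bilinear_mapsI)
    fix w assume w: "w \<in> carrier W"
    show "(\<lambda>v. g v w) \<in> linear_maps V U"
      using bilinear_maps_left[OF assms(4) w] by (rule linear_maps_cong) (simp_all add: eq w assms(1))
  next
    fix v assume v: "v \<in> carrier V"
    show "g v \<in> linear_maps W U"
      using bilinear_maps_right[OF assms(4) v] by (rule linear_maps_cong) (simp_all add: eq v assms(2))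
  qed
  show ?thesis
    using assms(5) sweedler_linear[OF assms(1-4)] sweedler_linear[OF assms(1-3) g]
    by (rule linear_maps_tensor_eqI) (simp add: sweedler_pure[OF assms(1-4)] sweedler_pure[OF assms(1-3) g] eq)
qed

lemma linear_maps_pure_left:
  assumes "vspace V" "vspace W" "f \<in> linear_maps Y V" "w \<in> carrier W"
  shows "(\<lambda>y. pure_tensor V W (f y) w) \<in> linear_maps Y (tensor V W)"
  using linear_maps_comp[OF assms(3) bilinear_maps_left[OF pure_tensor_bilinear[OF assms(1,2)] assms(4)]] .

lemma linear_maps_pure_right:
  assumes "vspace V" "vspace W" "f \<in> linear_maps Y W" "v \<in> carrier V"
  shows "(\<lambda>y. pure_tensor V W v (f y)) \<in> linear_maps Y (tensor V W)"
  using linear_maps_comp[OF assms(3) bilinear_maps_right[OF pure_tensor_bilinear[OF assms(1,2)] assms(4)]] .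

lemma pure_tensor_smult_left:
  assumes "vspace V" "vspace W" "v \<in> carrier V" "w \<in> carrier W"
  shows "pure_tensor V W (c \<odot>\<^bsub>V\<^esub> v) w = c \<odot>\<^bsub>tensor V W\<^esub> pure_tensor V W v w"
  using linear_maps_smult[OF bilinear_maps_left[OF pure_tensor_bilinear[OF assms(1,2)] assms(4)] assms(3)] .

lemma pure_tensor_smult_right:
  assumes "vspace V" "vspace W" "v \<in> carrier V" "w \<in> carrier W"
  shows "pure_tensor V W v (c \<odot>\<^bsub>W\<^esub> w) = c \<odot>\<^bsub>tensor V W\<^esub> pure_tensor V W v w"
  using linear_maps_smult[OF bilinear_maps_right[OF pure_tensor_bilinear[OF assms(1,2)] assms(3)] assms(4)] .

lemma linear_maps_tensor_eqI:
  assumes "vspace V" "vspace W"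
    and "S \<in> carrier (tensor V W)" "f \<in> linear_maps (tensor V W) U" "g \<in> linear_maps (tensor V W) U"
    and "\<And>v w. v \<in> carrier V \<Longrightarrow> w \<in> carrier W \<Longrightarrow> f (pure_tensor V W v w) = g (pure_tensor V W v w)"
  shows "f S = g S"
proof -
  interpret tens V W using assms by (intro tens.intro vsp.intro)
  show ?thesis using assms(3-) by (rule linear_maps_tensor_eqI)
qed

subsection \<open>Iterated Sweedler sums\<close>

text \<open>Multilinearity of the summand of a doubly nested Sweedler sum: the first two arguments
  are the legs of the outer tensor, the last two those of the inner one. Multiplicativity of a
  coaction, braided commutativity and both operations of the coproduct are identities between such
  sums.\<close>

definition quadlin where
  "quadlin V1 V2 W1 W2 U = {K.
     (\<forall>b\<in>carrier V2. \<forall>c\<in>carrier W1. \<forall>d\<in>carrier W2. (\<lambda>a. K a b c d) \<in> linear_maps V1 U) \<and>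
     (\<forall>a\<in>carrier V1. \<forall>c\<in>carrier W1. \<forall>d\<in>carrier W2. (\<lambda>b. K a b c d) \<in> linear_maps V2 U) \<and>
     (\<forall>a\<in>carrier V1. \<forall>b\<in>carrier V2. \<forall>d\<in>carrier W2. (\<lambda>c. K a b c d) \<in> linear_maps W1 U) \<and>
     (\<forall>a\<in>carrier V1. \<forall>b\<in>carrier V2. \<forall>c\<in>carrier W1. (\<lambda>d. K a b c d) \<in> linear_maps W2 U)}"

lemma quadlinI:
  assumes "\<And>b c d. b \<in> carrier V2 \<Longrightarrow> c \<in> carrier W1 \<Longrightarrow> d \<in> carrier W2 \<Longrightarrow> (\<lambda>a. K a b c d) \<in> linear_maps V1 U"
    "\<And>a c d. a \<in> carrier V1 \<Longrightarrow> c \<in> carrier W1 \<Longrightarrow> d \<in> carrier W2 \<Longrightarrow> (\<lambda>b. K a b c d) \<in> linear_maps V2 U"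
    "\<And>a b d. a \<in> carrier V1 \<Longrightarrow> b \<in> carrier V2 \<Longrightarrow> d \<in> carrier W2 \<Longrightarrow> (\<lambda>c. K a b c d) \<in> linear_maps W1 U"
    "\<And>a b c. a \<in> carrier V1 \<Longrightarrow> b \<in> carrier V2 \<Longrightarrow> c \<in> carrier W1 \<Longrightarrow> (\<lambda>d. K a b c d) \<in> linear_maps W2 U"
  shows "K \<in> quadlin V1 V2 W1 W2 U"
  unfolding quadlin_def using assms by blast

lemma quadlinD:
  assumes "K \<in> quadlin V1 V2 W1 W2 U"
  shows "b \<in> carrier V2 \<Longrightarrow> c \<in> carrier W1 \<Longrightarrow> d \<in> carrier W2 \<Longrightarrow> (\<lambda>a. K a b c d) \<in> linear_maps V1 U"
    "a \<in> carrier V1 \<Longrightarrow> c \<in> carrier W1 \<Longrightarrow> d \<in> carrier W2 \<Longrightarrow> (\<lambda>b. K a b c d) \<in> linear_maps V2 U"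
    "a \<in> carrier V1 \<Longrightarrow> b \<in> carrier V2 \<Longrightarrow> d \<in> carrier W2 \<Longrightarrow> (\<lambda>c. K a b c d) \<in> linear_maps W1 U"
    "a \<in> carrier V1 \<Longrightarrow> b \<in> carrier V2 \<Longrightarrow> c \<in> carrier W1 \<Longrightarrow> (\<lambda>d. K a b c d) \<in> linear_maps W2 U"
  using assms unfolding quadlin_def by blast+

lemma quadlin_inner:
  assumes "K \<in> quadlin V1 V2 W1 W2 U" "a \<in> carrier V1" "b \<in> carrier V2"
  shows "K a b \<in> bilinear_maps W1 W2 U"
  using quadlinD[OF assms(1)] assms(2,3) by (intro bilinear_mapsI) auto

lemma quadlin_outer:
  assumes "vspace V1" "vspace V2" "vspace W1" "vspace W2" "vspace U"
    and K: "K \<in> quadlin V1 V2 W1 W2 U" and T: "T \<in> carrier (tensor W1 W2)"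
  shows "(\<lambda>a b. sweedler U T (K a b)) \<in> bilinear_maps V1 V2 U"
  using assms quadlin_inner[OF K] quadlinD[OF K]
  by (intro bilinear_mapsI linear_maps_sweedler_fun[of W1 W2]) auto

lemma dbl_bilinear:
  assumes "vspace V1" "vspace V2" "vspace W1" "vspace W2" "vspace U"
    and K: "K \<in> quadlin V1 V2 W1 W2 U"
  shows "(\<lambda>S T. sweedler U S (\<lambda>a b. sweedler U T (K a b))) \<in> bilinear_maps (tensor V1 V2) (tensor W1 W2) U"
proof (rule bilinear_mapsI)
  fix T assume T: "T \<in> carrier (tensor W1 W2)"
  show "(\<lambda>S. sweedler U S (\<lambda>a b. sweedler U T (K a b))) \<in> linear_maps (tensor V1 V2) U"
    using assms T by (intro sweedler_linear quadlin_outer)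
next
  fix S assume S: "S \<in> carrier (tensor V1 V2)"
  show "(\<lambda>T. sweedler U S (\<lambda>a b. sweedler U T (K a b))) \<in> linear_maps (tensor W1 W2) U"
    using assms S
    by (intro linear_maps_sweedler_fun[of V1 V2] vspace_tensor quadlin_outer sweedler_linear quadlin_inner)
qed

lemma dbl_pure:
  assumes "vspace V1" "vspace V2" "vspace W1" "vspace W2" "vspace U"
    and K: "K \<in> quadlin V1 V2 W1 W2 U"
    and "a \<in> carrier V1" "b \<in> carrier V2" "c \<in> carrier W1" "d \<in> carrier W2"
  shows "sweedler U (pure_tensor V1 V2 a b) (\<lambda>a b. sweedler U (pure_tensor W1 W2 c d) (K a b)) = K a b c d"
proof -
  have "sweedler U (pure_tensor V1 V2 a b) (\<lambda>a b. sweedler U (pure_tensor W1 W2 c d) (K a b))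
      = sweedler U (pure_tensor W1 W2 c d) (K a b)"
    using assms by (intro sweedler_pure quadlin_outer) (auto intro: pure_tensor_closed)
  also have "\<dots> = K a b c d"
    using assms by (intro sweedler_pure quadlin_inner[OF K])
  finally show ?thesis .
qed

text \<open>Serves the product of the coproduct, whose outer arguments \<open>a\<close> and
  \<open>b'\<close> are parameters of a double sum over the coactions of the two inner ones.\<close>

lemma dbl_linear_fun:
  assumes "vspace V1" "vspace V2" "vspace W1" "vspace W2" "vspace U" "vspace Y"
    and K: "\<And>x. x \<in> carrier Y \<Longrightarrow> K x \<in> quadlin V1 V2 W1 W2 U"
    and L: "\<And>a b c d. \<lbrakk>a \<in> carrier V1; b \<in> carrier V2; c \<in> carrier W1; d \<in> carrier W2\<rbrakk>
      \<Longrightarrow> (\<lambda>x. K x a b c d) \<in> linear_maps Y U"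
    and "S \<in> carrier (tensor V1 V2)" "T \<in> carrier (tensor W1 W2)"
  shows "(\<lambda>x. sweedler U S (\<lambda>a b. sweedler U T (K x a b))) \<in> linear_maps Y U"
  using assms
  by (intro linear_maps_sweedler_fun[of V1 V2] linear_maps_sweedler_fun[of W1 W2] quadlin_outer
      quadlin_inner[OF K])

subsection \<open>The ground field and the torus\<close>

lemma ground_simps [simp]:
  "carrier ground = UNIV" "add ground = (+)" "ring.zero ground = 0" "module.smult ground = (*)"
  by (simp_all add: ground_def ring.defs module.defs fun_eq_iff)

lemma torus_simps [simp]:
  "carrier torus = UNIV" "add torus = (+)" "ring.zero torus = 0" "module.smult torus = pscale"
  by (simp_all add: torus_def ring.defs module.defs fun_eq_iff)

lemma abelian_group_type:
  fixes G :: "('a::ab_group_add, 'x) ring_scheme"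
  assumes "carrier G = UNIV" "add G = (+)" "ring.zero G = 0"
  shows "abelian_group G"
  by (rule abelian_groupI; unfold assms) (auto simp: add.assoc add.commute intro: exI[of _ "- _"] left_minus)

lemma vspace_ground: "vspace (ground :: ('k::field, 'k) module)"
  by (rule vspaceI) (auto intro: abelian_group_type simp: algebra_simps)

lemma vspace_torus: "vspace (torus :: ('k::field, ('k, 'n::finite) torus) module)"
  by (rule vspaceI) (auto intro: abelian_group_type simp: pscale_add_left pscale_add pscale_pscale)

lemma pscale_mult_left: "pscale c p * q = pscale c (p * q :: 'm::monoid_add \<Rightarrow>\<^sub>0 'k::field)"
  by (simp add: mult_map_scale_conv_mult mult.assoc)

text \<open>A scalar multiple is a product with \<open>single 0 c\<close>, which is central although
  the exponent monoid need not be commutative. The generality is used for words, where the product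
  is noncommutative.\<close>

lemma pscale_mult_right: "p * pscale c q = pscale c (p * q :: 'm::monoid_add \<Rightarrow>\<^sub>0 'k::field)"
proof -
  have comm: "p * Poly_Mapping.single 0 c = Poly_Mapping.single 0 c * p"
    by (induction p rule: poly_mapping_additive_induct) (simp_all add: mult_single algebra_simps)
  show ?thesis
    by (simp add: mult_map_scale_conv_mult mult.assoc[symmetric] comm)
qed

lemma torus_mult_linear:
  "(\<lambda>h. h * g) \<in> linear_maps torus torus" "(\<lambda>g. h * g) \<in> linear_maps torus torus"
  by (auto intro!: linear_mapsI simp: algebra_simps pscale_mult_left pscale_mult_right)

lemma lookup_linear: "(\<lambda>h. Poly_Mapping.lookup h m) \<in> linear_maps torus ground"
  by (auto intro!: linear_mapsI simp: lookup_add)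

lemma counit_H_superset:
  "finite M \<Longrightarrow> Poly_Mapping.keys h \<subseteq> M \<Longrightarrow> counit_H h = (\<Sum>m\<in>M. Poly_Mapping.lookup h m)"
  unfolding counit_H_def by (intro sum.mono_neutral_left) (auto simp: in_keys_iff)

lemma counit_H_linear: "(counit_H :: ('k::field, 'n::finite) torus \<Rightarrow> 'k) \<in> linear_maps torus ground"
proof (rule linear_mapsI)
  fix p q :: "('k, 'n) torus"
  let ?M = "Poly_Mapping.keys p \<union> Poly_Mapping.keys q"
  show "counit_H (p \<oplus>\<^bsub>torus\<^esub> q) = counit_H p \<oplus>\<^bsub>ground\<^esub> counit_H q"
    using keys_add[of p q] by (simp add: counit_H_superset[of ?M] lookup_add sum.distrib)
next
  fix c and p :: "('k, 'n) torus"
  show "counit_H (c \<odot>\<^bsub>torus\<^esub> p) = c \<odot>\<^bsub>ground\<^esub> counit_H p"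
    using keys_pscale[of c p] by (simp add: counit_H_superset[of "Poly_Mapping.keys p"] sum_distrib_left)
qed auto

lemma counit_H_tbasis [simp]: "counit_H (tbasis m) = 1"
  by (simp add: counit_H_def tbasis_def)

lemma tbasis_add: "tbasis (m + n) = tbasis m * tbasis n"
  by (simp add: tbasis_def mult_single)

lemma tbasis_zero: "tbasis 0 = 1"
  by (simp add: tbasis_def)

lemma lext_linear_torus:
  assumes "vspace U" "f \<in> UNIV \<rightarrow> carrier U"
  shows "lext U f \<in> linear_maps torus U"
proof -
  interpret U: vsp U using assms by (intro vsp.intro)
  show ?thesis using assms(2) U.lext_closed[of _ UNIV f]
    by (intro linear_mapsI) (auto simp: U.lext_add[of _ UNIV] U.lext_pscale[of _ UNIV])
qed

lemma linear_maps_torus_eqI: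
  fixes f g :: "('k::field, 'n::finite) torus \<Rightarrow> 'u"
  assumes "vspace U" "f \<in> linear_maps torus U" "g \<in> linear_maps torus U" "\<And>m. f (tbasis m) = g (tbasis m)"
  shows "f h = g h"
proof (induction h rule: poly_mapping_additive_induct)
  case zero
  show ?case using linear_maps_zero[OF vspace_torus assms(1,2)] linear_maps_zero[OF vspace_torus assms(1,3)] by simp
next
  case (single x c)
  have "Poly_Mapping.single x c = c \<odot>\<^bsub>torus\<^esub> tbasis x" by (simp add: tbasis_def)
  then show ?case using linear_maps_smult[OF assms(2), of "tbasis x" c] linear_maps_smult[OF assms(3), of "tbasis x" c] assms(4)
    by simp
next
  case (add p q)
  then show ?case using linear_maps_add[OF assms(2), of p q] linear_maps_add[OF assms(3), of p q] by simp
qed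

lemma coproduct_H_linear:
  "(coproduct_H :: ('k::field, 'n::finite) torus \<Rightarrow> _) \<in> linear_maps torus (tensor torus torus)"
proof -
  have eq: "(coproduct_H :: ('k, 'n) torus \<Rightarrow> _) =
      lext (tensor torus torus) (\<lambda>m. pure_tensor torus torus (tbasis m) (tbasis m))"
    by (simp add: fun_eq_iff coproduct_H_def lext_def)
  show ?thesis unfolding eq
    by (intro lext_linear_torus vspace_tensor vspace_torus) (auto intro!: pure_tensor_closed vspace_torus)
qed

lemma coproduct_H_tbasis:
  fixes m :: "int ^ 'n::finite"
  shows "coproduct_H (tbasis m :: ('k::field, 'n) torus) = pure_tensor torus torus (tbasis m) (tbasis m)"
proof -
  let ?t = "torus :: ('k, ('k, 'n) torus) module"
  interpret U: vsp "tensor ?t ?t" by (intro vsp.intro vspace_tensor vspace_torus)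
  have c: "pure_tensor ?t ?t (tbasis m) (tbasis m) \<in> carrier (tensor torus torus)" for m
    by (auto intro: pure_tensor_closed vspace_torus)
  have "coproduct_H (tbasis m) = lext (tensor ?t ?t)
      (\<lambda>m. pure_tensor torus torus (tbasis m) (tbasis m)) (Poly_Mapping.single m 1)"
    by (simp only: coproduct_H_def lext_def tbasis_def)
  also have "\<dots> = 1 \<odot>\<^bsub>tensor ?t ?t\<^esub> pure_tensor ?t ?t (tbasis m) (tbasis m)"
    using c by (intro U.lext_single)
  finally show ?thesis using c by simp
qed

subsection \<open>Comodules are spanned by homogeneous elements\<close>

text \<open>Inductive rather than by finite sums, so that identities between linear maps extend from
  \<open>G\<close> to its span by rule induction.\<close>

inductive_set vspan :: "('k::field, 'v, 'x) module_scheme \<Rightarrow> 'v set \<Rightarrow> 'v set" for V G where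
  zero: "\<zero>\<^bsub>V\<^esub> \<in> vspan V G"
| base: "x \<in> G \<Longrightarrow> x \<in> vspan V G"
| add: "x \<in> vspan V G \<Longrightarrow> y \<in> vspan V G \<Longrightarrow> x \<oplus>\<^bsub>V\<^esub> y \<in> vspan V G"
| smult: "x \<in> vspan V G \<Longrightarrow> c \<odot>\<^bsub>V\<^esub> x \<in> vspan V G"

lemma (in vsp) vspan_closed: "x \<in> vspan V G \<Longrightarrow> G \<subseteq> carrier V \<Longrightarrow> x \<in> carrier V"
  by (induction rule: vspan.induct) auto

lemma (in vsp) vspan_finsum: "finite M \<Longrightarrow> f \<in> M \<rightarrow> G \<Longrightarrow> G \<subseteq> carrier V \<Longrightarrow> (\<Oplus>m\<in>M. f m) \<in> vspan V G"
proof (induction M rule: finite_induct)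
  case (insert m M)
  then have "f m \<in> vspan V G" "f \<in> M \<rightarrow> carrier V" "f m \<in> carrier V" by (auto intro: vspan.base)
  then show ?case using insert by (auto intro: vspan.add)
qed (auto intro: vspan.zero)

text \<open>Stated with \<open>G \<subseteq> vspan V G'\<close>, so it also expresses transitivity
  of spans: a spanning set may be replaced by one whose elements decompose further.\<close>

lemma vspan_mono: "x \<in> vspan V G \<Longrightarrow> G \<subseteq> vspan V G' \<Longrightarrow> x \<in> vspan V G'"
  by (induction rule: vspan.induct) (auto intro: vspan.intros)

lemma linear_maps_vspan_eqI:
  assumes "vspace V" "vspace U" "f \<in> linear_maps V U" "g \<in> linear_maps V U" "G \<subseteq> carrier V"
    and "x \<in> vspan V G" "\<And>x. x \<in> G \<Longrightarrow> f x = g x"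
  shows "f x = g x"
proof -
  interpret V: vsp V by (rule vsp.intro) fact
  from assms(6) show ?thesis
    by (induction rule: vspan.induct)
      (simp_all add: assms(7) linear_maps_zero[OF assms(1,2)] assms(3,4) V.vspan_closed[OF _ assms(5)]
        linear_maps_add[OF assms(3)] linear_maps_add[OF assms(4)]
        linear_maps_smult[OF assms(3)] linear_maps_smult[OF assms(4)])
qed

lemma bilinear_maps_vspan_eqI:
  assumes "vspace V" "vspace W" "vspace U" "f \<in> bilinear_maps V W U" "g \<in> bilinear_maps V W U"
    and "G \<subseteq> carrier V" "H \<subseteq> carrier W" "x \<in> vspan V G" "y \<in> vspan W H"
    and "\<And>x y. x \<in> G \<Longrightarrow> y \<in> H \<Longrightarrow> f x y = g x y"
  shows "f x y = g x y"
proof -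
  interpret W: vsp W by (rule vsp.intro) fact
  have y: "y \<in> carrier W" using W.vspan_closed assms by blast
  show ?thesis
  proof (rule linear_maps_vspan_eqI[OF assms(1,3) bilinear_maps_left[OF assms(4) y]
        bilinear_maps_left[OF assms(5) y] assms(6,8)])
    fix x assume x: "x \<in> G"
    then have xc: "x \<in> carrier V" using assms(6) by auto
    show "f x y = g x y"
      by (rule linear_maps_vspan_eqI[OF assms(2,3) bilinear_maps_right[OF assms(4) xc]
            bilinear_maps_right[OF assms(5) xc] assms(7,9)]) (rule assms(10)[OF x])
  qed
qed

text \<open>The projection to degree \<open>m\<close>: the coaction followed, on its first leg, by
  the functional dual to \<open>tbasis m\<close>.\<close>

definition hom_component :: "('k::field, 'n::finite, 'a, 'x) halg_scheme \<Rightarrow> int ^ 'n \<Rightarrow> 'a \<Rightarrow> 'a" where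
  "hom_component V m v = sweedler V (coact V v) (\<lambda>h v0. Poly_Mapping.lookup h m \<odot>\<^bsub>V\<^esub> v0)"

lemma comodule_vspace: "comodule V \<Longrightarrow> vspace V"
  and comodule_coact: "comodule V \<Longrightarrow> coact V \<in> linear_maps V (tensor torus V)"
  by (auto simp: comodule_def)

lemma lookup_bilinear:
  assumes "vspace V" shows "(\<lambda>h v. Poly_Mapping.lookup h m \<odot>\<^bsub>V\<^esub> v) \<in> bilinear_maps torus V V"
  by (intro bilinear_maps_smult assms vspace_torus lookup_linear linear_maps_id)

lemma hom_component_linear:
  assumes "comodule V" shows "hom_component V m \<in> linear_maps V V"
  unfolding hom_component_def[abs_def]
  by (intro linear_maps_sweedler_arg[of torus V] vspace_torus lookup_bilinear comodule_vspace
      comodule_coact assms)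

lemma hom_component_homogeneous_self:
  assumes "vspace V" "v \<in> homogeneous V m" shows "hom_component V m v = v"
proof -
  interpret vsp V by (rule vsp.intro) fact
  show ?thesis
    using assms sweedler_pure[OF vspace_torus assms(1) assms(1) lookup_bilinear[OF assms(1)], of "tbasis m" v m]
    by (auto simp: hom_component_def homogeneous_def tbasis_def)
qed

text \<open>Makes the left side of coassociativity a legitimate Sweedler sum over the coaction;
  \<open>coassoc_right_bilinear\<close> does the same for the right side.\<close>

lemma coassoc_left_bilinear:
  assumes "vspace V"
  shows "(\<lambda>h v0. sweedler (tensor torus (tensor torus V)) (coproduct_H h)
          (\<lambda>h1 h2. pure_tensor torus (tensor torus V) h1 (pure_tensor torus V h2 v0)))
    \<in> bilinear_maps torus V (tensor torus (tensor torus V))"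
proof -
  note vs = vspace_torus vspace_tensor assms
  have b: "(\<lambda>h1 h2. pure_tensor torus (tensor torus V) h1 (pure_tensor torus V h2 v0))
      \<in> bilinear_maps torus torus (tensor torus (tensor torus V))" if "v0 \<in> carrier V" for v0
    by (intro bilinear_mapsI linear_maps_pure_left linear_maps_pure_right vs linear_maps_id
        pure_tensor_closed that) auto
  show ?thesis
    by (intro bilinear_mapsI linear_maps_sweedler_arg[of torus torus] linear_maps_sweedler_fun[of torus torus]
        vs b coproduct_H_linear linear_maps_closed[OF coproduct_H_linear]
        linear_maps_pure_right linear_maps_id pure_tensor_closed) auto
qed

lemma coassoc_right_bilinear:
  assumes "vspace V" "coact V \<in> linear_maps V (tensor torus V)"
  shows "(\<lambda>h v0. pure_tensor torus (tensor torus V) h (coact V v0))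
    \<in> bilinear_maps torus V (tensor torus (tensor torus V))"
  by (intro bilinear_mapsI linear_maps_pure_left linear_maps_pure_right vspace_torus vspace_tensor
      assms linear_maps_id linear_maps_closed[OF assms(2)]) auto

text \<open>Apply \<open>h \<mapsto> h\<^sub>m\<close> to the first leg of the coassociativity identity.\<close>

lemma hom_component_homogeneous:
  fixes V :: "('k::field, 'n::finite, 'a, 'x) halg_scheme"
  assumes V: "comodule V" and v: "v \<in> carrier V" shows "hom_component V m v \<in> homogeneous V m"
proof -
  let ?T = "tensor (torus :: ('k, ('k, 'n) torus) module) V"
  let ?U = "tensor (torus :: ('k, ('k, 'n) torus) module) ?T"
  note vV = comodule_vspace[OF V] and c = comodule_coact[OF V]
  note vs = vspace_torus vspace_tensor vV
  interpret V: vsp V by (rule vsp.intro) fact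
  interpret T: vsp ?T by (rule vsp.intro) (intro vs)
  \<comment> \<open>The functional dual to \<open>tbasis m\<close> on the outermost torus factor,
    identity on the rest.\<close>
  define E where "E = (\<lambda>S. sweedler ?T S (\<lambda>h t. Poly_Mapping.lookup h m \<odot>\<^bsub>?T\<^esub> t))"
  have E: "E \<in> linear_maps ?U ?T"
    unfolding E_def by (intro sweedler_linear vs lookup_bilinear)
  have Ep: "E (pure_tensor torus ?T h t) = Poly_Mapping.lookup h m \<odot>\<^bsub>?T\<^esub> t" if "t \<in> carrier ?T" for h t
    unfolding E_def using that by (intro sweedler_pure vs lookup_bilinear) auto
  have cv: "coact V v \<in> carrier ?T" using c v by (rule linear_maps_closed)
  have b: "(\<lambda>h1 h2. pure_tensor torus (tensor torus V) h1 (pure_tensor torus V h2 v0))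
      \<in> bilinear_maps torus torus (tensor torus (tensor torus V))" if "v0 \<in> carrier V" for v0
    by (intro bilinear_mapsI linear_maps_pure_left linear_maps_pure_right vs linear_maps_id
        pure_tensor_closed that) auto
  have pc: "pure_tensor torus V h v0 \<in> carrier ?T" if "v0 \<in> carrier V" for h v0
    by (intro pure_tensor_closed vs that) auto
  \<comment> \<open>Since \<open>tbasis k\<close> is grouplike, evaluating its first copy leaves the
    second copy \<open>tbasis m\<close> if \<open>k = m\<close>, and zero otherwise. By linearity
    this settles all \<open>h\<close>.\<close>
  have inner: "E (sweedler ?U (coproduct_H h) (\<lambda>h1 h2. pure_tensor torus ?T h1 (pure_tensor torus V h2 v0)))
      = Poly_Mapping.lookup h m \<odot>\<^bsub>?T\<^esub> pure_tensor torus V (tbasis m) v0" if v0: "v0 \<in> carrier V" for h v0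
  proof (rule linear_maps_torus_eqI[where U = ?T and h = h and
        f = "\<lambda>h. E (sweedler ?U (coproduct_H h) (\<lambda>h1 h2. pure_tensor torus ?T h1 (pure_tensor torus V h2 v0)))"
        and g = "\<lambda>h. Poly_Mapping.lookup h m \<odot>\<^bsub>?T\<^esub> pure_tensor torus V (tbasis m) v0"])
    show "(\<lambda>h. E (sweedler ?U (coproduct_H h) (\<lambda>h1 h2. pure_tensor torus ?T h1 (pure_tensor torus V h2 v0))))
        \<in> linear_maps torus ?T"
      by (intro linear_maps_comp[OF _ E] linear_maps_sweedler_arg[of torus torus] vs coproduct_H_linear b v0)
    show "(\<lambda>h. Poly_Mapping.lookup h m \<odot>\<^bsub>?T\<^esub> pure_tensor torus V (tbasis m) v0) \<in> linear_maps torus ?T"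
      by (intro linear_maps_smult_right vs lookup_linear pc v0)
    fix k
    have "sweedler ?U (coproduct_H (tbasis k)) (\<lambda>h1 h2. pure_tensor torus ?T h1 (pure_tensor torus V h2 v0))
      = pure_tensor torus ?T (tbasis k) (pure_tensor torus V (tbasis k) v0)"
      unfolding coproduct_H_tbasis by (intro sweedler_pure vs b v0) auto
    then show "E (sweedler ?U (coproduct_H (tbasis k)) (\<lambda>h1 h2. pure_tensor torus ?T h1 (pure_tensor torus V h2 v0)))
      = Poly_Mapping.lookup (tbasis k) m \<odot>\<^bsub>?T\<^esub> pure_tensor torus V (tbasis m) v0"
      using pc[OF v0] by (cases "k = m") (simp_all add: Ep tbasis_def lookup_single when_def)
  qed (intro vs)
  have "coact V (hom_component V m v) = sweedler ?T (coact V v) (\<lambda>h v0. coact V (Poly_Mapping.lookup h m \<odot>\<^bsub>V\<^esub> v0))"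
    unfolding hom_component_def by (intro sweedler_commute[of torus V V] vs lookup_bilinear c cv)
  also have "\<dots> = sweedler ?T (coact V v) (\<lambda>h v0. E (pure_tensor torus ?T h (coact V v0)))"
    by (intro sweedler_cong[of torus V] vs bilinear_maps_comp[OF lookup_bilinear c] cv)
      (simp add: Ep linear_maps_closed[OF c] linear_maps_smult[OF c])
  also have "\<dots> = E (sweedler ?U (coact V v) (\<lambda>h v0. pure_tensor torus ?T h (coact V v0)))"
    by (intro sweedler_commute[symmetric, of torus V ?U] vs E cv coassoc_right_bilinear c)
  also have "\<dots> = E (sweedler ?U (coact V v) (\<lambda>h v0. sweedler ?U (coproduct_H h)
          (\<lambda>h1 h2. pure_tensor torus ?T h1 (pure_tensor torus V h2 v0))))"
    using V v by (simp add: comodule_def Let_def)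
  also have "\<dots> = sweedler ?T (coact V v) (\<lambda>h v0. E (sweedler ?U (coproduct_H h)
          (\<lambda>h1 h2. pure_tensor torus ?T h1 (pure_tensor torus V h2 v0))))"
    by (intro sweedler_commute[of torus V ?U] vs E cv coassoc_left_bilinear)
  also have "\<dots> = sweedler ?T (coact V v) (\<lambda>h v0. pure_tensor torus V (tbasis m) (Poly_Mapping.lookup h m \<odot>\<^bsub>V\<^esub> v0))"
    by (intro sweedler_cong[of torus V] vs bilinear_maps_comp[OF coassoc_left_bilinear E] cv)
      (simp add: inner pure_tensor_smult_right vs)
  also have "\<dots> = pure_tensor torus V (tbasis m) (hom_component V m v)"
    unfolding hom_component_def by (intro sweedler_commute[symmetric, of torus V V] vs lookup_bilinear cv
        bilinear_maps_right[OF pure_tensor_bilinear]) auto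
  finally show ?thesis
    using linear_maps_closed[OF hom_component_linear[OF V] v] by (simp add: homogeneous_def)
qed

lemma homogeneous_closed: "a \<in> homogeneous A m \<Longrightarrow> a \<in> carrier A"
  by (simp add: homogeneous_def)

lemma homogeneous_subset: "(\<Union>m. homogeneous A m) \<subseteq> carrier A"
  by (auto simp: homogeneous_def)

lemma (in vsp) finsum_smult_left:
  "finite M \<Longrightarrow> v \<in> carrier V \<Longrightarrow> (\<Sum>m\<in>M. c m) \<odot> v = (\<Oplus>m\<in>M. c m \<odot> v)"
  by (induction M rule: finite_induct) (auto simp: smult_ladd)

text \<open>The counit is the sum of all coefficient functionals, so the counit axiom exhibits
  \<open>v\<close> as the sum of its components, which are homogeneous by coassociativity.\<close>

lemma comodule_vspan:
  fixes V :: "('k::field, 'n::finite, 'a, 'x) halg_scheme"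
  assumes V: "comodule V" and v: "v \<in> carrier V"
  shows "v \<in> vspan V (\<Union>m. homogeneous V m)"
proof -
  note vV = comodule_vspace[OF V] and c = comodule_coact[OF V]
  note vs = vspace_torus vspace_tensor vV
  interpret V: vsp V by (rule vsp.intro) fact
  interpret t: tens torus V by (intro tens.intro vsp.intro vs)
  have cb: "(\<lambda>h v. counit_H h \<odot>\<^bsub>V\<^esub> v) \<in> bilinear_maps torus V V"
    by (intro bilinear_maps_smult vs counit_H_linear linear_maps_id)
  note lb = lookup_bilinear[OF vV]
  let ?s = "\<lambda>m S. sweedler V S (\<lambda>h v. Poly_Mapping.lookup h m \<odot>\<^bsub>V\<^esub> v)"
  have sc: "?s m S \<in> carrier V" if "S \<in> carrier (tensor torus V)" for m S
    by (intro sweedler_closed[of torus V] vs lb that)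
  \<comment> \<open>The set of relevant degrees depends on \<open>S\<close>. Allowing every finite
    superset lets the induction merge the sets belonging to two summands.\<close>
  have "\<exists>M. finite M \<and> (\<forall>M'. finite M' \<longrightarrow> M \<subseteq> M' \<longrightarrow>
     sweedler V S (\<lambda>h v. counit_H h \<odot>\<^bsub>V\<^esub> v) = (\<Oplus>\<^bsub>V\<^esub>m\<in>M'. ?s m S))" if "S \<in> carrier (tensor torus V)" for S
    using that
  proof (induction rule: t.tensor_induct)
    case (pure h w)
    have "counit_H h \<odot>\<^bsub>V\<^esub> w = (\<Oplus>\<^bsub>V\<^esub>m\<in>M. Poly_Mapping.lookup h m \<odot>\<^bsub>V\<^esub> w)"
      if "finite M" "Poly_Mapping.keys h \<subseteq> M" for M
      using that pure by (simp add: counit_H_superset V.finsum_smult_left)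
    then show ?case
      using pure by (intro exI[of _ "Poly_Mapping.keys h"])
        (simp add: sweedler_pure[OF vspace_torus vV vV cb] sweedler_pure[OF vspace_torus vV vV lb])
  next
    case (add S T)
    then obtain M N where M: "finite M" "\<And>M'. finite M' \<Longrightarrow> M \<subseteq> M' \<Longrightarrow>
         sweedler V S (\<lambda>h v. counit_H h \<odot>\<^bsub>V\<^esub> v) = (\<Oplus>\<^bsub>V\<^esub>m\<in>M'. ?s m S)"
      and N: "finite N" "\<And>M'. finite M' \<Longrightarrow> N \<subseteq> M' \<Longrightarrow>
         sweedler V T (\<lambda>h v. counit_H h \<odot>\<^bsub>V\<^esub> v) = (\<Oplus>\<^bsub>V\<^esub>m\<in>M'. ?s m T)"
      by metis
    show ?case
    proof (intro exI[of _ "M \<union> N"] conjI allI impI)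
      fix M' assume M': "finite M'" "M \<union> N \<subseteq> M'"
      have "sweedler V (S \<oplus>\<^bsub>tensor torus V\<^esub> T) (\<lambda>h v. counit_H h \<odot>\<^bsub>V\<^esub> v)
        = (\<Oplus>\<^bsub>V\<^esub>m\<in>M'. ?s m S) \<oplus>\<^bsub>V\<^esub> (\<Oplus>\<^bsub>V\<^esub>m\<in>M'. ?s m T)"
        using add M' M(2) N(2) by (simp add: linear_maps_add[OF sweedler_linear[OF vspace_torus vV vV cb]])
      also have "\<dots> = (\<Oplus>\<^bsub>V\<^esub>m\<in>M'. ?s m S \<oplus>\<^bsub>V\<^esub> ?s m T)"
        using add sc by (intro V.finsum_addf[symmetric]) auto
      also have "\<dots> = (\<Oplus>\<^bsub>V\<^esub>m\<in>M'. ?s m (S \<oplus>\<^bsub>tensor torus V\<^esub> T))"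
        using add sc by (intro V.finsum_cong') (auto simp: linear_maps_add[OF sweedler_linear[OF vspace_torus vV vV lb]])
      finally show "sweedler V (S \<oplus>\<^bsub>tensor torus V\<^esub> T) (\<lambda>h v. counit_H h \<odot>\<^bsub>V\<^esub> v)
        = (\<Oplus>\<^bsub>V\<^esub>m\<in>M'. ?s m (S \<oplus>\<^bsub>tensor torus V\<^esub> T))" .
    qed (use M N in auto)
  qed
  from this[OF linear_maps_closed[OF c v]] obtain M where "finite M"
    "sweedler V (coact V v) (\<lambda>h v. counit_H h \<odot>\<^bsub>V\<^esub> v) = (\<Oplus>\<^bsub>V\<^esub>m\<in>M. hom_component V m v)"
    by (auto simp: hom_component_def)
  then have "v = (\<Oplus>\<^bsub>V\<^esub>m\<in>M. hom_component V m v)"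
    using V v by (simp add: comodule_def)
  moreover have "(\<Oplus>\<^bsub>V\<^esub>m\<in>M. hom_component V m v) \<in> vspan V (\<Union>m. homogeneous V m)"
    using hom_component_homogeneous[OF V v] \<open>finite M\<close>
    by (intro V.vspan_finsum homogeneous_subset) auto
  ultimately show ?thesis by simp
qed

text \<open>The converse of \<open>comodule_vspan\<close>. Both comodule axioms are linear in
  \<open>v\<close>, and on a homogeneous element they reduce to \<open>tbasis m\<close> being
  grouplike with counit 1.\<close>

lemma comoduleI:
  fixes V :: "('k::field, 'n::finite, 'a, 'x) halg_scheme"
  assumes vV: "vspace V" and c: "coact V \<in> linear_maps V (tensor torus V)"
    and span: "\<And>v. v \<in> carrier V \<Longrightarrow> v \<in> vspan V (\<Union>m. homogeneous V m)"
  shows "comodule V"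
  unfolding comodule_def Let_def
proof (intro conjI ballI vV c)
  let ?T = "tensor (torus :: ('k, ('k, 'n) torus) module) V"
  let ?U = "tensor (torus :: ('k, ('k, 'n) torus) module) ?T"
  note vs = vspace_torus vspace_tensor vV
  interpret V: vsp V by (rule vsp.intro) fact
  have b: "(\<lambda>h1 h2. pure_tensor torus (tensor torus V) h1 (pure_tensor torus V h2 v0))
      \<in> bilinear_maps torus torus (tensor torus (tensor torus V))" if "v0 \<in> carrier V" for v0
    by (intro bilinear_mapsI linear_maps_pure_left linear_maps_pure_right vs linear_maps_id
        pure_tensor_closed that) auto
  fix v assume v: "v \<in> carrier V"
  show "sweedler ?U (coact V v) (\<lambda>h v0. sweedler ?U (coproduct_H h)
          (\<lambda>h1 h2. pure_tensor torus (tensor torus V) h1 (pure_tensor torus V h2 v0)))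
        = sweedler ?U (coact V v) (\<lambda>h v0. pure_tensor torus (tensor torus V) h (coact V v0))"
  proof (rule linear_maps_vspan_eqI[where U = ?U, OF vV _ _ _ homogeneous_subset span[OF v]])
    fix w assume "w \<in> (\<Union>m. homogeneous V m)"
    then obtain m where w: "w \<in> carrier V" "coact V w = pure_tensor torus V (tbasis m) w"
      by (auto simp: homogeneous_def)
    have "sweedler ?U (coact V w) (\<lambda>h v0. sweedler ?U (coproduct_H h)
          (\<lambda>h1 h2. pure_tensor torus (tensor torus V) h1 (pure_tensor torus V h2 v0)))
      = sweedler ?U (coproduct_H (tbasis m))
          (\<lambda>h1 h2. pure_tensor torus (tensor torus V) h1 (pure_tensor torus V h2 w))"
      unfolding w(2) by (intro sweedler_pure vs coassoc_left_bilinear w) auto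
    also have "\<dots> = pure_tensor torus (tensor torus V) (tbasis m) (pure_tensor torus V (tbasis m) w)"
      unfolding coproduct_H_tbasis by (intro sweedler_pure vs b w) auto
    also have "\<dots> = sweedler ?U (coact V w) (\<lambda>h v0. pure_tensor torus (tensor torus V) h (coact V v0))"
      unfolding w(2) using sweedler_pure[OF vspace_torus vV _ coassoc_right_bilinear[OF vV c], of "tbasis m" w] w
      by (simp add: vs)
    finally show "sweedler ?U (coact V w) (\<lambda>h v0. sweedler ?U (coproduct_H h)
          (\<lambda>h1 h2. pure_tensor torus (tensor torus V) h1 (pure_tensor torus V h2 v0)))
        = sweedler ?U (coact V w) (\<lambda>h v0. pure_tensor torus (tensor torus V) h (coact V v0))" .
  qed (intro vs linear_maps_sweedler_arg[of torus V] coassoc_left_bilinear coassoc_right_bilinear c)+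
  have cb: "(\<lambda>h v. counit_H h \<odot>\<^bsub>V\<^esub> v) \<in> bilinear_maps torus V V"
    by (intro bilinear_maps_smult vs counit_H_linear linear_maps_id)
  show "sweedler V (coact V v) (\<lambda>h v0. counit_H h \<odot>\<^bsub>V\<^esub> v0) = v"
  proof (rule linear_maps_vspan_eqI[OF vV vV linear_maps_sweedler_arg[OF vspace_torus vV vV cb c] linear_maps_id
          homogeneous_subset span[OF v]])
    fix w assume "w \<in> (\<Union>m. homogeneous V m)"
    then obtain m where w: "w \<in> carrier V" "coact V w = pure_tensor torus V (tbasis m) w"
      by (auto simp: homogeneous_def)
    then show "sweedler V (coact V w) (\<lambda>h v0. counit_H h \<odot>\<^bsub>V\<^esub> v0) = w"
      by (simp add: sweedler_pure[OF vspace_torus vV vV cb])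
  qed
qed

subsection \<open>Comodule algebras\<close>

text \<open>The part of \<open>comodule_algebra\<close> that does not mention the coaction. For free
  algebras, quotients and coproducts it is established first, because the axioms on the coaction are
  Sweedler sums whose evaluation needs a bilinear product.\<close>

definition alg :: "('k::field, 'a, 'x) module_scheme \<Rightarrow> bool" where
  "alg A \<longleftrightarrow> vspace A \<and> ring A \<and> (\<forall>c. \<forall>a\<in>carrier A. \<forall>b\<in>carrier A.
     (c \<odot>\<^bsub>A\<^esub> a) \<otimes>\<^bsub>A\<^esub> b = c \<odot>\<^bsub>A\<^esub> (a \<otimes>\<^bsub>A\<^esub> b) \<and> a \<otimes>\<^bsub>A\<^esub> (c \<odot>\<^bsub>A\<^esub> b) = c \<odot>\<^bsub>A\<^esub> (a \<otimes>\<^bsub>A\<^esub> b))"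

lemma algI:
  assumes "vspace A" "ring A"
    and "\<And>c a b. a \<in> carrier A \<Longrightarrow> b \<in> carrier A \<Longrightarrow> (c \<odot>\<^bsub>A\<^esub> a) \<otimes>\<^bsub>A\<^esub> b = c \<odot>\<^bsub>A\<^esub> (a \<otimes>\<^bsub>A\<^esub> b)"
    and "\<And>c a b. a \<in> carrier A \<Longrightarrow> b \<in> carrier A \<Longrightarrow> a \<otimes>\<^bsub>A\<^esub> (c \<odot>\<^bsub>A\<^esub> b) = c \<odot>\<^bsub>A\<^esub> (a \<otimes>\<^bsub>A\<^esub> b)"
  shows "alg A"
  using assms by (auto simp: alg_def)

lemma alg_vspace: "alg A \<Longrightarrow> vspace A" and alg_ring: "alg A \<Longrightarrow> ring A"
  and alg_smult_left: "alg A \<Longrightarrow> a \<in> carrier A \<Longrightarrow> b \<in> carrier A \<Longrightarrow>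
    (c \<odot>\<^bsub>A\<^esub> a) \<otimes>\<^bsub>A\<^esub> b = c \<odot>\<^bsub>A\<^esub> (a \<otimes>\<^bsub>A\<^esub> b)"
  and alg_smult_right: "alg A \<Longrightarrow> a \<in> carrier A \<Longrightarrow> b \<in> carrier A \<Longrightarrow>
    a \<otimes>\<^bsub>A\<^esub> (c \<odot>\<^bsub>A\<^esub> b) = c \<odot>\<^bsub>A\<^esub> (a \<otimes>\<^bsub>A\<^esub> b)"
  by (auto simp: alg_def)

lemma alg_mult_left_linear:
  assumes "alg A" "b \<in> carrier A" shows "(\<lambda>a. a \<otimes>\<^bsub>A\<^esub> b) \<in> linear_maps A A"
proof -
  interpret ring A using assms by (simp add: alg_def)
  show ?thesis using assms by (intro linear_mapsI) (auto simp: l_distr alg_smult_left)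
qed

lemma alg_mult_right_linear:
  assumes "alg A" "a \<in> carrier A" shows "(\<lambda>b. a \<otimes>\<^bsub>A\<^esub> b) \<in> linear_maps A A"
proof -
  interpret ring A using assms by (simp add: alg_def)
  show ?thesis using assms by (intro linear_mapsI) (auto simp: r_distr alg_smult_right)
qed

lemma alg_mult_closed: "alg A \<Longrightarrow> a \<in> carrier A \<Longrightarrow> b \<in> carrier A \<Longrightarrow> a \<otimes>\<^bsub>A\<^esub> b \<in> carrier A"
  using monoid.m_closed[of A a b] ring.is_monoid by (auto simp: alg_def)

lemma alg_mult_bilinear: "alg A \<Longrightarrow> (\<lambda>a b. a \<otimes>\<^bsub>A\<^esub> b) \<in> bilinear_maps A A A"
  by (intro bilinear_mapsI alg_mult_left_linear alg_mult_right_linear)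

lemma comodule_algebra_alg: "comodule_algebra A \<Longrightarrow> alg A"
  and comodule_algebra_comodule: "comodule_algebra A \<Longrightarrow> comodule A"
  by (auto simp: comodule_algebra_def alg_def comodule_vspace)

lemma comodule_algebra_vspace: "comodule_algebra A \<Longrightarrow> vspace A"
  and comodule_algebra_ring: "comodule_algebra A \<Longrightarrow> ring A"
  and comodule_algebra_coact: "comodule_algebra A \<Longrightarrow> coact A \<in> linear_maps A (tensor torus A)"
  by (auto simp: comodule_algebra_def comodule_vspace comodule_coact)

lemma coact_mult_quadlin:
  assumes "alg A"
  shows "(\<lambda>h a0 g b0. pure_tensor torus A (h * g) (a0 \<otimes>\<^bsub>A\<^esub> b0)) \<in> quadlin torus A torus A (tensor torus A)"
  by (intro quadlinI linear_maps_pure_left linear_maps_pure_right alg_vspace vspace_torus assms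
      torus_mult_linear alg_mult_left_linear alg_mult_right_linear alg_mult_closed) auto

text \<open>The coaction is multiplicative, and the product of \<open>tbasis m\<close> and
  \<open>tbasis n\<close> is \<open>tbasis (m + n)\<close>.\<close>

lemma homogeneous_mult:
  fixes A :: "('k::field, 'n::finite, 'a, 'x) halg_scheme"
  assumes A: "comodule_algebra A" and a: "a \<in> homogeneous A m" and b: "b \<in> homogeneous A n"
  shows "a \<otimes>\<^bsub>A\<^esub> b \<in> homogeneous A (m + n)"
proof -
  note alg = comodule_algebra_alg[OF A]
  have c: "a \<in> carrier A" "b \<in> carrier A" using a b by (auto simp: homogeneous_def)
  have "coact A (a \<otimes>\<^bsub>A\<^esub> b) = sweedler (tensor torus A) (pure_tensor torus A (tbasis m) a) (\<lambda>h a0.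
          sweedler (tensor torus A) (pure_tensor torus A (tbasis n) b) (\<lambda>g b0.
            pure_tensor torus A (h * g) (a0 \<otimes>\<^bsub>A\<^esub> b0)))"
    using A c a b by (simp add: comodule_algebra_def homogeneous_def)
  also have "\<dots> = pure_tensor torus A (tbasis m * tbasis n) (a \<otimes>\<^bsub>A\<^esub> b)"
    using c by (intro dbl_pure vspace_torus alg_vspace[OF alg] vspace_tensor coact_mult_quadlin[OF alg]) auto
  finally show ?thesis using alg_mult_closed[OF alg c]
    by (simp add: homogeneous_def tbasis_add)
qed

lemma homogeneous_one:
  assumes "comodule_algebra A" shows "\<one>\<^bsub>A\<^esub> \<in> homogeneous A 0"
proof -
  interpret ring A using assms by (simp add: comodule_algebra_def)
  show ?thesis using assms by (simp add: homogeneous_def comodule_algebra_def tbasis_zero)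
qed

lemma homogeneous_span_comodule:
  assumes "vspace V" "coact V \<in> linear_maps V (tensor torus V)"
    and "\<And>m. D m \<subseteq> homogeneous V m" and "\<And>v. v \<in> carrier V \<Longrightarrow> v \<in> vspan V (\<Union>m. D m)"
  shows "comodule V"
proof (rule comoduleI[OF assms(1,2)])
  fix v assume "v \<in> carrier V"
  from assms(4)[OF this] show "v \<in> vspan V (\<Union>m. homogeneous V m)"
    by (rule vspan_mono) (use assms(3) in \<open>auto intro!: vspan.base\<close>)
qed

text \<open>The spanning family \<open>D\<close> may be much smaller than the family of all
  homogeneous elements: words in free algebras, pure tensors of homogeneous elements in coproducts,
  images of homogeneous elements in quotients.\<close>

lemma comodule_algebraI:
  fixes A :: "('k::field, 'n::finite, 'a, 'x) halg_scheme"
  assumes alg: "alg A" and c: "coact A \<in> linear_maps A (tensor torus A)"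
    and D: "\<And>m. D m \<subseteq> homogeneous A m" and span: "\<And>v. v \<in> carrier A \<Longrightarrow> v \<in> vspan A (\<Union>m. D m)"
    and mult: "\<And>a b m n. a \<in> D m \<Longrightarrow> b \<in> D n \<Longrightarrow> a \<otimes>\<^bsub>A\<^esub> b \<in> homogeneous A (m + n)"
    and one: "\<one>\<^bsub>A\<^esub> \<in> homogeneous A 0"
  shows "comodule_algebra A"
  unfolding comodule_algebra_def
proof (intro conjI)
  note vs = vspace_torus vspace_tensor alg_vspace[OF alg]
  show "comodule A" using alg_vspace[OF alg] c D span by (rule homogeneous_span_comodule)
  show "ring A" using alg by (rule alg_ring)
  show "coact A \<one>\<^bsub>A\<^esub> = pure_tensor torus A 1 \<one>\<^bsub>A\<^esub>"
    using one by (simp add: homogeneous_def tbasis_zero)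
  show "\<forall>a\<in>carrier A. \<forall>b\<in>carrier A. coact A (a \<otimes>\<^bsub>A\<^esub> b) =
        sweedler (tensor torus A) (coact A a) (\<lambda>h a0.
          sweedler (tensor torus A) (coact A b) (\<lambda>g b0.
            pure_tensor torus A (h * g) (a0 \<otimes>\<^bsub>A\<^esub> b0)))"
  proof (intro ballI)
    fix a b assume a: "a \<in> carrier A" and b: "b \<in> carrier A"
    have sub: "(\<Union>m. D m) \<subseteq> carrier A" using D by (auto simp: homogeneous_def)
    let ?F = "\<lambda>S T. sweedler (tensor torus A) S (\<lambda>h a0.
          sweedler (tensor torus A) T (\<lambda>g b0. pure_tensor torus A (h * g) (a0 \<otimes>\<^bsub>A\<^esub> b0)))"
    have F: "?F \<in> bilinear_maps (tensor torus A) (tensor torus A) (tensor torus A)"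
      by (intro dbl_bilinear vs coact_mult_quadlin alg)
    have F2: "(\<lambda>a b. ?F (coact A a) (coact A b)) \<in> bilinear_maps A A (tensor torus A)"
    proof (rule bilinear_mapsI)
      fix w assume "w \<in> carrier A"
      then show "(\<lambda>v. ?F (coact A v) (coact A w)) \<in> linear_maps A (tensor torus A)"
        using linear_maps_comp[OF c bilinear_maps_left[OF F linear_maps_closed[OF c]]] by blast
    next
      fix v assume "v \<in> carrier A"
      then show "(\<lambda>w. ?F (coact A v) (coact A w)) \<in> linear_maps A (tensor torus A)"
        using linear_maps_comp[OF c bilinear_maps_right[OF F linear_maps_closed[OF c]]] by blast
    qed
    have L: "(\<lambda>a b. coact A (a \<otimes>\<^bsub>A\<^esub> b)) \<in> bilinear_maps A A (tensor torus A)"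
      by (intro bilinear_maps_comp[OF alg_mult_bilinear] alg c)
    show "coact A (a \<otimes>\<^bsub>A\<^esub> b) = ?F (coact A a) (coact A b)"
    proof (rule bilinear_maps_vspan_eqI[OF alg_vspace[OF alg] alg_vspace[OF alg] _ L F2 sub sub span[OF a] span[OF b]])
      fix x y assume "x \<in> (\<Union>m. D m)" "y \<in> (\<Union>m. D m)"
      then obtain m n where x: "x \<in> D m" and y: "y \<in> D n" by auto
      then have hx: "x \<in> homogeneous A m" and hy: "y \<in> homogeneous A n" using D by auto
      then have "?F (coact A x) (coact A y) = ?F (pure_tensor torus A (tbasis m) x) (pure_tensor torus A (tbasis n) y)"
        by (simp add: homogeneous_def)
      also have "\<dots> = pure_tensor torus A (tbasis m * tbasis n) (x \<otimes>\<^bsub>A\<^esub> y)"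
        using hx hy by (intro dbl_pure vs coact_mult_quadlin[OF alg]) (auto simp: homogeneous_def)
      finally show "coact A (x \<otimes>\<^bsub>A\<^esub> y) = ?F (coact A x) (coact A y)"
        using mult[OF x y] by (simp add: homogeneous_def tbasis_add)
    qed (intro vs)
  qed
qed (use alg in \<open>auto simp: alg_def\<close>)

subsection \<open>Braided commutative algebras\<close>

lemma cotriangular_linear: "cotriangular R \<Longrightarrow> R \<in> linear_maps (tensor torus torus) ground"
  by (simp add: cotriangular_def)

lemma braiding_linear:
  assumes "R \<in> linear_maps (tensor torus torus) ground"
  shows "(\<lambda>h. R (HH h g)) \<in> linear_maps torus ground" "(\<lambda>g. R (HH h g)) \<in> linear_maps torus ground"
  using linear_maps_comp[OF linear_maps_pure_left[OF vspace_torus vspace_torus linear_maps_id] assms, of g]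
    linear_maps_comp[OF linear_maps_pure_right[OF vspace_torus vspace_torus linear_maps_id] assms, of h]
  by simp_all

lemma HA_comm_quadlin:
  assumes A: "alg A" and R: "R \<in> linear_maps (tensor torus torus) ground"
  shows "(\<lambda>h' a0' h a0. R (HH h' h) \<odot>\<^bsub>A\<^esub> (a0' \<otimes>\<^bsub>A\<^esub> a0)) \<in> quadlin torus A torus A A"
  by (intro quadlinI linear_maps_smult_left linear_maps_smult_right alg_vspace A vspace_torus
      braiding_linear R alg_mult_left_linear alg_mult_right_linear alg_mult_closed)

lemma HA_obj_comodule_algebra: "HA_obj R A \<Longrightarrow> comodule_algebra A"
  by (simp add: HA_obj_def)

lemma HA_comm_pure:
  assumes A: "alg A" and R: "R \<in> linear_maps (tensor torus torus) ground"
    and a: "a \<in> homogeneous A m" and b: "b \<in> homogeneous A n"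
  shows "sweedler A (coact A b) (\<lambda>h' a0'. sweedler A (coact A a) (\<lambda>h a0.
          R (HH h' h) \<odot>\<^bsub>A\<^esub> (a0' \<otimes>\<^bsub>A\<^esub> a0))) = R (HH (tbasis n) (tbasis m)) \<odot>\<^bsub>A\<^esub> (b \<otimes>\<^bsub>A\<^esub> a)"
proof -
  have "sweedler A (coact A b) (\<lambda>h' a0'. sweedler A (coact A a) (\<lambda>h a0.
          R (HH h' h) \<odot>\<^bsub>A\<^esub> (a0' \<otimes>\<^bsub>A\<^esub> a0)))
      = sweedler A (pure_tensor torus A (tbasis n) b) (\<lambda>h' a0'. sweedler A (pure_tensor torus A (tbasis m) a) (\<lambda>h a0.
          R (HH h' h) \<odot>\<^bsub>A\<^esub> (a0' \<otimes>\<^bsub>A\<^esub> a0)))"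
    using a b by (simp add: homogeneous_def)
  also have "\<dots> = R (HH (tbasis n) (tbasis m)) \<odot>\<^bsub>A\<^esub> (b \<otimes>\<^bsub>A\<^esub> a)"
    using a b by (intro dbl_pure vspace_torus alg_vspace[OF A] HA_comm_quadlin[OF A R])
      (auto simp: homogeneous_def)
  finally show ?thesis .
qed

lemma HA_obj_comm:
  assumes R: "R \<in> linear_maps (tensor torus torus) ground"
    and A: "HA_obj R A" and a: "a \<in> homogeneous A m" and b: "b \<in> homogeneous A n"
  shows "a \<otimes>\<^bsub>A\<^esub> b = R (HH (tbasis n) (tbasis m)) \<odot>\<^bsub>A\<^esub> (b \<otimes>\<^bsub>A\<^esub> a)"
  using A HA_comm_pure[OF comodule_algebra_alg[OF HA_obj_comodule_algebra[OF A]] R a b]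
    homogeneous_closed[OF a] homogeneous_closed[OF b]
  by (simp add: HA_obj_def)

text \<open>Both sides of the commutation law are bilinear in the two elements, so the members of
  the spanning family decide it; there the double Sweedler sum collapses to one value of the
  bicharacter.\<close>

lemma HA_objI:
  fixes A :: "('k::field, 'n::finite, 'a, 'x) halg_scheme"
  assumes R: "R \<in> linear_maps (tensor torus torus) ground"
    and A: "comodule_algebra A"
    and D: "\<And>m. D m \<subseteq> homogeneous A m" and span: "\<And>v. v \<in> carrier A \<Longrightarrow> v \<in> vspan A (\<Union>m. D m)"
    and comm: "\<And>a b m n. a \<in> D m \<Longrightarrow> b \<in> D n \<Longrightarrow>
      a \<otimes>\<^bsub>A\<^esub> b = R (HH (tbasis n) (tbasis m)) \<odot>\<^bsub>A\<^esub> (b \<otimes>\<^bsub>A\<^esub> a)"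
  shows "HA_obj R A"
  unfolding HA_obj_def
proof (intro conjI ballI A)
  note alg = comodule_algebra_alg[OF A] and c = comodule_algebra_coact[OF A]
  note vs = vspace_torus vspace_tensor alg_vspace[OF alg]
  fix a b assume a: "a \<in> carrier A" and b: "b \<in> carrier A"
  have sub: "(\<Union>m. D m) \<subseteq> carrier A" using D by (auto simp: homogeneous_def)
  let ?F = "\<lambda>S T. sweedler A S (\<lambda>h' a0'. sweedler A T (\<lambda>h a0. R (HH h' h) \<odot>\<^bsub>A\<^esub> (a0' \<otimes>\<^bsub>A\<^esub> a0)))"
  have F: "?F \<in> bilinear_maps (tensor torus A) (tensor torus A) A"
    by (intro dbl_bilinear vs HA_comm_quadlin alg R)
  have F2: "(\<lambda>a b. ?F (coact A b) (coact A a)) \<in> bilinear_maps A A A"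
  proof (rule bilinear_mapsI)
    fix w assume "w \<in> carrier A"
    then show "(\<lambda>v. ?F (coact A w) (coact A v)) \<in> linear_maps A A"
      using linear_maps_comp[OF c bilinear_maps_right[OF F linear_maps_closed[OF c]]] by blast
  next
    fix v assume "v \<in> carrier A"
    then show "(\<lambda>w. ?F (coact A w) (coact A v)) \<in> linear_maps A A"
      using linear_maps_comp[OF c bilinear_maps_left[OF F linear_maps_closed[OF c]]] by blast
  qed
  show "a \<otimes>\<^bsub>A\<^esub> b = ?F (coact A b) (coact A a)"
  proof (rule bilinear_maps_vspan_eqI[OF alg_vspace[OF alg] alg_vspace[OF alg] alg_vspace[OF alg]
        alg_mult_bilinear[OF alg] F2 sub sub span[OF a] span[OF b]])
    fix x y assume "x \<in> (\<Union>m. D m)" "y \<in> (\<Union>m. D m)"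
    then obtain m n where x: "x \<in> D m" and y: "y \<in> D n" by auto
    show "x \<otimes>\<^bsub>A\<^esub> y = ?F (coact A y) (coact A x)"
      using HA_comm_pure[OF alg R subsetD[OF D x] subsetD[OF D y]] comm[OF x y] by simp
  qed
qed

subsection \<open>Morphisms\<close>

lemma equivariant_bilinear:
  assumes "vspace W" "f \<in> linear_maps V W"
  shows "(\<lambda>h v0. pure_tensor torus W h (f v0)) \<in> bilinear_maps torus V (tensor torus W)"
  by (intro bilinear_mapsI linear_maps_pure_left linear_maps_pure_right assms vspace_torus linear_maps_id
      linear_maps_closed[OF assms(2)]) auto

lemma equivariant_linear: "f \<in> equivariant_maps V W \<Longrightarrow> f \<in> linear_maps V W"
  by (simp add: equivariant_maps_def)

lemma equivariant_homogeneous: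
  assumes "vspace V" "vspace W" "f \<in> equivariant_maps V W" "v \<in> homogeneous V m"
  shows "f v \<in> homogeneous W m"
  using assms sweedler_pure[OF vspace_torus assms(1) _ equivariant_bilinear[OF assms(2) equivariant_linear[OF assms(3)]],
      of "tbasis m" v] linear_maps_closed[OF equivariant_linear[OF assms(3)]]
  by (auto simp: homogeneous_def equivariant_maps_def vspace_tensor vspace_torus)

lemma equivariantI:
  assumes V: "comodule V" and W: "comodule W" and f: "f \<in> linear_maps V W"
    and D: "\<And>m. D m \<subseteq> homogeneous V m" and span: "\<And>v. v \<in> carrier V \<Longrightarrow> v \<in> vspan V (\<Union>m. D m)"
    and hom: "\<And>m v. v \<in> D m \<Longrightarrow> f v \<in> homogeneous W m"
  shows "f \<in> equivariant_maps V W"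
  unfolding equivariant_maps_def
proof (intro CollectI conjI ballI f)
  note vs = vspace_torus vspace_tensor comodule_vspace[OF V] comodule_vspace[OF W]
  have sub: "(\<Union>m. D m) \<subseteq> carrier V" using D by (auto simp: homogeneous_def)
  note b = equivariant_bilinear[OF comodule_vspace[OF W] f]
  fix v assume v: "v \<in> carrier V"
  show "coact W (f v) = sweedler (tensor torus W) (coact V v) (\<lambda>h v0. pure_tensor torus W h (f v0))"
  proof (rule linear_maps_vspan_eqI[where U = "tensor torus W", OF _ _ _ _ sub span[OF v]])
    show "(\<lambda>v. coact W (f v)) \<in> linear_maps V (tensor torus W)"
      using f comodule_coact[OF W] by (rule linear_maps_comp)
    show "(\<lambda>v. sweedler (tensor torus W) (coact V v) (\<lambda>h v0. pure_tensor torus W h (f v0)))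
        \<in> linear_maps V (tensor torus W)"
      by (intro linear_maps_sweedler_arg[of torus V] vs b comodule_coact[OF V])
    fix x assume "x \<in> (\<Union>m. D m)"
    then obtain m where x: "x \<in> D m" by auto
    then have hx: "x \<in> carrier V" "coact V x = pure_tensor torus V (tbasis m) x"
      using D by (auto simp: homogeneous_def)
    have "sweedler (tensor torus W) (pure_tensor torus V (tbasis m) x) (\<lambda>h v0. pure_tensor torus W h (f v0))
      = pure_tensor torus W (tbasis m) (f x)"
      by (intro sweedler_pure vs b hx) auto
    then show "coact W (f x) = sweedler (tensor torus W) (coact V x) (\<lambda>h v0. pure_tensor torus W h (f v0))"
      using hom[OF x] hx by (simp add: homogeneous_def)
  qed (intro vs)+
qed

text \<open>Equivariance allows the degree projection to be taken before or after the map. It is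
  used to invert isomorphisms and to choose coinvariant lifts along a quotient map.\<close>

lemma hom_component_equivariant:
  assumes V: "comodule V" and W: "comodule W" and f: "f \<in> equivariant_maps V W" and v: "v \<in> carrier V"
  shows "f (hom_component V m v) = hom_component W m (f v)"
proof -
  note vs = vspace_torus vspace_tensor comodule_vspace[OF V] comodule_vspace[OF W]
  note fl = equivariant_linear[OF f]
  have c: "coact V v \<in> carrier (tensor torus V)" using comodule_coact[OF V] v by (rule linear_maps_closed)
  have "hom_component W m (f v) = sweedler W (sweedler (tensor torus W) (coact V v) (\<lambda>h v0. pure_tensor torus W h (f v0)))
      (\<lambda>h v0. Poly_Mapping.lookup h m \<odot>\<^bsub>W\<^esub> v0)"
    using f v by (simp add: hom_component_def equivariant_maps_def)
  also have "\<dots> = sweedler W (coact V v) (\<lambda>h v0. sweedler W (pure_tensor torus W h (f v0))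
      (\<lambda>h v0. Poly_Mapping.lookup h m \<odot>\<^bsub>W\<^esub> v0))"
    by (intro sweedler_commute[of torus V] vs equivariant_bilinear fl c sweedler_linear lookup_bilinear)
  also have "\<dots> = sweedler W (coact V v) (\<lambda>h v0. f (Poly_Mapping.lookup h m \<odot>\<^bsub>V\<^esub> v0))"
    by (intro sweedler_cong[of torus V] vs c bilinear_maps_comp[OF equivariant_bilinear[OF _ fl]]
        sweedler_linear lookup_bilinear)
      (simp add: sweedler_pure vs lookup_bilinear linear_maps_closed[OF fl] linear_maps_smult[OF fl])
  also have "\<dots> = f (hom_component V m v)"
    unfolding hom_component_def by (intro sweedler_commute[symmetric, of torus V] vs lookup_bilinear fl c)
  finally show ?thesis by simp
qed

lemma HA_homD:
  assumes "f \<in> HA_hom A B"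
  shows "f \<in> linear_maps A B" "f \<in> ring_hom A B" "f \<in> equivariant_maps A B"
    "a \<in> carrier A \<Longrightarrow> f a \<in> carrier B"
    "a \<in> carrier A \<Longrightarrow> b \<in> carrier A \<Longrightarrow> f (a \<otimes>\<^bsub>A\<^esub> b) = f a \<otimes>\<^bsub>B\<^esub> f b"
    "f \<one>\<^bsub>A\<^esub> = \<one>\<^bsub>B\<^esub>"
  using assms by (auto simp: HA_hom_def equivariant_maps_def ring_hom_def)

lemma HA_hom_homogeneous:
  assumes "comodule_algebra A" "comodule_algebra B" "f \<in> HA_hom A B" "a \<in> homogeneous A m"
  shows "f a \<in> homogeneous B m"
  using assms equivariant_homogeneous[of A B f] by (simp add: comodule_algebra_vspace HA_homD(3))

lemma HA_homI:
  assumes "comodule_algebra A" "comodule_algebra B" "f \<in> linear_maps A B"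
    and "\<And>a b. a \<in> carrier A \<Longrightarrow> b \<in> carrier A \<Longrightarrow> f (a \<otimes>\<^bsub>A\<^esub> b) = f a \<otimes>\<^bsub>B\<^esub> f b"
    and "f \<one>\<^bsub>A\<^esub> = \<one>\<^bsub>B\<^esub>"
    and "\<And>m. D m \<subseteq> homogeneous A m" and "\<And>v. v \<in> carrier A \<Longrightarrow> v \<in> vspan A (\<Union>m. D m)"
    and "\<And>m v. v \<in> D m \<Longrightarrow> f v \<in> homogeneous B m"
  shows "f \<in> HA_hom A B"
proof -
  have "f \<in> equivariant_maps A B"
    using assms(1-3,6-) by (intro equivariantI[where D = D] comodule_algebra_comodule)
  moreover have "f \<in> ring_hom A B"
    using assms(3-5) by (intro ring_hom_memI) (auto intro: linear_maps_closed linear_maps_add)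
  ultimately show ?thesis by (simp add: HA_hom_def)
qed

lemma HA_homI_homogeneous:
  assumes "comodule_algebra A" "comodule_algebra B" "f \<in> linear_maps A B"
    and "\<And>a b. a \<in> carrier A \<Longrightarrow> b \<in> carrier A \<Longrightarrow> f (a \<otimes>\<^bsub>A\<^esub> b) = f a \<otimes>\<^bsub>B\<^esub> f b"
    and "f \<one>\<^bsub>A\<^esub> = \<one>\<^bsub>B\<^esub>"
    and "\<And>m v. v \<in> homogeneous A m \<Longrightarrow> f v \<in> homogeneous B m"
  shows "f \<in> HA_hom A B"
  using assms comodule_vspan[OF comodule_algebra_comodule[OF assms(1)]]
  by (intro HA_homI[where D = "homogeneous A"]) auto

lemma HA_hom_comp:
  assumes "comodule_algebra A" "comodule_algebra B" "comodule_algebra C"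
    and f: "f \<in> HA_hom A B" and g: "g \<in> HA_hom B C"
  shows "(\<lambda>a. g (f a)) \<in> HA_hom A C"
  using assms(1,3)
proof (rule HA_homI_homogeneous)
  show "(\<lambda>a. g (f a)) \<in> linear_maps A C"
    using HA_homD(1)[OF f] HA_homD(1)[OF g] by (rule linear_maps_comp)
  show "g (f v) \<in> homogeneous C m" if "v \<in> homogeneous A m" for m v
    using HA_hom_homogeneous[OF assms(2,3) g HA_hom_homogeneous[OF assms(1,2) f that]] .
qed (simp_all add: HA_homD(4-)[OF f] HA_homD(5-)[OF g])

lemma HA_isoI:
  assumes "f \<in> HA_hom A B" "g \<in> HA_hom B A"
    and "\<And>a. a \<in> carrier A \<Longrightarrow> g (f a) = a" "\<And>b. b \<in> carrier B \<Longrightarrow> f (g b) = b"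
  shows "f \<in> HA_iso A B"
proof -
  have "bij_betw f (carrier A) (carrier B)"
    using assms HA_homD(4)[OF assms(1)] HA_homD(4)[OF assms(2)]
    by (intro bij_betw_byWitness[of _ g]) auto
  then show ?thesis using assms(1) by (simp add: HA_iso_def)
qed

lemma HA_iso_hom: "f \<in> HA_iso A B \<Longrightarrow> f \<in> HA_hom A B"
  by (simp add: HA_iso_def)

text \<open>\<open>HA_iso\<close> asks only for bijectivity, so the inverse has to be shown to be a
  morphism again. Algebraic compatibility follows from injectivity; compatibility with degrees goes
  through degree components.\<close>

lemma HA_iso_inverse:
  assumes A: "comodule_algebra A" and B: "comodule_algebra B" and f: "f \<in> HA_iso A B"
  obtains g where "g \<in> HA_hom B A" "\<And>a. a \<in> carrier A \<Longrightarrow> g (f a) = a" "\<And>b. b \<in> carrier B \<Longrightarrow> f (g b) = b"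
proof -
  define g where "g = inv_into (carrier A) f"
  have bij: "bij_betw f (carrier A) (carrier B)" and fh: "f \<in> HA_hom A B" using f by (auto simp: HA_iso_def)
  have gf: "g (f a) = a" if "a \<in> carrier A" for a
    using that bij by (simp add: g_def bij_betw_inv_into_left)
  have fg: "f (g b) = b" and gc: "g b \<in> carrier A" if "b \<in> carrier B" for b
    using that bij by (auto simp: g_def bij_betw_inv_into_right bij_betw_def inv_into_into)
  interpret A: vsp A by (intro vsp.intro comodule_algebra_vspace A)
  note alg = comodule_algebra_alg[OF A]
  interpret RA: ring A by (rule alg_ring[OF alg])
  have "g \<in> HA_hom B A"
  proof (rule HA_homI_homogeneous[OF B A])
    show "g \<in> linear_maps B A"
    proof (rule linear_mapsI)
      fix b b' assume b: "b \<in> carrier B" "b' \<in> carrier B"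
      have "g (b \<oplus>\<^bsub>B\<^esub> b') = g (f (g b \<oplus>\<^bsub>A\<^esub> g b'))"
        using b linear_maps_add[OF HA_homD(1)[OF fh] gc gc] by (simp add: fg)
      then show "g (b \<oplus>\<^bsub>B\<^esub> b') = g b \<oplus>\<^bsub>A\<^esub> g b'" using b by (simp add: gf gc)
    next
      fix c b assume b: "b \<in> carrier B"
      have "g (c \<odot>\<^bsub>B\<^esub> b) = g (f (c \<odot>\<^bsub>A\<^esub> g b))"
        using b linear_maps_smult[OF HA_homD(1)[OF fh] gc] by (simp add: fg)
      then show "g (c \<odot>\<^bsub>B\<^esub> b) = c \<odot>\<^bsub>A\<^esub> g b" using b gf[of "c \<odot>\<^bsub>A\<^esub> g b"] A.smult_cl[OF gc] by simp
    qed (rule gc)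
    fix b b' assume b: "b \<in> carrier B" "b' \<in> carrier B"
    have "g (b \<otimes>\<^bsub>B\<^esub> b') = g (f (g b \<otimes>\<^bsub>A\<^esub> g b'))"
      using b HA_homD(5)[OF fh gc gc] by (simp add: fg)
    then show "g (b \<otimes>\<^bsub>B\<^esub> b') = g b \<otimes>\<^bsub>A\<^esub> g b'" using b by (simp add: gf gc)
  next
    have "g \<one>\<^bsub>B\<^esub> = g (f \<one>\<^bsub>A\<^esub>)" using HA_homD(6)[OF fh] by simp
    then show "g \<one>\<^bsub>B\<^esub> = \<one>\<^bsub>A\<^esub>" by (simp add: gf)
  next
    fix m b assume b: "b \<in> homogeneous B m"
    then have bc: "b \<in> carrier B" by (rule homogeneous_closed)
    note co = comodule_algebra_comodule[OF A] comodule_algebra_comodule[OF B]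
    \<comment> \<open>Applying \<open>f\<close> to the degree-\<open>m\<close> component of
      \<open>g b\<close> gives the degree-\<open>m\<close> component of \<open>b\<close>, that is
      \<open>b\<close> itself; injectivity of \<open>f\<close> then identifies this component with
      \<open>g b\<close>.\<close>
    have "f (hom_component A m (g b)) = b"
      using hom_component_equivariant[OF co HA_homD(3)[OF fh] gc[OF bc]] fg[OF bc]
        hom_component_homogeneous_self[OF comodule_algebra_vspace[OF B] b] by simp
    then have "hom_component A m (g b) = g b"
      using gf[OF linear_maps_closed[OF hom_component_linear[OF co(1), of m] gc[OF bc]]] by simp
    then show "g b \<in> homogeneous A m" using hom_component_homogeneous[OF co(1) gc[OF bc], of m] by simp
  qed
  then show ?thesis using gf fg by (rule that)
qed

lemma HA_iso_comp:
  assumes "comodule_algebra A" "comodule_algebra B" "comodule_algebra C"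
    and f: "f \<in> HA_iso A B" and g: "g \<in> HA_iso B C"
  shows "(\<lambda>a. g (f a)) \<in> HA_iso A C"
  using HA_hom_comp[OF assms(1-3) HA_iso_hom[OF f] HA_iso_hom[OF g]] f g bij_betw_trans[of f "carrier A" "carrier B" g "carrier C"]
  by (simp add: HA_iso_def comp_def)

lemma coinvariants_eq: "coinvariants A = homogeneous A 0"
  by (simp add: coinvariants_def homogeneous_def tbasis_zero)

subsection \<open>Quotients by homogeneous ideals\<close>

text \<open>Transports the ring axioms from \<open>A Quot J\<close> to the extended record
  \<open>quotient A J\<close>, which has the same ring fields.\<close>

lemma ring_cong:
  assumes "ring M" "carrier N = carrier M" "monoid.mult N = monoid.mult M" "one N = one M"
    "ring.zero N = ring.zero M" "add N = add M"
  shows "ring N"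
proof -
  interpret M: ring M by fact
  note eq = assms(2-)
  have "abelian_group N"
    by (rule abelian_groupI; unfold eq)
      (simp_all add: M.a_assoc M.add.l_inv_ex, simp add: M.a_comm)
  moreover have "Group.monoid N"
    by (rule monoidI; unfold eq) (simp_all add: M.m_assoc)
  ultimately show ?thesis
    by (rule ringI; unfold eq) (simp_all add: M.l_distr M.r_distr)
qed

lemma vspan_linear_image:
  assumes "vspace V" "vspace W" "f \<in> linear_maps V W" "G \<subseteq> carrier V" "x \<in> vspan V G"
  shows "f x \<in> vspan W (f ` G)"
proof -
  interpret V: vsp V by (rule vsp.intro) fact
  from assms(5) show ?thesis
    by (induction rule: vspan.induct)
      (auto simp: linear_maps_zero[OF assms(1-3)] linear_maps_add[OF assms(3)] linear_maps_smult[OF assms(3)]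
         V.vspan_closed[OF _ assms(4)] intro: vspan.intros)
qed

text \<open>The graded form of stability under the coaction: in a comodule algebra, an ideal is a
  subcomodule exactly if it is spanned by its homogeneous elements.\<close>

definition hom_ideal :: "('k::field, 'n::finite, 'a, 'x) halg_scheme \<Rightarrow> 'a set \<Rightarrow> bool" where
  "hom_ideal A J \<longleftrightarrow> ideal J A \<and> J \<subseteq> vspan A (\<Union>m. homogeneous A m \<inter> J)"

lemma quotient_vspace_simps:
  "carrier (quotient_vspace A J) = a_rcosets\<^bsub>A\<^esub> J"
  "monoid.mult (quotient_vspace A J) = rcoset_mult A J"
  "one (quotient_vspace A J) = J +>\<^bsub>A\<^esub> \<one>\<^bsub>A\<^esub>"
  "ring.zero (quotient_vspace A J) = J"
  "add (quotient_vspace A J) = set_add A"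
  "module.smult (quotient_vspace A J) = (\<lambda>c S. \<Union>x\<in>S. J +>\<^bsub>A\<^esub> (c \<odot>\<^bsub>A\<^esub> x))"
  by (simp_all add: quotient_vspace_def ring.defs module.defs FactRing_def)

lemma quotient_simps:
  "carrier (quotient A J) = a_rcosets\<^bsub>A\<^esub> J"
  "monoid.mult (quotient A J) = rcoset_mult A J"
  "one (quotient A J) = J +>\<^bsub>A\<^esub> \<one>\<^bsub>A\<^esub>"
  "ring.zero (quotient A J) = J"
  "add (quotient A J) = set_add A"
  "module.smult (quotient A J) = (\<lambda>c S. \<Union>x\<in>S. J +>\<^bsub>A\<^esub> (c \<odot>\<^bsub>A\<^esub> x))"
  by (simp_all add: quotient_def module.defs halg.defs quotient_vspace_simps)

lemma same_vs_quotient: "same_vs (quotient_vspace A J) (quotient A J)"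
  by (simp add: same_vs_def quotient_simps quotient_vspace_simps)

section \<open>The quotient algebra, its coaction and its universal property\<close>

locale quot =
  fixes A :: "('k::field, 'n::finite, 'a, 'x) halg_scheme" and J :: "'a set"
  assumes cA: "comodule_algebra A" and hJ: "hom_ideal A J"
begin

abbreviation Q where "Q \<equiv> quotient A J"
abbreviation proj where "proj a \<equiv> J +>\<^bsub>A\<^esub> a"

lemma ideal_J: "ideal J A" using hJ by (simp add: hom_ideal_def)

lemmas algA = comodule_algebra_alg[OF cA] and vA = comodule_algebra_vspace[OF cA]
  and coA = comodule_algebra_coact[OF cA]

sublocale A: vsp A by (intro vsp.intro vA)
sublocale J: ideal J A by (rule ideal_J)

lemma J_sub: "J \<subseteq> carrier A" using J.a_subset .

text \<open>A ring ideal of an algebra is a subspace, since scaling by \<open>c\<close> is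
  multiplication by the element \<open>c\<close> times the unit.\<close>

lemma J_smult: "x \<in> J \<Longrightarrow> c \<odot>\<^bsub>A\<^esub> x \<in> J"
proof -
  assume x: "x \<in> J"
  then have xc: "x \<in> carrier A" using J_sub by auto
  have "c \<odot>\<^bsub>A\<^esub> x = (c \<odot>\<^bsub>A\<^esub> \<one>\<^bsub>A\<^esub>) \<otimes>\<^bsub>A\<^esub> x"
    using alg_smult_left[OF algA, of "\<one>\<^bsub>A\<^esub>" x c] xc by simp
  then show ?thesis using J.I_l_closed[OF x, of "c \<odot>\<^bsub>A\<^esub> \<one>\<^bsub>A\<^esub>"] by simp
qed

lemma proj_eq_iff: "a \<in> carrier A \<Longrightarrow> b \<in> carrier A \<Longrightarrow> proj a = proj b \<longleftrightarrow> a \<ominus>\<^bsub>A\<^esub> b \<in> J"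
  using J.quotient_eq_iff_same_a_r_cos[OF ideal_J] by blast

lemma carrier_Q: "carrier Q = proj ` carrier A"
  by (auto simp: quotient_simps A_RCOSETS_def')

lemma proj_closed: "a \<in> carrier A \<Longrightarrow> proj a \<in> carrier Q"
  by (simp add: carrier_Q)

lemma Q_carrierE:
  assumes "S \<in> carrier Q" obtains a where "a \<in> carrier A" "S = proj a"
  using assms by (auto simp: carrier_Q)

lemma proj_mem: "a \<in> carrier A \<Longrightarrow> x \<in> proj a \<Longrightarrow> x \<in> carrier A \<and> proj x = proj a"
  using J.a_repr_independence'[of x a] J_sub
  by (auto simp: a_r_coset_def')

lemma proj_self: "a \<in> carrier A \<Longrightarrow> a \<in> proj a"
  by (rule J.a_rcos_self)

lemma Q_mult: "a \<in> carrier A \<Longrightarrow> b \<in> carrier A \<Longrightarrow> proj a \<otimes>\<^bsub>Q\<^esub> proj b = proj (a \<otimes>\<^bsub>A\<^esub> b)"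
  by (simp add: quotient_simps J.rcoset_mult_add)

lemma Q_add: "a \<in> carrier A \<Longrightarrow> b \<in> carrier A \<Longrightarrow> proj a \<oplus>\<^bsub>Q\<^esub> proj b = proj (a \<oplus>\<^bsub>A\<^esub> b)"
  by (simp add: quotient_simps J.a_rcos_sum)

lemma Q_one: "\<one>\<^bsub>Q\<^esub> = proj \<one>\<^bsub>A\<^esub>"
  by (simp add: quotient_simps)

text \<open>The union in the definition runs over all representatives of the coset; they contribute
  one and the same coset because \<open>J\<close> is a subspace.\<close>

lemma Q_smult:
  assumes a: "a \<in> carrier A" shows "c \<odot>\<^bsub>Q\<^esub> proj a = proj (c \<odot>\<^bsub>A\<^esub> a)"
proof -
  have "proj (c \<odot>\<^bsub>A\<^esub> x) = proj (c \<odot>\<^bsub>A\<^esub> a)" if "x \<in> proj a" for x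
  proof -
    have x: "x \<in> carrier A" "proj x = proj a" using proj_mem[OF a that] by auto
    then have "c \<odot>\<^bsub>A\<^esub> (x \<ominus>\<^bsub>A\<^esub> a) \<in> J" using a by (simp add: proj_eq_iff J_smult)
    moreover have "c \<odot>\<^bsub>A\<^esub> (x \<ominus>\<^bsub>A\<^esub> a) = c \<odot>\<^bsub>A\<^esub> x \<ominus>\<^bsub>A\<^esub> c \<odot>\<^bsub>A\<^esub> a"
      using x a by (simp add: A.minus_smult A.smult_radd A.smult_mult[symmetric] mult.commute)
    ultimately show ?thesis using x a by (simp add: proj_eq_iff)
  qed
  then have "(\<Union>x\<in>proj a. proj (c \<odot>\<^bsub>A\<^esub> x)) = proj (c \<odot>\<^bsub>A\<^esub> a)"
    using proj_self[OF a] by blast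
  then show ?thesis by (simp add: quotient_simps)
qed

lemma ring_Q: "ring Q"
  by (rule ring_cong[OF J.quotient_is_ring]) (simp_all add: quotient_simps FactRing_def)

lemma vspace_Q: "vspace Q"
proof (rule vspaceI)
  show "abelian_group Q" using ring_Q by (simp add: ring_def)
next
  fix c d :: 'k and S T assume S: "S \<in> carrier Q"
  then obtain a where a: "a \<in> carrier A" "S = proj a" by (rule Q_carrierE)
  show "c \<odot>\<^bsub>Q\<^esub> S \<in> carrier Q" using a by (simp add: Q_smult proj_closed)
  show "(c + d) \<odot>\<^bsub>Q\<^esub> S = c \<odot>\<^bsub>Q\<^esub> S \<oplus>\<^bsub>Q\<^esub> d \<odot>\<^bsub>Q\<^esub> S"
    using a by (simp add: Q_smult Q_add A.smult_ladd)
  show "(c * d) \<odot>\<^bsub>Q\<^esub> S = c \<odot>\<^bsub>Q\<^esub> (d \<odot>\<^bsub>Q\<^esub> S)"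
    using a by (simp add: Q_smult A.smult_mult)
  show "1 \<odot>\<^bsub>Q\<^esub> S = S"
    using a by (simp add: Q_smult)
  assume "T \<in> carrier Q"
  then obtain b where b: "b \<in> carrier A" "T = proj b" by (rule Q_carrierE)
  show "c \<odot>\<^bsub>Q\<^esub> (S \<oplus>\<^bsub>Q\<^esub> T) = c \<odot>\<^bsub>Q\<^esub> S \<oplus>\<^bsub>Q\<^esub> c \<odot>\<^bsub>Q\<^esub> T"
    using a b by (simp add: Q_smult Q_add A.smult_radd)
qed

lemma alg_Q: "alg Q"
proof (rule algI[OF vspace_Q ring_Q])
  fix c S T assume "S \<in> carrier Q" "T \<in> carrier Q"
  then obtain a b where a: "a \<in> carrier A" "S = proj a" and b: "b \<in> carrier A" "T = proj b"
    by (metis Q_carrierE)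
  have ab: "a \<otimes>\<^bsub>A\<^esub> b \<in> carrier A" using alg_mult_closed[OF algA a(1) b(1)] .
  show "(c \<odot>\<^bsub>Q\<^esub> S) \<otimes>\<^bsub>Q\<^esub> T = c \<odot>\<^bsub>Q\<^esub> (S \<otimes>\<^bsub>Q\<^esub> T)"
    unfolding a(2) b(2) using a(1) b(1) ab by (simp only: Q_smult Q_mult alg_smult_left[OF algA] A.smult_cl)
  show "S \<otimes>\<^bsub>Q\<^esub> (c \<odot>\<^bsub>Q\<^esub> T) = c \<odot>\<^bsub>Q\<^esub> (S \<otimes>\<^bsub>Q\<^esub> T)"
    unfolding a(2) b(2) using a(1) b(1) ab by (simp only: Q_smult Q_mult alg_smult_right[OF algA] A.smult_cl)
qed

lemma proj_linear: "(\<lambda>a. proj a) \<in> linear_maps A Q"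
  by (intro linear_mapsI) (simp_all add: proj_closed Q_add Q_smult)

text \<open>The future coaction of the quotient, still as a map on \<open>A\<close>.\<close>

definition \<theta> where
  "\<theta> a = sweedler (tensor torus Q) (coact A a) (\<lambda>h a0. pure_tensor torus Q h (proj a0))"

lemma proj_bilinear: "(\<lambda>h a0. pure_tensor torus Q h (proj a0)) \<in> bilinear_maps torus A (tensor torus Q)"
  by (rule equivariant_bilinear[OF vspace_Q proj_linear])

lemma \<theta>_linear: "\<theta> \<in> linear_maps A (tensor torus Q)"
  unfolding \<theta>_def[abs_def]
  by (intro linear_maps_sweedler_arg[of torus A] vspace_torus vspace_tensor vA vspace_Q proj_bilinear coA)

lemma \<theta>_homogeneous:
  assumes "a \<in> homogeneous A m" shows "\<theta> a = pure_tensor torus Q (tbasis m) (proj a)"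
proof -
  have "a \<in> carrier A" "coact A a = pure_tensor torus A (tbasis m) a"
    using assms by (auto simp: homogeneous_def)
  then show ?thesis
    using sweedler_pure[OF vspace_torus vA vspace_tensor[OF vspace_torus vspace_Q] proj_bilinear, of "tbasis m" a]
    by (simp add: \<theta>_def)
qed

text \<open>Here homogeneity of the ideal enters: on a homogeneous \<open>x\<close> in
  \<open>J\<close> the value is \<open>tbasis m\<close> tensored with the class of \<open>x\<close>,
  which is zero, and such elements span \<open>J\<close>.\<close>

lemma \<theta>_J:
  assumes "j \<in> J" shows "\<theta> j = \<zero>\<^bsub>tensor torus Q\<^esub>"
proof -
  note vT = vspace_tensor[OF vspace_torus vspace_Q]
  interpret T: vsp "tensor torus Q" by (intro vsp.intro vspace_tensor vspace_torus vspace_Q)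
  interpret QQ: vsp Q by (intro vsp.intro vspace_Q)
  have j: "j \<in> vspan A (\<Union>m. homogeneous A m \<inter> J)" using assms hJ by (auto simp: hom_ideal_def)
  have z: "(\<lambda>_. \<zero>\<^bsub>tensor torus Q\<^esub>) \<in> linear_maps A (tensor torus Q)"
    by (intro linear_mapsI) auto
  have sub: "(\<Union>m. homogeneous A m \<inter> J) \<subseteq> carrier A" using J_sub by auto
  have "\<theta> x = \<zero>\<^bsub>tensor torus Q\<^esub>" if x: "x \<in> (\<Union>m. homogeneous A m \<inter> J)" for x
  proof -
    obtain m where m: "x \<in> homogeneous A m" "x \<in> J" using x by auto
    have "proj x = \<zero>\<^bsub>Q\<^esub>" using m by (simp add: quotient_simps J.a_rcos_const)
    moreover have "pure_tensor torus Q (tbasis m) \<zero>\<^bsub>Q\<^esub> = \<zero>\<^bsub>tensor torus Q\<^esub>"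
      using bilinear_maps_right[OF pure_tensor_bilinear[OF vspace_torus vspace_Q]]
      by (intro linear_maps_zero vspace_Q vT) auto
    ultimately show ?thesis by (simp add: \<theta>_homogeneous[OF m(1)])
  qed
  then show ?thesis
    by (rule linear_maps_vspan_eqI[OF vA vT \<theta>_linear z sub j])
qed

lemma coact_Q:
  assumes a: "a \<in> carrier A" shows "coact Q (proj a) = \<theta> a"
proof -
  define x where "x = (SOME x. x \<in> proj a)"
  have "x \<in> proj a" unfolding x_def using proj_self[OF a] by (rule someI)
  then have x: "x \<in> carrier A" "proj x = proj a" using proj_mem[OF a] by auto
  interpret T: vsp "tensor torus Q" by (intro vsp.intro vspace_tensor vspace_torus vspace_Q)
  have "\<theta> x = \<theta> a"
  proof -
    have "\<theta> (x \<ominus>\<^bsub>A\<^esub> a) = \<zero>\<^bsub>tensor torus Q\<^esub>" using x a by (intro \<theta>_J) (simp add: proj_eq_iff)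
    then have "\<theta> x \<ominus>\<^bsub>tensor torus Q\<^esub> \<theta> a = \<zero>\<^bsub>tensor torus Q\<^esub>"
      using linear_maps_minus[OF vA vspace_tensor[OF vspace_torus vspace_Q] \<theta>_linear x(1) a] by simp
    then show ?thesis
      by (rule T.minus_eq_zeroD[OF linear_maps_closed[OF \<theta>_linear x(1)] linear_maps_closed[OF \<theta>_linear a]])
  qed
  \<comment> \<open>The definition of \<open>quotient\<close> computes in the tensor product with
    \<open>quotient_vspace\<close>; \<open>same_vs\<close> identifies it with the tensor product
    with \<open>Q\<close>.\<close>
  moreover have "coact Q (proj a) = \<theta> x"
    unfolding \<theta>_def x_def same_vs_tensor[OF same_vs_refl same_vs_quotient, symmetric]
      same_vs_pure_tensor[OF same_vs_refl same_vs_quotient, symmetric]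
    by (simp add: quotient_def module.defs halg.defs)
  ultimately show ?thesis by simp
qed

lemma coact_Q_linear: "coact Q \<in> linear_maps Q (tensor torus Q)"
proof (rule linear_mapsI)
  fix S T c assume "S \<in> carrier Q"
  then obtain a where a: "a \<in> carrier A" "S = proj a" by (rule Q_carrierE)
  show "coact Q S \<in> carrier (tensor torus Q)"
    using a linear_maps_closed[OF \<theta>_linear] by (simp add: coact_Q)
  show "coact Q (c \<odot>\<^bsub>Q\<^esub> S) = c \<odot>\<^bsub>tensor torus Q\<^esub> coact Q S"
    using a linear_maps_smult[OF \<theta>_linear] by (simp add: Q_smult coact_Q)
  assume "T \<in> carrier Q"
  then obtain b where b: "b \<in> carrier A" "T = proj b" by (rule Q_carrierE)
  show "coact Q (S \<oplus>\<^bsub>Q\<^esub> T) = coact Q S \<oplus>\<^bsub>tensor torus Q\<^esub> coact Q T"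
    using a b linear_maps_add[OF \<theta>_linear] by (simp add: Q_add coact_Q)
qed

lemma proj_homogeneous: "a \<in> homogeneous A m \<Longrightarrow> proj a \<in> homogeneous Q m"
  using homogeneous_closed[of a A m]
  by (simp add: homogeneous_def[of Q] coact_Q \<theta>_homogeneous proj_closed)

lemma proj_span:
  assumes span: "\<And>v. v \<in> carrier A \<Longrightarrow> v \<in> vspan A (\<Union>m. D m)" and D: "\<And>m. D m \<subseteq> homogeneous A m"
    and S: "S \<in> carrier Q"
  shows "S \<in> vspan Q (\<Union>m. proj ` D m)"
proof -
  obtain a where a: "a \<in> carrier A" "S = proj a" using S by (rule Q_carrierE)
  have "(\<Union>m. D m) \<subseteq> carrier A"
    by (rule order_trans[OF UN_mono[OF order_refl D] homogeneous_subset])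
  from vspan_linear_image[OF vA vspace_Q proj_linear this span[OF a(1)]]
  show ?thesis by (simp add: a(2) image_UN)
qed

lemma A_span: "v \<in> carrier A \<Longrightarrow> v \<in> vspan A (\<Union>m. homogeneous A m)"
  by (rule comodule_vspan[OF comodule_algebra_comodule[OF cA]])

lemma comodule_algebra_Q: "comodule_algebra Q"
proof (rule comodule_algebraI[OF alg_Q coact_Q_linear, where D = "\<lambda>m. proj ` homogeneous A m"])
  show "\<And>v. v \<in> carrier Q \<Longrightarrow> v \<in> vspan Q (\<Union>m. proj ` homogeneous A m)"
    by (rule proj_span) (auto intro: A_span)
  fix S T m n assume "S \<in> proj ` homogeneous A m" "T \<in> proj ` homogeneous A n"
  then obtain a b where a: "a \<in> homogeneous A m" "S = proj a" and b: "b \<in> homogeneous A n" "T = proj b"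
    by auto
  show "S \<otimes>\<^bsub>Q\<^esub> T \<in> homogeneous Q (m + n)"
    using a b homogeneous_closed[OF a(1)] homogeneous_closed[OF b(1)] homogeneous_mult[OF cA a(1) b(1)]
    by (simp add: Q_mult proj_homogeneous)
next
  show "\<one>\<^bsub>Q\<^esub> \<in> homogeneous Q 0"
    using homogeneous_one[OF cA] by (simp add: Q_one proj_homogeneous)
qed (auto intro: proj_homogeneous)

lemma proj_HA_hom: "(\<lambda>a. proj a) \<in> HA_hom A Q"
  by (rule HA_homI_homogeneous[OF cA comodule_algebra_Q proj_linear])
    (simp_all add: Q_mult Q_one proj_homogeneous)

text \<open>Commutation is required between classes only, because for the free associative algebra
  it is the quotient that creates it. \<open>HA_obj_Q\<close> is the case where it already holds in
  \<open>A\<close>.\<close>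

lemma HA_obj_Q_D:
  assumes R: "R \<in> linear_maps (tensor torus torus) ground"
    and span: "\<And>v. v \<in> carrier A \<Longrightarrow> v \<in> vspan A (\<Union>m. D m)" and D: "\<And>m. D m \<subseteq> homogeneous A m"
    and comm: "\<And>a b m n. a \<in> D m \<Longrightarrow> b \<in> D n \<Longrightarrow>
      proj a \<otimes>\<^bsub>Q\<^esub> proj b = R (HH (tbasis n) (tbasis m)) \<odot>\<^bsub>Q\<^esub> (proj b \<otimes>\<^bsub>Q\<^esub> proj a)"
  shows "HA_obj R Q"
  using R comodule_algebra_Q
proof (rule HA_objI[where D = "\<lambda>m. proj ` D m"])
  show "\<And>m. proj ` D m \<subseteq> homogeneous Q m" using D by (auto intro: proj_homogeneous)
  show "\<And>v. v \<in> carrier Q \<Longrightarrow> v \<in> vspan Q (\<Union>m. proj ` D m)" using span D by (rule proj_span)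
  fix S T m n assume "S \<in> proj ` D m" "T \<in> proj ` D n"
  then obtain a b where a: "a \<in> D m" "S = proj a" and b: "b \<in> D n" "T = proj b" by auto
  show "S \<otimes>\<^bsub>Q\<^esub> T = R (HH (tbasis n) (tbasis m)) \<odot>\<^bsub>Q\<^esub> (T \<otimes>\<^bsub>Q\<^esub> S)"
    unfolding a(2) b(2) by (rule comm[OF a(1) b(1)])
qed

lemma HA_obj_Q:
  assumes R: "R \<in> linear_maps (tensor torus torus) ground" and A: "HA_obj R A"
  shows "HA_obj R Q"
proof (rule HA_obj_Q_D[OF R A_span order_refl])
  fix a b m n assume a: "a \<in> homogeneous A m" and b: "b \<in> homogeneous A n"
  note c = homogeneous_closed[OF a] homogeneous_closed[OF b]
  have "proj (a \<otimes>\<^bsub>A\<^esub> b) = proj (R (HH (tbasis n) (tbasis m)) \<odot>\<^bsub>A\<^esub> (b \<otimes>\<^bsub>A\<^esub> a))"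
    using HA_obj_comm[OF R A a b] by simp
  also have "\<dots> = R (HH (tbasis n) (tbasis m)) \<odot>\<^bsub>Q\<^esub> proj (b \<otimes>\<^bsub>A\<^esub> a)"
    using Q_smult[OF alg_mult_closed[OF algA c(2,1)]] by simp
  finally show "proj a \<otimes>\<^bsub>Q\<^esub> proj b = R (HH (tbasis n) (tbasis m)) \<odot>\<^bsub>Q\<^esub> (proj b \<otimes>\<^bsub>Q\<^esub> proj a)"
    using c by (simp only: Q_mult)
qed

text \<open>Since \<open>f\<close> kills \<open>J\<close>, its value at a chosen representative of a
  coset does not depend on the choice. Homogeneous classes of the form \<open>proj a\<close> with
  \<open>a\<close> homogeneous span the quotient, which suffices for equivariance.\<close>

lemma lift:
  assumes C: "comodule_algebra C" and f: "f \<in> HA_hom A C" and J0: "\<And>j. j \<in> J \<Longrightarrow> f j = \<zero>\<^bsub>C\<^esub>"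
  obtains F where "F \<in> HA_hom Q C" "\<And>a. a \<in> carrier A \<Longrightarrow> F (proj a) = f a"
proof -
  interpret C: vsp C by (intro vsp.intro comodule_algebra_vspace C)
  define F where "F S = f (SOME x. x \<in> S)" for S
  have F: "F (proj a) = f a" if a: "a \<in> carrier A" for a
  proof -
    define x where "x = (SOME x. x \<in> proj a)"
    have "x \<in> proj a" unfolding x_def using proj_self[OF a] by (rule someI)
    then have x: "x \<in> carrier A" "proj x = proj a" using proj_mem[OF a] by auto
    have "f (x \<ominus>\<^bsub>A\<^esub> a) = \<zero>\<^bsub>C\<^esub>" using x a by (intro J0) (simp add: proj_eq_iff)
    then have "f x \<ominus>\<^bsub>C\<^esub> f a = \<zero>\<^bsub>C\<^esub>"
      using linear_maps_minus[OF vA comodule_algebra_vspace[OF C] HA_homD(1)[OF f] x(1) a] by simp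
    then have "f x = f a"
      by (rule C.minus_eq_zeroD[OF HA_homD(4)[OF f x(1)] HA_homD(4)[OF f a]])
    then show ?thesis by (simp add: F_def x_def)
  qed
  have "F \<in> HA_hom Q C"
  proof (rule HA_homI[OF comodule_algebra_Q C, where D = "\<lambda>m. proj ` homogeneous A m"])
    show "F \<in> linear_maps Q C"
    proof (rule linear_mapsI)
      fix S T c assume "S \<in> carrier Q"
      then obtain a where a: "a \<in> carrier A" "S = proj a" by (rule Q_carrierE)
      show "F S \<in> carrier C" using a HA_homD(4)[OF f] by (simp add: F)
      show "F (c \<odot>\<^bsub>Q\<^esub> S) = c \<odot>\<^bsub>C\<^esub> F S"
        using a linear_maps_smult[OF HA_homD(1)[OF f]] by (simp add: Q_smult F)
      assume "T \<in> carrier Q"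
      then obtain b where b: "b \<in> carrier A" "T = proj b" by (rule Q_carrierE)
      show "F (S \<oplus>\<^bsub>Q\<^esub> T) = F S \<oplus>\<^bsub>C\<^esub> F T"
        using a b linear_maps_add[OF HA_homD(1)[OF f]] by (simp add: Q_add F)
    qed
    show "F (S \<otimes>\<^bsub>Q\<^esub> T) = F S \<otimes>\<^bsub>C\<^esub> F T" if ST: "S \<in> carrier Q" "T \<in> carrier Q" for S T
    proof -
      obtain a b where a: "a \<in> carrier A" "S = proj a" and b: "b \<in> carrier A" "T = proj b"
        using ST by (metis Q_carrierE)
      show ?thesis using a b HA_homD(5)[OF f] alg_mult_closed[OF algA] by (simp add: Q_mult F)
    qed
    show "F \<one>\<^bsub>Q\<^esub> = \<one>\<^bsub>C\<^esub>" using HA_homD(6)[OF f] by (simp add: Q_one F)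
    show "\<And>v. v \<in> carrier Q \<Longrightarrow> v \<in> vspan Q (\<Union>m. proj ` homogeneous A m)"
      by (rule proj_span) (auto intro: A_span)
    fix m S assume "S \<in> proj ` homogeneous A m"
    then obtain a where a: "a \<in> homogeneous A m" "S = proj a" by auto
    then show "F S \<in> homogeneous C m"
      using HA_hom_homogeneous[OF cA C f a(1)] F[OF homogeneous_closed[OF a(1)]] by simp
  qed (auto intro: proj_homogeneous)
  then show ?thesis using F by (rule that)
qed

end

text \<open>The span of the homogeneous elements of \<open>Idl G\<close> is again an ideal containing \<open>G\<close>.\<close>

lemma genideal_hom_ideal:
  fixes A :: "('k::field, 'n::finite, 'a, 'x) halg_scheme"
  assumes A: "comodule_algebra A" and G: "G \<subseteq> carrier A"
    and span: "G \<subseteq> vspan A (\<Union>m. homogeneous A m \<inter> Idl\<^bsub>A\<^esub> G)"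
  shows "hom_ideal A (Idl\<^bsub>A\<^esub> G)"
proof -
  let ?I = "Idl\<^bsub>A\<^esub> G" and ?H = "\<Union>m. homogeneous A m \<inter> Idl\<^bsub>A\<^esub> G"
  note alg = comodule_algebra_alg[OF A]
  interpret V: vsp A by (intro vsp.intro comodule_algebra_vspace A)
  interpret ring A by (rule comodule_algebra_ring[OF A])
  interpret I: ideal ?I A by (rule genideal_ideal[OF G])
  have sub: "?H \<subseteq> carrier A" using I.a_subset by auto
  have cl: "x \<in> carrier A" if "x \<in> vspan A ?H" for x using V.vspan_closed[OF that sub] .
  have hspan: "a \<in> vspan A (\<Union>m. homogeneous A m)" if "a \<in> carrier A" for a
    using comodule_vspan[OF comodule_algebra_comodule[OF A] that] .
  \<comment> \<open>If both factors are homogeneous, the product is homogeneous and stays in the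
    ideal. A general left factor is a combination of homogeneous ones.\<close>
  have bl: "a \<otimes>\<^bsub>A\<^esub> x \<in> vspan A ?H" if a: "a \<in> carrier A" and x: "x \<in> ?H" for a x
  proof -
    have "(\<lambda>a. a \<otimes>\<^bsub>A\<^esub> x) ` (\<Union>m. homogeneous A m) \<subseteq> vspan A ?H"
    proof
      fix z assume "z \<in> (\<lambda>a. a \<otimes>\<^bsub>A\<^esub> x) ` (\<Union>m. homogeneous A m)"
      then obtain m n b where z: "z = b \<otimes>\<^bsub>A\<^esub> x" "b \<in> homogeneous A m" "x \<in> homogeneous A n" "x \<in> ?I"
        using x by auto
      then have "z \<in> homogeneous A (m + n) \<inter> ?I"
        using homogeneous_mult[OF A z(2,3)] I.I_l_closed[OF z(4) homogeneous_closed[OF z(2)]] by simp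
      then show "z \<in> vspan A ?H" by (blast intro: vspan.base)
    qed
    moreover have "a \<otimes>\<^bsub>A\<^esub> x \<in> vspan A ((\<lambda>a. a \<otimes>\<^bsub>A\<^esub> x) ` (\<Union>m. homogeneous A m))"
      using x sub by (intro vspan_linear_image[OF alg_vspace[OF alg] alg_vspace[OF alg]
          alg_mult_left_linear[OF alg] homogeneous_subset hspan[OF a]]) auto
    ultimately show ?thesis by (rule vspan_mono[rotated])
  qed
  have br: "x \<otimes>\<^bsub>A\<^esub> a \<in> vspan A ?H" if a: "a \<in> carrier A" and x: "x \<in> ?H" for a x
  proof -
    have "(\<lambda>a. x \<otimes>\<^bsub>A\<^esub> a) ` (\<Union>m. homogeneous A m) \<subseteq> vspan A ?H"
    proof
      fix z assume "z \<in> (\<lambda>a. x \<otimes>\<^bsub>A\<^esub> a) ` (\<Union>m. homogeneous A m)"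
      then obtain m n b where z: "z = x \<otimes>\<^bsub>A\<^esub> b" "b \<in> homogeneous A m" "x \<in> homogeneous A n" "x \<in> ?I"
        using x by auto
      then have "z \<in> homogeneous A (n + m) \<inter> ?I"
        using homogeneous_mult[OF A z(3,2)] I.I_r_closed[OF z(4) homogeneous_closed[OF z(2)]] by simp
      then show "z \<in> vspan A ?H" by (blast intro: vspan.base)
    qed
    moreover have "x \<otimes>\<^bsub>A\<^esub> a \<in> vspan A ((\<lambda>a. x \<otimes>\<^bsub>A\<^esub> a) ` (\<Union>m. homogeneous A m))"
      using x sub by (intro vspan_linear_image[OF alg_vspace[OF alg] alg_vspace[OF alg]
          alg_mult_right_linear[OF alg] homogeneous_subset hspan[OF a]]) auto
    ultimately show ?thesis by (rule vspan_mono[rotated])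
  qed
  have "ideal (vspan A ?H) A"
  proof (rule idealI[OF ring_axioms])
    show "subgroup (vspan A ?H) (add_monoid A)"
    proof (rule V.add.subgroupI)
      show "vspan A ?H \<subseteq> carrier A" using cl by auto
      show "vspan A ?H \<noteq> {}" using vspan.zero by auto
      show "\<ominus>\<^bsub>A\<^esub> a \<in> vspan A ?H" if "a \<in> vspan A ?H" for a
        using vspan.smult[OF that, of "- 1"] cl[OF that] by (simp add: V.smult_m1)
      show "a \<oplus>\<^bsub>A\<^esub> b \<in> vspan A ?H" if "a \<in> vspan A ?H" "b \<in> vspan A ?H" for a b
        using that by (rule vspan.add)
    qed
    fix a x assume a: "a \<in> vspan A ?H" and x: "x \<in> carrier A"
    have "(\<lambda>a. x \<otimes>\<^bsub>A\<^esub> a) a \<in> vspan A ((\<lambda>a. x \<otimes>\<^bsub>A\<^esub> a) ` ?H)"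
      by (rule vspan_linear_image[OF alg_vspace[OF alg] alg_vspace[OF alg]
          alg_mult_right_linear[OF alg x] sub a])
    then show "x \<otimes>\<^bsub>A\<^esub> a \<in> vspan A ?H" by (rule vspan_mono) (use bl[OF x] in blast)
    have "(\<lambda>a. a \<otimes>\<^bsub>A\<^esub> x) a \<in> vspan A ((\<lambda>a. a \<otimes>\<^bsub>A\<^esub> x) ` ?H)"
      by (rule vspan_linear_image[OF alg_vspace[OF alg] alg_vspace[OF alg]
          alg_mult_left_linear[OF alg x] sub a])
    then show "a \<otimes>\<^bsub>A\<^esub> x \<in> vspan A ?H" by (rule vspan_mono) (use br[OF x] in blast)
  qed
  then have "?I \<subseteq> vspan A ?H" using span by (rule genideal_minimal)
  then show ?thesis using I.ideal_axioms by (simp add: hom_ideal_def)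
qed

lemma genideal_hom_ideal_homogeneous:
  assumes A: "comodule_algebra A" and G: "\<And>x. x \<in> G \<Longrightarrow> \<exists>m. x \<in> homogeneous A m"
  shows "hom_ideal A (Idl\<^bsub>A\<^esub> G)"
proof -
  interpret ring A by (rule comodule_algebra_ring[OF A])
  have sub: "G \<subseteq> carrier A" using G by (auto dest!: homogeneous_closed)
  show ?thesis
  proof (rule genideal_hom_ideal[OF A sub])
    show "G \<subseteq> vspan A (\<Union>m. homogeneous A m \<inter> Idl\<^bsub>A\<^esub> G)"
      using G genideal_self[OF sub] by (auto intro!: vspan.base)
  qed
qed

lemma HA_hom_kills_genideal:
  assumes A: "comodule_algebra A" and C: "comodule_algebra C" and f: "f \<in> HA_hom A C"
    and G: "G \<subseteq> carrier A" and 0: "\<And>x. x \<in> G \<Longrightarrow> f x = \<zero>\<^bsub>C\<^esub>" and j: "j \<in> Idl\<^bsub>A\<^esub> G"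
  shows "f j = \<zero>\<^bsub>C\<^esub>"
proof -
  interpret ring_hom_ring A C f
    by (rule ring_hom_ringI2[OF comodule_algebra_ring[OF A] comodule_algebra_ring[OF C] HA_homD(2)[OF f]])
  have "G \<subseteq> a_kernel A C f"
    unfolding a_kernel_def' using G 0 by blast
  then have "Idl\<^bsub>A\<^esub> G \<subseteq> a_kernel A C f"
    by (rule R.genideal_minimal[OF kernel_is_ideal])
  then show ?thesis using j unfolding a_kernel_def' by blast
qed

subsection \<open>Bicharacters\<close>

locale cotri =
  fixes R :: "('k::field, 'n::finite) braiding"
  assumes cot: "cotriangular R"
begin

abbreviation r :: "int ^ 'n \<Rightarrow> int ^ 'n \<Rightarrow> 'k" where "r m n \<equiv> R (HH (tbasis m) (tbasis n))"

lemma R_linear: "R \<in> linear_maps (tensor torus torus) ground"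
  using cot by (rule cotriangular_linear)

lemmas R_lin = braiding_linear[OF R_linear]

lemma linear_mult_const: "L \<in> linear_maps V ground \<Longrightarrow> (\<lambda>v. L v * c) \<in> linear_maps V (ground :: ('k, 'k) module)"
  "L \<in> linear_maps V ground \<Longrightarrow> (\<lambda>v. c * L v) \<in> linear_maps V (ground :: ('k, 'k) module)"
  by (auto simp: linear_maps_def algebra_simps)

text \<open>The basis elements are grouplike, so the Sweedler sum in the axiom for \<open>R\<close>
  has a single term. Together with \<open>r_add_right\<close> this makes \<open>r\<close> a
  bicharacter.\<close>

lemma r_add_left: "r (m + m') n = r m n * r m' n"
proof -
  have b: "(\<lambda>h1 h2. R (HH f h1) * R (HH g h2)) \<in> bilinear_maps torus torus ground" for f g
    by (intro bilinear_mapsI linear_mult_const R_lin)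
  have "r (m + m') n = sweedler ground (HH (tbasis n) (tbasis n)) (\<lambda>h1 h2. R (HH (tbasis m) h1) * R (HH (tbasis m') h2))"
    using cot by (simp add: cotriangular_def tbasis_add coproduct_H_tbasis)
  also have "\<dots> = r m n * r m' n"
    by (intro sweedler_pure vspace_torus vspace_ground b) auto
  finally show ?thesis .
qed

lemma r_add_right: "r n (m + m') = r n m * r n m'"
proof -
  have b: "(\<lambda>h1 h2. R (HH h1 g) * R (HH h2 f)) \<in> bilinear_maps torus torus ground" for f g
    by (intro bilinear_mapsI linear_mult_const R_lin)
  have "r n (m + m') = sweedler ground (HH (tbasis n) (tbasis n)) (\<lambda>h1 h2. R (HH h1 (tbasis m')) * R (HH h2 (tbasis m)))"
    using cot by (simp add: cotriangular_def tbasis_add coproduct_H_tbasis)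
  also have "\<dots> = r n m' * r n m"
    by (intro sweedler_pure vspace_torus vspace_ground b) auto
  finally show ?thesis by simp
qed

text \<open>The third cotriangularity axiom at grouplike elements, where both counits are 1.\<close>

lemma r_inverse: "r m n * r n m = 1"
proof -
  have q: "(\<lambda>h1 h2 g1 g2. R (HH h1 g1) * R (HH g2 h2)) \<in> quadlin torus torus torus torus ground"
    by (intro quadlinI linear_mult_const R_lin)
  have "counit_H (tbasis m :: ('k, 'n) torus) * counit_H (tbasis n :: ('k, 'n) torus)
      = sweedler ground (coproduct_H (tbasis m)) (\<lambda>h1 h2.
          sweedler ground (coproduct_H (tbasis n)) (\<lambda>g1 g2. R (HH h1 g1) * R (HH g2 h2)))"
    using cot unfolding cotriangular_def by blast
  also have "\<dots> = r m n * r n m"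
    unfolding coproduct_H_tbasis by (intro dbl_pure vspace_torus vspace_ground q) auto
  finally show ?thesis by simp
qed

text \<open>Idempotent by the bicharacter laws and nonzero by \<open>r_inverse\<close>, hence
  1.\<close>

lemma r_zero [simp]: "r 0 n = 1" "r n 0 = 1"
proof -
  have "r 0 n \<noteq> 0" "r n 0 \<noteq> 0" using r_inverse[of 0 n] r_inverse[of n 0] by auto
  moreover have "r 0 n * r 0 n = r 0 n" "r n 0 * r n 0 = r n 0"
    using r_add_left[of 0 0 n] r_add_right[of n 0 0] by auto
  ultimately show "r 0 n = 1" "r n 0 = 1" by auto
qed

text \<open>The degrees are explicit arguments rather than read off from the coaction, so that
  inductions over words can carry them along.\<close>

definition bcomm :: "('k, 'a, 'x) module_scheme \<Rightarrow> 'a \<Rightarrow> int ^ 'n \<Rightarrow> 'a \<Rightarrow> int ^ 'n \<Rightarrow> bool" where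
  "bcomm A a m b n \<longleftrightarrow> a \<otimes>\<^bsub>A\<^esub> b = r n m \<odot>\<^bsub>A\<^esub> (b \<otimes>\<^bsub>A\<^esub> a)"

text \<open>Moving \<open>b\<close> first past \<open>a'\<close> and then past \<open>a\<close>
  collects two factors, which \<open>r_add_right\<close> combines into one.\<close>

lemma bcomm_mult_left:
  assumes A: "alg A" and c: "a \<in> carrier A" "a' \<in> carrier A" "b \<in> carrier A"
    and ab: "bcomm A a m b n" and a'b: "bcomm A a' m' b n"
  shows "bcomm A (a \<otimes>\<^bsub>A\<^esub> a') (m + m') b n"
proof -
  interpret ring A using A by (rule alg_ring)
  interpret V: vsp A by (intro vsp.intro alg_vspace A)
  have "a \<otimes>\<^bsub>A\<^esub> a' \<otimes>\<^bsub>A\<^esub> b = a \<otimes>\<^bsub>A\<^esub> (a' \<otimes>\<^bsub>A\<^esub> b)" using c by (rule m_assoc)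
  also have "\<dots> = r n m' \<odot>\<^bsub>A\<^esub> (a \<otimes>\<^bsub>A\<^esub> b \<otimes>\<^bsub>A\<^esub> a')"
    using c a'b by (simp add: bcomm_def alg_smult_right[OF A] m_assoc)
  also have "\<dots> = r n m' \<odot>\<^bsub>A\<^esub> (r n m \<odot>\<^bsub>A\<^esub> (b \<otimes>\<^bsub>A\<^esub> a \<otimes>\<^bsub>A\<^esub> a'))"
    using c ab by (simp add: bcomm_def alg_smult_left[OF A])
  also have "\<dots> = r n (m + m') \<odot>\<^bsub>A\<^esub> (b \<otimes>\<^bsub>A\<^esub> (a \<otimes>\<^bsub>A\<^esub> a'))"
    using c by (simp add: V.smult_mult[symmetric] r_add_right m_assoc mult.commute)
  finally show ?thesis by (simp add: bcomm_def)
qed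

text \<open>The exchange factors in the two directions are mutually inverse by
  \<open>r_inverse\<close>; this is the symmetry of the braiding.\<close>

lemma bcomm_sym:
  assumes A: "alg A" and c: "a \<in> carrier A" "b \<in> carrier A" and ab: "bcomm A a m b n"
  shows "bcomm A b n a m"
proof -
  interpret V: vsp A by (intro vsp.intro alg_vspace A)
  have "r m n \<odot>\<^bsub>A\<^esub> (a \<otimes>\<^bsub>A\<^esub> b) = (r m n * r n m) \<odot>\<^bsub>A\<^esub> (b \<otimes>\<^bsub>A\<^esub> a)"
    using c ab alg_mult_closed[OF A] by (simp add: bcomm_def V.smult_mult)
  then show ?thesis using c alg_mult_closed[OF A] by (simp add: bcomm_def r_inverse)
qed

lemma bcomm_one:
  assumes A: "alg A" and c: "b \<in> carrier A" shows "bcomm A \<one>\<^bsub>A\<^esub> 0 b n"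
proof -
  interpret ring A using A by (rule alg_ring)
  interpret V: vsp A by (intro vsp.intro alg_vspace A)
  show ?thesis using c by (simp add: bcomm_def)
qed

end

section \<open>The elements of a fixed degree form a subspace\<close>

lemma homogeneous_add:
  assumes "vspace A" "coact A \<in> linear_maps A (tensor torus A)" "a \<in> homogeneous A m" "b \<in> homogeneous A m"
  shows "a \<oplus>\<^bsub>A\<^esub> b \<in> homogeneous A m"
proof -
  interpret V: vsp A by (intro vsp.intro assms)
  show ?thesis using assms linear_maps_add[OF bilinear_maps_right[OF pure_tensor_bilinear[OF vspace_torus assms(1)]], of "tbasis m" a b]
    by (simp add: homogeneous_def linear_maps_add[OF assms(2)])
qed

lemma homogeneous_smult:
  assumes "vspace A" "coact A \<in> linear_maps A (tensor torus A)" "a \<in> homogeneous A m"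
  shows "c \<odot>\<^bsub>A\<^esub> a \<in> homogeneous A m"
proof -
  interpret V: vsp A by (intro vsp.intro assms)
  show ?thesis using assms
    by (simp add: homogeneous_def linear_maps_smult[OF assms(2)] pure_tensor_smult_right vspace_torus)
qed

lemma homogeneous_minus:
  assumes "vspace A" "coact A \<in> linear_maps A (tensor torus A)" "a \<in> homogeneous A m" "b \<in> homogeneous A m"
  shows "a \<ominus>\<^bsub>A\<^esub> b \<in> homogeneous A m"
proof -
  interpret V: vsp A by (intro vsp.intro assms)
  show ?thesis using assms homogeneous_closed
    by (simp add: V.minus_smult[OF homogeneous_closed homogeneous_closed] homogeneous_add homogeneous_smult)
qed

subsection \<open>Free algebras\<close>

lemma letters_plus [simp]: "letters (u + v) = letters u @ letters v"
  and letters_zero [simp]: "letters 0 = []"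
  by (simp_all add: plus_word_def zero_word_def)

lemma assoc_vspace_simps:
  "carrier (assoc_vspace N) = {p. \<forall>w\<in>Poly_Mapping.keys p. \<forall>i\<in>set (letters w). i < N}"
  "monoid.mult (assoc_vspace N) = (*)" "one (assoc_vspace N) = 1" "ring.zero (assoc_vspace N) = 0"
  "add (assoc_vspace N) = (+)" "module.smult (assoc_vspace N) = pscale"
  by (simp_all add: assoc_vspace_def ring.defs module.defs)

text \<open>The argument \<open>kty\<close> brings the scalar field into the locale, as the list of
  degrees does not mention it and the braiding is fixed only later.\<close>

locale free_assoc =
  fixes ms :: "(int ^ 'n::finite) list" and kty :: "'k::field itself"
begin

abbreviation T :: "('k, 'n, 'k ncpoly) halg" where "T \<equiv> assoc_algebra ms"

definition WN :: "word set" where "WN = {w. \<forall>i\<in>set (letters w). i < length ms}"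

definition deg :: "word \<Rightarrow> int ^ 'n" where "deg w = (\<Sum>i\<leftarrow>letters w. ms ! i)"

lemma T_simps:
  "carrier T = {p. Poly_Mapping.keys p \<subseteq> WN}"
  "monoid.mult T = (*)" "one T = 1" "ring.zero T = 0" "add T = (+)" "module.smult T = pscale"
  by (auto simp: assoc_algebra_def Let_def module.defs halg.defs assoc_vspace_simps WN_def)

lemma same_vs_T: "same_vs (assoc_vspace (length ms)) T"
  by (auto simp: same_vs_def T_simps assoc_vspace_simps WN_def)

lemma WN_add: "u + v \<in> WN \<longleftrightarrow> u \<in> WN \<and> v \<in> WN"
  by (auto simp: WN_def)

lemma WN_zero: "0 \<in> WN" by (simp add: WN_def)

lemma deg_add: "deg (u + v) = deg u + deg v" and deg_zero: "deg 0 = 0"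
  by (simp_all add: deg_def)

lemma abelian_group_T: "abelian_group T"
proof (rule abelian_groupI)
  fix p q assume "p \<in> carrier T" "q \<in> carrier T"
  then show "p \<oplus>\<^bsub>T\<^esub> q \<in> carrier T" using keys_add[of p q] by (auto simp: T_simps)
next
  fix p assume "p \<in> carrier T"
  then show "\<exists>q\<in>carrier T. q \<oplus>\<^bsub>T\<^esub> p = \<zero>\<^bsub>T\<^esub>"
    by (intro bexI[of _ "- p"]) (auto simp: T_simps keys_minus')
qed (auto simp: T_simps add.assoc add.commute)

lemma T_mult_closed: "p \<in> carrier T \<Longrightarrow> q \<in> carrier T \<Longrightarrow> p * q \<in> carrier T"
  using keys_mult[of p q] by (force simp: T_simps WN_add)

lemma ring_T: "ring T"
proof (rule ringI[OF abelian_group_T])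
  show "Group.monoid T"
    by (rule monoidI) (auto simp: T_simps mult.assoc WN_zero intro: T_mult_closed[unfolded T_simps, simplified, THEN subsetD])
qed (auto simp: T_simps algebra_simps)

lemma vspace_T: "vspace T"
proof (rule vspaceI[OF abelian_group_T])
  fix c p assume "p \<in> carrier T"
  then show "c \<odot>\<^bsub>T\<^esub> p \<in> carrier T" using keys_pscale[of c p] by (auto simp: T_simps)
qed (auto simp: T_simps pscale_add_left pscale_add pscale_pscale)

lemma alg_T: "alg T"
  by (rule algI[OF vspace_T ring_T]) (simp_all add: T_simps pscale_mult_left pscale_mult_right)

definition wd :: "word \<Rightarrow> 'k ncpoly" where "wd w = Poly_Mapping.single w 1"

lemma wd_closed: "w \<in> WN \<Longrightarrow> wd w \<in> carrier T"
  by (simp add: wd_def T_simps)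

lemma wd_add: "wd (u + v) = wd u * wd v"
  by (simp add: wd_def mult_single)

lemma wd_zero: "wd 0 = 1"
  by (simp add: wd_def)

lemma var_wd: "var i = wd (Word [i])"
  by (simp add: var_def wd_def)

lemma T_span: "p \<in> carrier T \<Longrightarrow> p \<in> vspan T (wd ` WN)"
proof -
  assume "p \<in> carrier T"
  then have "Poly_Mapping.keys p \<subseteq> WN" by (simp add: T_simps)
  then show ?thesis
  proof (induction p rule: poly_mapping_keys_induct)
    case zero
    show ?case using vspan.zero[of T "wd ` WN"] by (simp add: T_simps)
  next
    case (single w c)
    then have "c \<odot>\<^bsub>T\<^esub> wd w \<in> vspan T (wd ` WN)" by (blast intro: vspan.smult vspan.base)
    then show ?case by (simp add: T_simps wd_def)
  next
    case (add p q)
    then have "p \<oplus>\<^bsub>T\<^esub> q \<in> vspan T (wd ` WN)" by (blast intro: vspan.add)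
    then show ?case by (simp add: T_simps)
  qed
qed

lemma lext_linear_T:
  assumes "vspace U" "f \<in> WN \<rightarrow> carrier U"
  shows "lext U f \<in> linear_maps T U"
proof -
  interpret U: vsp U using assms by (intro vsp.intro)
  show ?thesis using assms(2) U.lext_closed[of _ WN f]
    by (intro linear_mapsI) (auto simp: T_simps U.lext_add[of _ WN] U.lext_pscale[of _ WN])
qed

lemma coact_T: "coact T = lext (tensor torus T) (\<lambda>w. pure_tensor torus T (tbasis (deg w)) (wd w))"
  unfolding same_vs_tensor[OF same_vs_refl same_vs_T, symmetric]
    same_vs_pure_tensor[OF same_vs_refl same_vs_T, symmetric]
  by (simp add: assoc_algebra_def Let_def module.defs halg.defs lext_def fun_eq_iff wd_def deg_def)

lemma coact_T_linear: "coact T \<in> linear_maps T (tensor torus T)"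
  unfolding coact_T
  by (intro lext_linear_T vspace_tensor vspace_torus vspace_T)
    (auto intro!: pure_tensor_closed vspace_torus vspace_T wd_closed)

lemma wd_homogeneous: "w \<in> WN \<Longrightarrow> wd w \<in> homogeneous T (deg w)"
proof -
  assume w: "w \<in> WN"
  interpret U: vsp "tensor (torus :: ('k, ('k, 'n) torus) module) T"
    by (intro vsp.intro vspace_tensor vspace_torus vspace_T)
  have c: "pure_tensor torus T (tbasis (deg w)) (wd w) \<in> carrier (tensor torus T)"
    by (intro pure_tensor_closed vspace_torus vspace_T wd_closed w) auto
  have "coact T (wd w) = 1 \<odot>\<^bsub>tensor torus T\<^esub> pure_tensor torus T (tbasis (deg w)) (wd w)"
    unfolding coact_T wd_def by (rule U.lext_single) (use c in \<open>simp add: wd_def\<close>)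
  then show ?thesis using c wd_closed[OF w] by (simp add: homogeneous_def)
qed

definition WD :: "int ^ 'n \<Rightarrow> 'k ncpoly set" where "WD m = {wd w |w. w \<in> WN \<and> deg w = m}"

lemma WD_homogeneous: "WD m \<subseteq> homogeneous T m"
  using wd_homogeneous by (auto simp: WD_def)

lemma WD_union: "(\<Union>m. WD m) = wd ` WN"
  by (auto simp: WD_def)

lemma WD_span: "p \<in> carrier T \<Longrightarrow> p \<in> vspan T (\<Union>m. WD m)"
  unfolding WD_union by (rule T_span)

lemma comodule_algebra_T: "comodule_algebra T"
proof (rule comodule_algebraI[OF alg_T coact_T_linear WD_homogeneous WD_span])
  fix a b m n assume "a \<in> WD m" "b \<in> WD n"
  then obtain u v where "a = wd u" "b = wd v" "u \<in> WN" "v \<in> WN" "deg u = m" "deg v = n"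
    by (auto simp: WD_def)
  then show "a \<otimes>\<^bsub>T\<^esub> b \<in> homogeneous T (m + n)"
    using wd_homogeneous[of "u + v"] by (simp add: T_simps wd_add WN_add deg_add)
next
  show "\<one>\<^bsub>T\<^esub> \<in> homogeneous T 0"
    using wd_homogeneous[OF WN_zero] by (simp add: T_simps wd_zero deg_zero)
qed

lemma word_induct [consumes 1, case_names zero Cons]:
  assumes "w \<in> WN" "P 0" "\<And>i v. i < length ms \<Longrightarrow> v \<in> WN \<Longrightarrow> P v \<Longrightarrow> P (Word [i] + v)"
  shows "P w"
proof -
  have "P (Word l)" if "\<forall>i\<in>set l. i < length ms" for l
    using that
  proof (induction l)
    case Nil
    then show ?case using assms(2) by (simp add: zero_word_def)
  next
    case (Cons i l)
    then have "P (Word [i] + Word l)" by (intro assms(3)) (auto simp: WN_def)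
    then show ?case by (simp add: plus_word_def)
  qed
  then show ?thesis using assms(1) by (cases w) (simp add: WN_def)
qed

text \<open>The universal property of the free associative algebra: a word goes to the ordered
  product of the values of its letters, which is multiplicative under concatenation and has the
  degree of the word; linear extension does the rest.\<close>

lemma eval_exists:
  assumes C: "comodule_algebra C" and c: "\<And>i. i < length ms \<Longrightarrow> c i \<in> homogeneous C (ms ! i)"
  obtains F where "F \<in> HA_hom T C" "\<And>i. i < length ms \<Longrightarrow> F (var i) = c i"
proof -
  note vC = comodule_algebra_vspace[OF C] and aC = comodule_algebra_alg[OF C]
  interpret C: vsp C by (intro vsp.intro vC)
  interpret RC: ring C by (rule comodule_algebra_ring[OF C])
  define ev where "ev w = foldr (\<lambda>i x. c i \<otimes>\<^bsub>C\<^esub> x) (letters w) \<one>\<^bsub>C\<^esub>" for w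
  have cc: "c i \<in> carrier C" if "i < length ms" for i using c[OF that] by (rule homogeneous_closed)
  have ev_zero: "ev 0 = \<one>\<^bsub>C\<^esub>" by (simp add: ev_def)
  have ev_Cons: "ev (Word [i] + w) = c i \<otimes>\<^bsub>C\<^esub> ev w" for i w by (simp add: ev_def)
  have ev_hom: "ev w \<in> homogeneous C (deg w)" if "w \<in> WN" for w
    using that
  proof (induction rule: word_induct)
    case zero
    show ?case using homogeneous_one[OF C] by (simp add: ev_zero deg_zero)
  next
    case (Cons i v)
    then show ?case using homogeneous_mult[OF C c Cons(3), of i] by (simp add: ev_Cons deg_add) (simp add: deg_def)
  qed
  have evc: "ev w \<in> carrier C" if "w \<in> WN" for w using ev_hom[OF that] by (rule homogeneous_closed)
  have ev_add: "ev (u + v) = ev u \<otimes>\<^bsub>C\<^esub> ev v" if "u \<in> WN" "v \<in> WN" for u v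
    using that(1)
  proof (induction rule: word_induct)
    case zero
    show ?case using evc[OF that(2)] by (simp add: ev_zero)
  next
    case (Cons i w)
    then show ?case using evc[OF that(2)] evc[OF Cons(2)] cc by (simp add: ev_Cons add.assoc RC.m_assoc)
  qed
  define F where "F = lext C ev"
  have Fl: "F \<in> linear_maps T C" unfolding F_def using evc by (intro lext_linear_T vC) auto
  have Fw: "F (wd w) = ev w" if "w \<in> WN" for w
    using evc[OF that] by (simp add: F_def wd_def C.lext_single)
  have "F \<in> HA_hom T C"
  proof (rule HA_homI[OF comodule_algebra_T C Fl _ _ WD_homogeneous WD_span])
    fix a b assume a: "a \<in> carrier T" and b: "b \<in> carrier T"
    have sub: "wd ` WN \<subseteq> carrier T" using wd_closed by auto
    have b1: "(\<lambda>a b. F (a \<otimes>\<^bsub>T\<^esub> b)) \<in> bilinear_maps T T C"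
      by (intro bilinear_maps_comp[OF alg_mult_bilinear] alg_T Fl)
    have b2: "(\<lambda>a b. F a \<otimes>\<^bsub>C\<^esub> F b) \<in> bilinear_maps T T C"
    proof (rule bilinear_mapsI)
      fix w assume "w \<in> carrier T"
      then show "(\<lambda>v. F v \<otimes>\<^bsub>C\<^esub> F w) \<in> linear_maps T C"
        using linear_maps_comp[OF Fl alg_mult_left_linear[OF aC linear_maps_closed[OF Fl]]] by simp
    next
      fix v assume "v \<in> carrier T"
      then show "(\<lambda>w. F v \<otimes>\<^bsub>C\<^esub> F w) \<in> linear_maps T C"
        using linear_maps_comp[OF Fl alg_mult_right_linear[OF aC linear_maps_closed[OF Fl]]] by simp
    qed
    show "F (a \<otimes>\<^bsub>T\<^esub> b) = F a \<otimes>\<^bsub>C\<^esub> F b"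
    proof (rule bilinear_maps_vspan_eqI[OF vspace_T vspace_T vC b1 b2 sub sub T_span[OF a] T_span[OF b]])
      fix x y assume "x \<in> wd ` WN" "y \<in> wd ` WN"
      then obtain u v where x: "x = wd u" "y = wd v" and uv: "u \<in> WN" "v \<in> WN" by auto
      have "F (x \<otimes>\<^bsub>T\<^esub> y) = F (wd (u + v))" by (simp add: x T_simps wd_add)
      also have "\<dots> = ev u \<otimes>\<^bsub>C\<^esub> ev v" using uv by (simp add: Fw WN_add ev_add)
      finally show "F (x \<otimes>\<^bsub>T\<^esub> y) = F x \<otimes>\<^bsub>C\<^esub> F y" using uv by (simp add: x Fw)
    qed
  next
    show "F \<one>\<^bsub>T\<^esub> = \<one>\<^bsub>C\<^esub>" using Fw[OF WN_zero] by (simp add: T_simps wd_zero ev_zero)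
    fix m v assume "v \<in> WD m"
    then show "F v \<in> homogeneous C m" using Fw ev_hom by (auto simp: WD_def)
  qed
  moreover have "F (var i) = c i" if "i < length ms" for i
    using Fw[of "Word [i]"] that cc[OF that] by (simp add: var_wd WN_def ev_def)
  ultimately show ?thesis by (rule that)
qed

lemma var_closed: "i < length ms \<Longrightarrow> var i \<in> carrier T"
  unfolding var_wd by (rule wd_closed) (simp add: WN_def)

lemma var_homogeneous: "i < length ms \<Longrightarrow> var i \<in> homogeneous T (ms ! i)"
  using wd_homogeneous[of "Word [i]"] by (simp add: var_wd WN_def deg_def)

lemma T_hom_ext:
  assumes C: "comodule_algebra C" and f: "f \<in> HA_hom T C" and g: "g \<in> HA_hom T C"
    and eq: "\<And>i. i < length ms \<Longrightarrow> f (var i) = g (var i)" and p: "p \<in> carrier T"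
  shows "f p = g p"
proof (rule linear_maps_vspan_eqI[OF vspace_T comodule_algebra_vspace[OF C] HA_homD(1)[OF f] HA_homD(1)[OF g] _ T_span[OF p]])
  show "wd ` WN \<subseteq> carrier T" using wd_closed by auto
  fix x assume "x \<in> wd ` WN"
  then obtain w where x: "x = wd w" and "w \<in> WN" by auto
  from this(2) have "f (wd w) = g (wd w)"
  proof (induction rule: word_induct)
    case zero
    show ?case using HA_homD(6)[OF f] HA_homD(6)[OF g] by (simp add: wd_zero T_simps)
  next
    case (Cons i v)
    have "f (var i \<otimes>\<^bsub>T\<^esub> wd v) = g (var i \<otimes>\<^bsub>T\<^esub> wd v)"
      unfolding HA_homD(5)[OF f var_closed[OF Cons(1)] wd_closed[OF Cons(2)]]
        HA_homD(5)[OF g var_closed[OF Cons(1)] wd_closed[OF Cons(2)]] eq[OF Cons(1)] Cons(3) ..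
    then show ?case by (simp add: wd_add var_wd T_simps)
  qed
  then show "f x = g x" by (simp add: x)
qed

end

section \<open>The free braided commutative algebra as a quotient of the free associative
  one\<close>

locale free_braided = cotri R for R :: "('k::field, 'n::finite) braiding" +
  fixes ms :: "(int ^ 'n) list"
begin

sublocale free_assoc ms "TYPE('k)" .

definition rel :: "nat \<Rightarrow> nat \<Rightarrow> 'k ncpoly" where
  "rel i j = var i * var j - pscale (r (ms ! j) (ms ! i)) (var j * var i)"

definition rels :: "'k ncpoly set" where
  "rels = {rel i j |i j. i < length ms \<and> j < length ms}"

lemma free_ideal_eq: "free_ideal R ms = Idl\<^bsub>T\<^esub> rels"
  by (simp add: free_ideal_def rels_def rel_def)

sublocale T: vsp T by (intro vsp.intro vspace_T)

text \<open>Passes from the operations on finitely supported functions, in which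
  \<open>free_ideal\<close> is written, to those of the record \<open>T\<close>, in which the lemmas
  on homogeneous elements and morphisms are stated.\<close>

lemma rel_eq:
  assumes "i < length ms" "j < length ms"
  shows "rel i j = var i \<otimes>\<^bsub>T\<^esub> var j \<ominus>\<^bsub>T\<^esub> r (ms ! j) (ms ! i) \<odot>\<^bsub>T\<^esub> (var j \<otimes>\<^bsub>T\<^esub> var i)"
proof -
  have c: "var i \<otimes>\<^bsub>T\<^esub> var j \<in> carrier T" "var j \<otimes>\<^bsub>T\<^esub> var i \<in> carrier T"
    using assms by (simp_all add: alg_mult_closed[OF alg_T] var_closed)
  have "var i \<otimes>\<^bsub>T\<^esub> var j \<ominus>\<^bsub>T\<^esub> r (ms ! j) (ms ! i) \<odot>\<^bsub>T\<^esub> (var j \<otimes>\<^bsub>T\<^esub> var i)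
      = var i \<otimes>\<^bsub>T\<^esub> var j \<oplus>\<^bsub>T\<^esub> (- 1) \<odot>\<^bsub>T\<^esub> (r (ms ! j) (ms ! i) \<odot>\<^bsub>T\<^esub> (var j \<otimes>\<^bsub>T\<^esub> var i))"
    using c by (intro T.minus_smult) auto
  then show ?thesis by (simp add: T_simps rel_def pscale_minus_one)
qed

text \<open>The two monomials of a relation have the same degree because addition of degrees is
  commutative.\<close>

lemma rel_homogeneous:
  assumes "i < length ms" "j < length ms"
  shows "rel i j \<in> homogeneous T (ms ! i + ms ! j)"
  unfolding rel_eq[OF assms]
  using homogeneous_mult[OF comodule_algebra_T var_homogeneous[OF assms(1)] var_homogeneous[OF assms(2)]]
    homogeneous_mult[OF comodule_algebra_T var_homogeneous[OF assms(2)] var_homogeneous[OF assms(1)]]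
  by (intro homogeneous_minus homogeneous_smult vspace_T coact_T_linear) (simp_all add: add.commute)

lemma rels_closed: "rels \<subseteq> carrier T"
  by (auto simp: rels_def intro: homogeneous_closed[OF rel_homogeneous])

lemma hom_ideal_free: "hom_ideal T (free_ideal R ms)"
  unfolding free_ideal_eq
  by (rule genideal_hom_ideal_homogeneous[OF comodule_algebra_T]) (auto simp: rels_def intro: rel_homogeneous)

sublocale Fq: quot T "free_ideal R ms"
  by (intro quot.intro comodule_algebra_T hom_ideal_free)

abbreviation F where "F \<equiv> free_HA R ms"

lemma F_eq: "F = Fq.Q" by (simp add: free_HA_def)

lemma gen_eq: "gen R ms i = Fq.proj (var i)" by (simp add: gen_def)

lemma gen_homogeneous: "i < length ms \<Longrightarrow> gen R ms i \<in> homogeneous F (ms ! i)"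
  by (simp add: gen_eq F_eq Fq.proj_homogeneous var_homogeneous)

lemma comodule_algebra_F: "comodule_algebra F"
  by (simp add: F_eq Fq.comodule_algebra_Q)

lemma gen_bcomm:
  assumes "i < length ms" "j < length ms"
  shows "bcomm F (gen R ms i) (ms ! i) (gen R ms j) (ms ! j)"
proof -
  note c = var_closed[OF assms(1)] var_closed[OF assms(2)]
  have c2: "var i \<otimes>\<^bsub>T\<^esub> var j \<in> carrier T" "var j \<otimes>\<^bsub>T\<^esub> var i \<in> carrier T"
    using c by (simp_all add: alg_mult_closed[OF alg_T])
  have "rel i j \<in> free_ideal R ms"
    using Fq.J.genideal_self[OF rels_closed] assms by (auto simp: free_ideal_eq rels_def)
  then have "Fq.proj (var i \<otimes>\<^bsub>T\<^esub> var j) = Fq.proj (r (ms ! j) (ms ! i) \<odot>\<^bsub>T\<^esub> (var j \<otimes>\<^bsub>T\<^esub> var i))"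
    using c2 by (simp add: Fq.proj_eq_iff rel_eq[OF assms])
  then show ?thesis
    using c c2 by (simp add: bcomm_def gen_eq F_eq Fq.Q_mult Fq.Q_smult)
qed

text \<open>Commutation spreads from generators to words in two inductions: a word against a single
  generator, then, after turning this around with \<open>bcomm_sym\<close>, a word against a word by
  induction on the first.\<close>

lemma wd_bcomm:
  assumes u: "u \<in> WN" and v: "v \<in> WN"
  shows "bcomm F (Fq.proj (wd u)) (deg u) (Fq.proj (wd v)) (deg v)"
proof -
  note aF = comodule_algebra_alg[OF comodule_algebra_F]
  have pc: "Fq.proj (wd w) \<in> carrier F" if "w \<in> WN" for w
    using that by (simp add: F_eq Fq.proj_closed wd_closed)
  have gc: "gen R ms i \<in> carrier F" if "i < length ms" for i
    using gen_homogeneous[OF that] by (rule homogeneous_closed)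
  have step: "Fq.proj (wd (Word [i] + w)) = gen R ms i \<otimes>\<^bsub>F\<^esub> Fq.proj (wd w)" if "i < length ms" "w \<in> WN" for i w
    using that var_closed wd_closed by (simp add: wd_add gen_eq F_eq Fq.Q_mult) (simp add: T_simps var_wd)
  have dg: "deg (Word [i] + w) = ms ! i + deg w" for i w by (simp add: deg_def)
  have one: "Fq.proj (wd 0) = \<one>\<^bsub>F\<^esub>" by (simp add: F_eq Fq.Q_one wd_zero T_simps)
  have gen_wd: "bcomm F (Fq.proj (wd w)) (deg w) (gen R ms i) (ms ! i)" if i: "i < length ms" and w: "w \<in> WN" for i w
    using w
  proof (induction rule: word_induct)
    case zero
    then show ?case using bcomm_one[OF aF gc[OF i]] by (simp add: one deg_zero)
  next
    case (Cons j w)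
    show ?case unfolding step[OF Cons(1,2)] dg
      by (rule bcomm_mult_left[OF aF gc[OF Cons(1)] pc[OF Cons(2)] gc[OF i] gen_bcomm[OF Cons(1) i] Cons(3)])
  qed
  from u show ?thesis
  proof (induction rule: word_induct)
    case zero
    then show ?case using bcomm_one[OF aF pc[OF v]] by (simp add: one deg_zero)
  next
    case (Cons j w)
    show ?case unfolding step[OF Cons(1,2)] dg
      by (rule bcomm_mult_left[OF aF gc[OF Cons(1)] pc[OF Cons(2)] pc[OF v]
            bcomm_sym[OF aF pc[OF v] gc[OF Cons(1)] gen_wd[OF Cons(1) v]] Cons(3)])
  qed
qed

lemma HA_obj_F: "HA_obj R F"
  unfolding F_eq
proof (rule Fq.HA_obj_Q_D[OF R_linear WD_span WD_homogeneous])
  fix a b m n assume "a \<in> WD m" "b \<in> WD n"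
  then obtain u v where ab: "a = wd u" "b = wd v" "u \<in> WN" "v \<in> WN" "deg u = m" "deg v = n"
    by (auto simp: WD_def)
  then show "Fq.proj a \<otimes>\<^bsub>Fq.Q\<^esub> Fq.proj b = r n m \<odot>\<^bsub>Fq.Q\<^esub> (Fq.proj b \<otimes>\<^bsub>Fq.Q\<^esub> Fq.proj a)"
    using wd_bcomm[OF ab(3,4)] by (simp add: bcomm_def F_eq)
qed

text \<open>Evaluation on the free associative algebra kills each relation, because the values
  \<open>c i\<close> are homogeneous elements of a braided commutative algebra and so satisfy the
  same exchange law.\<close>

lemma F_hom_exists:
  assumes C: "HA_obj R C" and c: "\<And>i. i < length ms \<Longrightarrow> c i \<in> homogeneous C (ms ! i)"
  obtains G where "G \<in> HA_hom F C" "\<And>i. i < length ms \<Longrightarrow> G (gen R ms i) = c i"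
proof -
  note cC = HA_obj_comodule_algebra[OF C]
  interpret C: vsp C by (intro vsp.intro comodule_algebra_vspace cC)
  obtain E where E: "E \<in> HA_hom T C" and Ev: "\<And>i. i < length ms \<Longrightarrow> E (var i) = c i"
    using eval_exists[OF cC c] by metis
  have "E x = \<zero>\<^bsub>C\<^esub>" if x: "x \<in> rels" for x
  proof -
    obtain i j where x: "x = rel i j" and ij: "i < length ms" "j < length ms" using x by (auto simp: rels_def)
    note v = var_closed[OF ij(1)] var_closed[OF ij(2)]
    have c2: "var i \<otimes>\<^bsub>T\<^esub> var j \<in> carrier T" "var j \<otimes>\<^bsub>T\<^esub> var i \<in> carrier T"
      using v by (simp_all add: alg_mult_closed[OF alg_T])
    have "E x = E (var i \<otimes>\<^bsub>T\<^esub> var j) \<ominus>\<^bsub>C\<^esub> r (ms ! j) (ms ! i) \<odot>\<^bsub>C\<^esub> E (var j \<otimes>\<^bsub>T\<^esub> var i)"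
      unfolding x rel_eq[OF ij]
      using c2 by (simp add: linear_maps_minus[OF vspace_T comodule_algebra_vspace[OF cC] HA_homD(1)[OF E]]
          linear_maps_smult[OF HA_homD(1)[OF E]])
    also have "\<dots> = c i \<otimes>\<^bsub>C\<^esub> c j \<ominus>\<^bsub>C\<^esub> r (ms ! j) (ms ! i) \<odot>\<^bsub>C\<^esub> (c j \<otimes>\<^bsub>C\<^esub> c i)"
      using v ij by (simp add: HA_homD(5)[OF E] Ev)
    also have "\<dots> = \<zero>\<^bsub>C\<^esub>"
    proof -
      have "c i \<otimes>\<^bsub>C\<^esub> c j \<in> carrier C"
        using homogeneous_closed[OF c[OF ij(1)]] homogeneous_closed[OF c[OF ij(2)]]
        by (rule alg_mult_closed[OF comodule_algebra_alg[OF cC]])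
      then show ?thesis
        unfolding HA_obj_comm[OF R_linear C c[OF ij(1)] c[OF ij(2)], symmetric]
        by (simp add: a_minus_def C.r_neg)
    qed
    finally show ?thesis .
  qed
  then have "\<And>j. j \<in> free_ideal R ms \<Longrightarrow> E j = \<zero>\<^bsub>C\<^esub>"
    unfolding free_ideal_eq by (rule HA_hom_kills_genideal[OF comodule_algebra_T cC E rels_closed])
  from Fq.lift[OF cC E this] obtain G where "G \<in> HA_hom F C" "\<And>p. p \<in> carrier T \<Longrightarrow> G (Fq.proj p) = E p"
    unfolding F_eq by metis
  then show ?thesis using Ev var_closed by (intro that[of G]) (auto simp: gen_eq)
qed

lemma F_hom_ext:
  assumes C: "comodule_algebra C" and f: "f \<in> HA_hom F C" and g: "g \<in> HA_hom F C"
    and eq: "\<And>i. i < length ms \<Longrightarrow> f (gen R ms i) = g (gen R ms i)" and x: "x \<in> carrier F"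
  shows "f x = g x"
proof -
  obtain p where p: "p \<in> carrier T" "x = Fq.proj p" using x unfolding F_eq by (rule Fq.Q_carrierE)
  have "(\<lambda>p. f (Fq.proj p)) p = (\<lambda>p. g (Fq.proj p)) p"
  proof (rule T_hom_ext[OF C _ _ _ p(1)])
    show "(\<lambda>p. f (Fq.proj p)) \<in> HA_hom T C"
      by (rule HA_hom_comp[OF comodule_algebra_T comodule_algebra_F C _ f]) (simp add: F_eq Fq.proj_HA_hom)
    show "(\<lambda>p. g (Fq.proj p)) \<in> HA_hom T C"
      by (rule HA_hom_comp[OF comodule_algebra_T comodule_algebra_F C _ g]) (simp add: F_eq Fq.proj_HA_hom)
  qed (use eq in \<open>simp add: gen_eq\<close>)
  then show ?thesis by (simp add: p)
qed

end

subsection \<open>Coproducts\<close>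

locale coprod = cotri R for R :: "('k::field, 'n::finite) braiding" +
  fixes A :: "('k, 'n, 'a) halg" and B :: "('k, 'n, 'b) halg"
  assumes HA: "HA_obj R A" and HB: "HA_obj R B"
begin

lemmas cA = HA_obj_comodule_algebra[OF HA] and cB = HA_obj_comodule_algebra[OF HB]
lemmas aA = comodule_algebra_alg[OF cA] and aB = comodule_algebra_alg[OF cB]
lemmas vA = comodule_algebra_vspace[OF cA] and vB = comodule_algebra_vspace[OF cB]
lemmas coA = comodule_algebra_coact[OF cA] and coB = comodule_algebra_coact[OF cB]
lemmas rA = comodule_algebra_ring[OF cA] and rB = comodule_algebra_ring[OF cB]

sublocale A: vsp A by (intro vsp.intro vA)
sublocale B: vsp B by (intro vsp.intro vB)
sublocale RA: ring A by (rule rA)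
sublocale RB: ring B by (rule rB)

abbreviation TT where "TT \<equiv> tensor A B"
abbreviation C where "C \<equiv> coproduct R A B"
abbreviation pt where "pt \<equiv> pure_tensor A B"

lemma vTT: "vspace TT" by (intro vspace_tensor vA vB)

sublocale TT: vsp TT by (intro vsp.intro vTT)

lemma C_simps:
  "carrier C = carrier TT" "add C = add TT" "ring.zero C = ring.zero TT"
  "module.smult C = module.smult TT" "monoid.mult C = coproduct_mult R A B"
  "one C = pt \<one>\<^bsub>A\<^esub> \<one>\<^bsub>B\<^esub>" "coact C = coproduct_coact A B"
  by (simp_all add: coproduct_def module.defs halg.defs tensor_def)

lemma same_TT: "same_vs TT C" by (simp add: same_vs_def C_simps)

lemma vC: "vspace C" using same_TT vTT by (rule same_vs_vspace)

sublocale CC: vsp C by (intro vsp.intro vC)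

lemma linear_C: "linear_maps C V = linear_maps TT V" "linear_maps V C = linear_maps V TT"
  using same_vs_linear_maps[OF same_TT same_vs_refl] same_vs_linear_maps[OF same_vs_refl same_TT] by auto

lemma tensor_C: "tensor torus C = tensor torus TT" "pure_tensor torus C = pure_tensor torus TT"
  by (rule same_vs_tensor[OF same_vs_refl same_TT, symmetric],
      rule same_vs_pure_tensor[OF same_vs_refl same_TT, symmetric])

text \<open>The innermost summand of \<open>coproduct_mult\<close>, a summation kernel and not a
  null space. Cutting the four nested sums into \<open>ker\<close> and \<open>M\<close> lets the
  lemmas on double sums be applied twice.\<close>

definition ker :: "'a \<Rightarrow> 'b \<Rightarrow> ('k, 'n) torus \<Rightarrow> 'a \<Rightarrow> ('k, 'n) torus \<Rightarrow> 'b \<Rightarrow> ('k, 'a, 'b) tensor" where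
  "ker a b' h a0' g b0 = R (HH h g) \<odot>\<^bsub>TT\<^esub> pt (a \<otimes>\<^bsub>A\<^esub> a0') (b0 \<otimes>\<^bsub>B\<^esub> b')"

lemma ptc: "a \<in> carrier A \<Longrightarrow> b \<in> carrier B \<Longrightarrow> pt a b \<in> carrier TT"
  by (rule pure_tensor_closed[OF vA vB])

lemma ker_quadlin: "a \<in> carrier A \<Longrightarrow> b' \<in> carrier B \<Longrightarrow> ker a b' \<in> quadlin torus A torus B TT"
  unfolding ker_def[abs_def]
  by (intro quadlinI linear_maps_smult_left linear_maps_smult_right vTT vA vB vspace_torus R_lin
      linear_maps_pure_left linear_maps_pure_right alg_mult_right_linear alg_mult_left_linear
      aA aB alg_mult_closed ptc)

lemma ker_linear_a:
  "b' \<in> carrier B \<Longrightarrow> a0' \<in> carrier A \<Longrightarrow> b0 \<in> carrier B \<Longrightarrow> (\<lambda>a. ker a b' h a0' g b0) \<in> linear_maps A TT"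
  unfolding ker_def
  by (intro linear_maps_smult_left vTT vA vB linear_maps_pure_left alg_mult_left_linear aA aB alg_mult_closed)

lemma ker_linear_b':
  "a \<in> carrier A \<Longrightarrow> a0' \<in> carrier A \<Longrightarrow> b0 \<in> carrier B \<Longrightarrow> (\<lambda>b'. ker a b' h a0' g b0) \<in> linear_maps B TT"
  unfolding ker_def
  by (intro linear_maps_smult_left vTT vA vB linear_maps_pure_right alg_mult_right_linear aA aB alg_mult_closed)

definition M :: "'a \<Rightarrow> 'b \<Rightarrow> 'a \<Rightarrow> 'b \<Rightarrow> ('k, 'a, 'b) tensor" where
  "M a b a' b' = sweedler TT (coact A a') (\<lambda>h a0'. sweedler TT (coact B b) (ker a b' h a0'))"

lemma M_quadlin: "M \<in> quadlin A B A B TT"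
  unfolding M_def[abs_def]
proof (rule quadlinI)
  fix b a' b' assume c: "b \<in> carrier B" "a' \<in> carrier A" "b' \<in> carrier B"
  show "(\<lambda>a. sweedler TT (coact A a') (\<lambda>h a0'. sweedler TT (coact B b) (ker a b' h a0'))) \<in> linear_maps A TT"
    by (rule dbl_linear_fun[OF vspace_torus vA vspace_torus vB vTT vA, where K = "\<lambda>a. ker a b'"])
      (rule ker_quadlin[OF _ c(3)] ker_linear_a[OF c(3)] linear_maps_closed[OF coA c(2)]
        linear_maps_closed[OF coB c(1)]; assumption)+
next
  fix a a' b' assume c: "a \<in> carrier A" "a' \<in> carrier A" "b' \<in> carrier B"
  show "(\<lambda>b. sweedler TT (coact A a') (\<lambda>h a0'. sweedler TT (coact B b) (ker a b' h a0'))) \<in> linear_maps B TT"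
    by (rule linear_maps_comp[OF coB bilinear_maps_right[OF dbl_bilinear[OF vspace_torus vA vspace_torus vB vTT
          ker_quadlin[OF c(1,3)]] linear_maps_closed[OF coA c(2)]]])
next
  fix a b b' assume c: "a \<in> carrier A" "b \<in> carrier B" "b' \<in> carrier B"
  show "(\<lambda>a'. sweedler TT (coact A a') (\<lambda>h a0'. sweedler TT (coact B b) (ker a b' h a0'))) \<in> linear_maps A TT"
    by (rule linear_maps_comp[OF coA bilinear_maps_left[OF dbl_bilinear[OF vspace_torus vA vspace_torus vB vTT
          ker_quadlin[OF c(1,3)]] linear_maps_closed[OF coB c(2)]]])
next
  fix a b a' assume c: "a \<in> carrier A" "b \<in> carrier B" "a' \<in> carrier A"
  show "(\<lambda>b'. sweedler TT (coact A a') (\<lambda>h a0'. sweedler TT (coact B b) (ker a b' h a0'))) \<in> linear_maps B TT"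
    by (rule dbl_linear_fun[OF vspace_torus vA vspace_torus vB vTT vB, where K = "\<lambda>b'. ker a b'"])
      (rule ker_quadlin[OF c(1)] ker_linear_b'[OF c(1)] linear_maps_closed[OF coA c(3)]
        linear_maps_closed[OF coB c(2)]; assumption)+
qed

lemma C_mult: "S \<otimes>\<^bsub>C\<^esub> S' = sweedler TT S (\<lambda>a b. sweedler TT S' (M a b))"
  by (simp add: C_simps coproduct_mult_def M_def[abs_def] ker_def[abs_def] Let_def)

lemma C_mult_bilinear: "(\<lambda>S S'. S \<otimes>\<^bsub>C\<^esub> S') \<in> bilinear_maps TT TT TT"
  unfolding C_mult by (rule dbl_bilinear[OF vA vB vA vB vTT M_quadlin])

lemmas C_mult_left = bilinear_maps_left[OF C_mult_bilinear]
lemmas C_mult_right = bilinear_maps_right[OF C_mult_bilinear]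

lemma C_mult_closed: "S \<in> carrier TT \<Longrightarrow> S' \<in> carrier TT \<Longrightarrow> S \<otimes>\<^bsub>C\<^esub> S' \<in> carrier TT"
  by (rule bilinear_maps_closed[OF C_mult_bilinear])

text \<open>Only the two middle factors change places, so only \<open>b\<close> and
  \<open>a'\<close> need a degree.\<close>

lemma mult_pure:
  assumes a: "a \<in> carrier A" and b: "b \<in> homogeneous B n" and a': "a' \<in> homogeneous A m" and b': "b' \<in> carrier B"
  shows "pt a b \<otimes>\<^bsub>C\<^esub> pt a' b' = r m n \<odot>\<^bsub>TT\<^esub> pt (a \<otimes>\<^bsub>A\<^esub> a') (b \<otimes>\<^bsub>B\<^esub> b')"
proof -
  note c = homogeneous_closed[OF b] homogeneous_closed[OF a']
  have "pt a b \<otimes>\<^bsub>C\<^esub> pt a' b' = M a b a' b'"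
    unfolding C_mult by (rule dbl_pure[OF vA vB vA vB vTT M_quadlin a c b'])
  also have "\<dots> = sweedler TT (pure_tensor torus A (tbasis m) a') (\<lambda>h a0'.
      sweedler TT (pure_tensor torus B (tbasis n) b) (ker a b' h a0'))"
    using b a' by (simp add: M_def homogeneous_def)
  also have "\<dots> = ker a b' (tbasis m) a' (tbasis n) b"
    by (rule dbl_pure[OF vspace_torus vA vspace_torus vB vTT ker_quadlin[OF a b']]) (simp_all add: c)
  finally show ?thesis by (simp add: ker_def)
qed

lemma spanA: "a \<in> carrier A \<Longrightarrow> a \<in> vspan A (\<Union>m. homogeneous A m)"
  by (rule comodule_vspan[OF comodule_algebra_comodule[OF cA]])

lemma spanB: "b \<in> carrier B \<Longrightarrow> b \<in> vspan B (\<Union>m. homogeneous B m)"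
  by (rule comodule_vspan[OF comodule_algebra_comodule[OF cB]])

lemmas pt_left = bilinear_maps_left[OF pure_tensor_bilinear[OF vA vB]]
lemmas pt_right = bilinear_maps_right[OF pure_tensor_bilinear[OF vA vB]]

text \<open>A coinvariant \<open>b\<close> passes a homogeneous \<open>a'\<close> with factor
  \<open>r m 0 = 1\<close>; as the factor no longer depends on \<open>m\<close>, linearity removes
  the homogeneity of \<open>a'\<close>. The main case is \<open>b = 1\<close>.\<close>

lemma mult_pure_0_left:
  assumes a: "a \<in> carrier A" and b: "b \<in> homogeneous B 0" and a': "a' \<in> carrier A" and b': "b' \<in> carrier B"
  shows "pt a b \<otimes>\<^bsub>C\<^esub> pt a' b' = pt (a \<otimes>\<^bsub>A\<^esub> a') (b \<otimes>\<^bsub>B\<^esub> b')"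
proof -
  note c = homogeneous_closed[OF b]
  have l: "(\<lambda>a'. pt a b \<otimes>\<^bsub>C\<^esub> pt a' b') \<in> linear_maps A TT"
    by (rule linear_maps_comp[OF pt_left[OF b'] C_mult_right[OF ptc[OF a c]]])
  have l2: "(\<lambda>a'. pt (a \<otimes>\<^bsub>A\<^esub> a') (b \<otimes>\<^bsub>B\<^esub> b')) \<in> linear_maps A TT"
    by (rule linear_maps_comp[OF alg_mult_right_linear[OF aA a] pt_left[OF alg_mult_closed[OF aB c b']]])
  show ?thesis
  proof (rule linear_maps_vspan_eqI[OF vA vTT l l2 homogeneous_subset spanA[OF a']])
    fix x assume "x \<in> (\<Union>m. homogeneous A m)"
    then obtain m where x: "x \<in> homogeneous A m" by auto
    have "pt (a \<otimes>\<^bsub>A\<^esub> x) (b \<otimes>\<^bsub>B\<^esub> b') \<in> carrier TT"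
      by (rule ptc[OF alg_mult_closed[OF aA a homogeneous_closed[OF x]] alg_mult_closed[OF aB c b']])
    then show "pt a b \<otimes>\<^bsub>C\<^esub> pt x b' = pt (a \<otimes>\<^bsub>A\<^esub> x) (b \<otimes>\<^bsub>B\<^esub> b')"
      by (simp add: mult_pure[OF a b x b'])
  qed
qed

lemma mult_pure_0_right:
  assumes a: "a \<in> carrier A" and b: "b \<in> carrier B" and a': "a' \<in> homogeneous A 0" and b': "b' \<in> carrier B"
  shows "pt a b \<otimes>\<^bsub>C\<^esub> pt a' b' = pt (a \<otimes>\<^bsub>A\<^esub> a') (b \<otimes>\<^bsub>B\<^esub> b')"
proof -
  note c = homogeneous_closed[OF a']
  have l: "(\<lambda>b. pt a b \<otimes>\<^bsub>C\<^esub> pt a' b') \<in> linear_maps B TT"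
    by (rule linear_maps_comp[OF pt_right[OF a] C_mult_left[OF ptc[OF c b']]])
  have l2: "(\<lambda>b. pt (a \<otimes>\<^bsub>A\<^esub> a') (b \<otimes>\<^bsub>B\<^esub> b')) \<in> linear_maps B TT"
    by (rule linear_maps_comp[OF alg_mult_left_linear[OF aB b'] pt_right[OF alg_mult_closed[OF aA a c]]])
  show ?thesis
  proof (rule linear_maps_vspan_eqI[OF vB vTT l l2 homogeneous_subset spanB[OF b]])
    fix x assume "x \<in> (\<Union>m. homogeneous B m)"
    then obtain n where x: "x \<in> homogeneous B n" by auto
    have "pt (a \<otimes>\<^bsub>A\<^esub> a') (x \<otimes>\<^bsub>B\<^esub> b') \<in> carrier TT"
      by (rule ptc[OF alg_mult_closed[OF aA a c] alg_mult_closed[OF aB homogeneous_closed[OF x] b']])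
    then show "pt a x \<otimes>\<^bsub>C\<^esub> pt a' b' = pt (a \<otimes>\<^bsub>A\<^esub> a') (x \<otimes>\<^bsub>B\<^esub> b')"
      by (simp add: mult_pure[OF a x a' b'])
  qed
qed

definition PD :: "int ^ 'n \<Rightarrow> ('k, 'a, 'b) tensor set" where
  "PD k = {pt a b |a b m n. a \<in> homogeneous A m \<and> b \<in> homogeneous B n \<and> m + n = k}"

lemma PD_closed: "(\<Union>k. PD k) \<subseteq> carrier TT"
  by (auto simp: PD_def intro!: ptc dest: homogeneous_closed)

lemma PD_I: "a \<in> homogeneous A m \<Longrightarrow> b \<in> homogeneous B n \<Longrightarrow> pt a b \<in> PD (m + n)"
  by (auto simp: PD_def)

lemma PD_E:
  assumes "x \<in> (\<Union>k. PD k)"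
  obtains a b m n where "x = pt a b" "a \<in> homogeneous A m" "b \<in> homogeneous B n"
  using assms by (auto simp: PD_def)

text \<open>Decompose one factor at a time, using linearity of the pure tensor in each.\<close>

lemma pt_span:
  assumes a: "a \<in> carrier A" and b: "b \<in> carrier B"
  shows "pt a b \<in> vspan TT (\<Union>k. PD k)"
proof -
  have *: "pt x b \<in> vspan TT (\<Union>k. PD k)" if x: "x \<in> homogeneous A m" for x m
  proof -
    have "pt x b \<in> vspan TT (pt x ` (\<Union>m. homogeneous B m))"
      by (rule vspan_linear_image[OF vB vTT pt_right[OF homogeneous_closed[OF x]] homogeneous_subset spanB[OF b]])
    then show ?thesis
    proof (rule vspan_mono)
      show "pt x ` (\<Union>m. homogeneous B m) \<subseteq> vspan TT (\<Union>k. PD k)"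
        using PD_I[OF x] by (auto intro!: vspan.base)
    qed
  qed
  have "(\<lambda>x. pt x b) a \<in> vspan TT ((\<lambda>x. pt x b) ` (\<Union>m. homogeneous A m))"
    by (rule vspan_linear_image[OF vA vTT pt_left[OF b] homogeneous_subset spanA[OF a]])
  then show ?thesis
  proof (rule vspan_mono)
    show "(\<lambda>x. pt x b) ` (\<Union>m. homogeneous A m) \<subseteq> vspan TT (\<Union>k. PD k)"
      using * by auto
  qed
qed

lemma TT_span: "S \<in> carrier TT \<Longrightarrow> S \<in> vspan TT (\<Union>k. PD k)"
proof -
  interpret t: tens A B by (intro tens.intro vsp.intro vA vB)
  assume "S \<in> carrier TT"
  then show ?thesis
    by (induction rule: t.tensor_induct) (rule pt_span vspan.add, assumption+)+
qed

lemma vspan_C: "vspan C G = vspan TT G"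
proof -
  have "x \<in> vspan C G" if "x \<in> vspan TT G" for x
    using that
  proof (induction rule: vspan.induct)
    case zero show ?case using vspan.zero[of C G] by (simp add: C_simps)
  next
    case (base x) then show ?case by (rule vspan.base)
  next
    case (add x y) then show ?case using vspan.add[of x C G y] by (simp add: C_simps)
  next
    case (smult x c) then show ?case using vspan.smult[of x C G c] by (simp add: C_simps)
  qed
  moreover have "x \<in> vspan TT G" if "x \<in> vspan C G" for x
    using that
  proof (induction rule: vspan.induct)
    case zero show ?case using vspan.zero[of TT G] by (simp add: C_simps)
  next
    case (base x) then show ?case by (rule vspan.base)
  next
    case (add x y) then show ?case using vspan.add[of x TT G y] by (simp add: C_simps)
  next
    case (smult x c) then show ?case using vspan.smult[of x TT G c] by (simp add: C_simps)
  qed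
  ultimately show ?thesis by blast
qed

lemma mult_pt_homogeneous:
  assumes "a \<in> homogeneous A k" "b \<in> homogeneous B n" "a' \<in> homogeneous A m" "b' \<in> homogeneous B l"
  shows "pt a b \<otimes>\<^bsub>C\<^esub> pt a' b' = r m n \<odot>\<^bsub>TT\<^esub> pt (a \<otimes>\<^bsub>A\<^esub> a') (b \<otimes>\<^bsub>B\<^esub> b')"
  by (rule mult_pure[OF homogeneous_closed[OF assms(1)] assms(2,3) homogeneous_closed[OF assms(4)]])

text \<open>Either bracketing collects \<open>r m' n\<close>, \<open>r m'' n\<close> and
  \<open>r m'' n'\<close>, one factor for each element of \<open>B\<close> standing to the left of
  an element of \<open>A\<close>; the bicharacter laws make the two groupings agree.\<close>

lemma C_assoc_PD:
  assumes "x \<in> (\<Union>k. PD k)" "y \<in> (\<Union>k. PD k)" "z \<in> (\<Union>k. PD k)"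
  shows "x \<otimes>\<^bsub>C\<^esub> y \<otimes>\<^bsub>C\<^esub> z = x \<otimes>\<^bsub>C\<^esub> (y \<otimes>\<^bsub>C\<^esub> z)"
proof -
  obtain a b k n where x: "x = pt a b" "a \<in> homogeneous A k" "b \<in> homogeneous B n" using assms(1) by (rule PD_E)
  obtain a' b' m' n' where y: "y = pt a' b'" "a' \<in> homogeneous A m'" "b' \<in> homogeneous B n'" using assms(2) by (rule PD_E)
  obtain a'' b'' m'' n'' where z: "z = pt a'' b''" "a'' \<in> homogeneous A m''" "b'' \<in> homogeneous B n''" using assms(3) by (rule PD_E)
  note xc = homogeneous_closed[OF x(2)] homogeneous_closed[OF x(3)]
    and yc = homogeneous_closed[OF y(2)] homogeneous_closed[OF y(3)]
    and zc = homogeneous_closed[OF z(2)] homogeneous_closed[OF z(3)]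
  let ?a = "a \<otimes>\<^bsub>A\<^esub> a' \<otimes>\<^bsub>A\<^esub> a''" and ?b = "b \<otimes>\<^bsub>B\<^esub> b' \<otimes>\<^bsub>B\<^esub> b''"
  have ab: "pt ?a ?b \<in> carrier TT" using xc yc zc by (intro ptc) auto
  have zT: "z \<in> carrier TT" and xT: "x \<in> carrier TT" unfolding x(1) z(1) by (rule ptc xc zc)+
  have xy: "pt (a \<otimes>\<^bsub>A\<^esub> a') (b \<otimes>\<^bsub>B\<^esub> b') \<in> carrier TT" and yz: "pt (a' \<otimes>\<^bsub>A\<^esub> a'') (b' \<otimes>\<^bsub>B\<^esub> b'') \<in> carrier TT"
    using xc yc zc by (auto intro!: ptc)
  have "x \<otimes>\<^bsub>C\<^esub> y \<otimes>\<^bsub>C\<^esub> z = r m' n \<odot>\<^bsub>TT\<^esub> (pt (a \<otimes>\<^bsub>A\<^esub> a') (b \<otimes>\<^bsub>B\<^esub> b') \<otimes>\<^bsub>C\<^esub> z)"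
    unfolding x(1) y(1) mult_pt_homogeneous[OF x(2,3) y(2,3)]
    by (rule linear_maps_smult[OF C_mult_left[OF zT] xy])
  also have "\<dots> = r m' n \<odot>\<^bsub>TT\<^esub> (r m'' (n + n') \<odot>\<^bsub>TT\<^esub> pt ?a ?b)"
    unfolding z(1) mult_pt_homogeneous[OF homogeneous_mult[OF cA x(2) y(2)] homogeneous_mult[OF cB x(3) y(3)] z(2,3)] ..
  also have "\<dots> = r m'' n' \<odot>\<^bsub>TT\<^esub> (r (m' + m'') n \<odot>\<^bsub>TT\<^esub> pt ?a ?b)"
    using ab by (simp add: TT.smult_mult[symmetric] r_add_left r_add_right mult.commute mult.left_commute)
  also have "\<dots> = r m'' n' \<odot>\<^bsub>TT\<^esub> (x \<otimes>\<^bsub>C\<^esub> pt (a' \<otimes>\<^bsub>A\<^esub> a'') (b' \<otimes>\<^bsub>B\<^esub> b''))"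
    unfolding x(1) mult_pt_homogeneous[OF x(2,3) homogeneous_mult[OF cA y(2) z(2)] homogeneous_mult[OF cB y(3) z(3)]]
    using xc yc zc by (simp add: RA.m_assoc RB.m_assoc)
  also have "\<dots> = x \<otimes>\<^bsub>C\<^esub> (y \<otimes>\<^bsub>C\<^esub> z)"
    unfolding y(1) z(1) mult_pt_homogeneous[OF y(2,3) z(2,3)]
    by (rule linear_maps_smult[OF C_mult_right[OF xT] yz, symmetric])
  finally show ?thesis .
qed

lemma C_assoc:
  assumes x: "x \<in> carrier TT" and y: "y \<in> carrier TT" and z: "z \<in> carrier TT"
  shows "x \<otimes>\<^bsub>C\<^esub> y \<otimes>\<^bsub>C\<^esub> z = x \<otimes>\<^bsub>C\<^esub> (y \<otimes>\<^bsub>C\<^esub> z)"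
proof (rule linear_maps_vspan_eqI[OF vTT vTT _ _ PD_closed TT_span[OF x]])
  show "(\<lambda>x. x \<otimes>\<^bsub>C\<^esub> y \<otimes>\<^bsub>C\<^esub> z) \<in> linear_maps TT TT"
    by (rule linear_maps_comp[OF C_mult_left[OF y] C_mult_left[OF z]])
  show "(\<lambda>x. x \<otimes>\<^bsub>C\<^esub> (y \<otimes>\<^bsub>C\<^esub> z)) \<in> linear_maps TT TT"
    by (rule C_mult_left[OF C_mult_closed[OF y z]])
  fix x assume xP: "x \<in> (\<Union>k. PD k)"
  then have x: "x \<in> carrier TT" using PD_closed by blast
  show "x \<otimes>\<^bsub>C\<^esub> y \<otimes>\<^bsub>C\<^esub> z = x \<otimes>\<^bsub>C\<^esub> (y \<otimes>\<^bsub>C\<^esub> z)"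
  proof (rule linear_maps_vspan_eqI[OF vTT vTT _ _ PD_closed TT_span[OF y]])
    show "(\<lambda>y. x \<otimes>\<^bsub>C\<^esub> y \<otimes>\<^bsub>C\<^esub> z) \<in> linear_maps TT TT"
      by (rule linear_maps_comp[OF C_mult_right[OF x] C_mult_left[OF z]])
    show "(\<lambda>y. x \<otimes>\<^bsub>C\<^esub> (y \<otimes>\<^bsub>C\<^esub> z)) \<in> linear_maps TT TT"
      by (rule linear_maps_comp[OF C_mult_left[OF z] C_mult_right[OF x]])
    fix y assume yP: "y \<in> (\<Union>k. PD k)"
    then have y: "y \<in> carrier TT" using PD_closed by blast
    show "x \<otimes>\<^bsub>C\<^esub> y \<otimes>\<^bsub>C\<^esub> z = x \<otimes>\<^bsub>C\<^esub> (y \<otimes>\<^bsub>C\<^esub> z)"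
    proof (rule linear_maps_vspan_eqI[OF vTT vTT _ _ PD_closed TT_span[OF z]])
      show "(\<lambda>z. x \<otimes>\<^bsub>C\<^esub> y \<otimes>\<^bsub>C\<^esub> z) \<in> linear_maps TT TT"
        by (rule C_mult_right[OF C_mult_closed[OF x y]])
      show "(\<lambda>z. x \<otimes>\<^bsub>C\<^esub> (y \<otimes>\<^bsub>C\<^esub> z)) \<in> linear_maps TT TT"
        by (rule linear_maps_comp[OF C_mult_right[OF y] C_mult_right[OF x]])
      fix z assume zP: "z \<in> (\<Union>k. PD k)"
      show "x \<otimes>\<^bsub>C\<^esub> y \<otimes>\<^bsub>C\<^esub> z = x \<otimes>\<^bsub>C\<^esub> (y \<otimes>\<^bsub>C\<^esub> z)"
        by (rule C_assoc_PD[OF xP yP zP])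
    qed
  qed
qed

lemma oneA: "\<one>\<^bsub>A\<^esub> \<in> homogeneous A 0" and oneB: "\<one>\<^bsub>B\<^esub> \<in> homogeneous B 0"
  by (rule homogeneous_one[OF cA], rule homogeneous_one[OF cB])

lemma one_closed: "\<one>\<^bsub>C\<^esub> \<in> carrier TT"
  by (simp add: C_simps ptc)

lemma C_one_left:
  assumes "x \<in> carrier TT" shows "\<one>\<^bsub>C\<^esub> \<otimes>\<^bsub>C\<^esub> x = x"
proof (rule linear_maps_tensor_eqI[OF vA vB assms C_mult_right[OF one_closed] linear_maps_id])
  fix a b assume ab: "a \<in> carrier A" "b \<in> carrier B"
  show "\<one>\<^bsub>C\<^esub> \<otimes>\<^bsub>C\<^esub> pt a b = pt a b"
    unfolding C_simps(6) mult_pure_0_left[OF RA.one_closed oneB ab] using ab by simp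
qed

lemma C_one_right:
  assumes "x \<in> carrier TT" shows "x \<otimes>\<^bsub>C\<^esub> \<one>\<^bsub>C\<^esub> = x"
proof (rule linear_maps_tensor_eqI[OF vA vB assms C_mult_left[OF one_closed] linear_maps_id])
  fix a b assume ab: "a \<in> carrier A" "b \<in> carrier B"
  show "pt a b \<otimes>\<^bsub>C\<^esub> \<one>\<^bsub>C\<^esub> = pt a b"
    unfolding C_simps(6) mult_pure_0_right[OF ab oneA RB.one_closed] using ab by simp
qed

lemma ring_C: "ring C"
proof (rule ringI)
  show "abelian_group C" by (rule CC.abelian_group_axioms)
  show "Group.monoid C"
  proof (rule monoidI)
    fix x y z assume "x \<in> carrier C" "y \<in> carrier C" "z \<in> carrier C"
    then show "x \<otimes>\<^bsub>C\<^esub> y \<otimes>\<^bsub>C\<^esub> z = x \<otimes>\<^bsub>C\<^esub> (y \<otimes>\<^bsub>C\<^esub> z)"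
      unfolding C_simps(1) by (rule C_assoc)
  next
    fix x y assume "x \<in> carrier C" "y \<in> carrier C"
    then show "x \<otimes>\<^bsub>C\<^esub> y \<in> carrier C" unfolding C_simps(1) by (rule C_mult_closed)
  next
    fix x assume "x \<in> carrier C"
    then show "\<one>\<^bsub>C\<^esub> \<otimes>\<^bsub>C\<^esub> x = x" "x \<otimes>\<^bsub>C\<^esub> \<one>\<^bsub>C\<^esub> = x"
      unfolding C_simps(1) by (rule C_one_left, rule C_one_right)
  qed (use one_closed in \<open>simp only: C_simps(1)\<close>)
next
  fix x y z assume "x \<in> carrier C" "y \<in> carrier C" "z \<in> carrier C"
  then have c: "x \<in> carrier TT" "y \<in> carrier TT" "z \<in> carrier TT" by (simp_all only: C_simps(1))
  show "(x \<oplus>\<^bsub>C\<^esub> y) \<otimes>\<^bsub>C\<^esub> z = x \<otimes>\<^bsub>C\<^esub> z \<oplus>\<^bsub>C\<^esub> y \<otimes>\<^bsub>C\<^esub> z"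
    unfolding C_simps(2) by (rule linear_maps_add[OF C_mult_left[OF c(3)] c(1,2)])
  show "z \<otimes>\<^bsub>C\<^esub> (x \<oplus>\<^bsub>C\<^esub> y) = z \<otimes>\<^bsub>C\<^esub> x \<oplus>\<^bsub>C\<^esub> z \<otimes>\<^bsub>C\<^esub> y"
    unfolding C_simps(2) by (rule linear_maps_add[OF C_mult_right[OF c(3)] c(1,2)])
qed

lemma alg_C: "alg C"
proof (rule algI[OF vC ring_C])
  fix c x y assume "x \<in> carrier C" "y \<in> carrier C"
  then have c: "x \<in> carrier TT" "y \<in> carrier TT" by (simp_all only: C_simps(1))
  show "(c \<odot>\<^bsub>C\<^esub> x) \<otimes>\<^bsub>C\<^esub> y = c \<odot>\<^bsub>C\<^esub> (x \<otimes>\<^bsub>C\<^esub> y)"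
    unfolding C_simps(4) by (rule linear_maps_smult[OF C_mult_left[OF c(2)] c(1)])
  show "x \<otimes>\<^bsub>C\<^esub> (c \<odot>\<^bsub>C\<^esub> y) = c \<odot>\<^bsub>C\<^esub> (x \<otimes>\<^bsub>C\<^esub> y)"
    unfolding C_simps(4) by (rule linear_maps_smult[OF C_mult_right[OF c(1)] c(2)])
qed

section \<open>The coaction on the coproduct and its braided commutativity\<close>

definition cker :: "('k, 'n) torus \<Rightarrow> 'a \<Rightarrow> ('k, 'n) torus \<Rightarrow> 'b \<Rightarrow> _" where
  "cker h a0 g b0 = pure_tensor torus TT (h * g) (pt a0 b0)"

lemma cker_quadlin: "cker \<in> quadlin torus A torus B (tensor torus TT)"
  unfolding cker_def[abs_def]
  by (intro quadlinI linear_maps_pure_left linear_maps_pure_right vTT vA vB vspace_torus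
      torus_mult_linear linear_maps_id ptc) auto

lemma vTTT: "vspace (tensor (torus :: ('k, ('k, 'n) torus) module) TT)"
  by (rule vspace_tensor[OF vspace_torus vTT])

lemma coact_C: "coact C S = sweedler (tensor torus TT) S (\<lambda>a b. sweedler (tensor torus TT) (coact A a)
    (\<lambda>h a0. sweedler (tensor torus TT) (coact B b) (cker h a0)))"
  by (simp add: C_simps coproduct_coact_def cker_def[abs_def] Let_def)

lemma coact_C_inner: "(\<lambda>a b. sweedler (tensor torus TT) (coact A a)
    (\<lambda>h a0. sweedler (tensor torus TT) (coact B b) (cker h a0))) \<in> bilinear_maps A B (tensor torus TT)"
proof (rule bilinear_mapsI)
  fix b assume b: "b \<in> carrier B"
  show "(\<lambda>a. sweedler (tensor torus TT) (coact A a)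
    (\<lambda>h a0. sweedler (tensor torus TT) (coact B b) (cker h a0))) \<in> linear_maps A (tensor torus TT)"
    by (rule linear_maps_comp[OF coA bilinear_maps_left[OF dbl_bilinear[OF vspace_torus vA vspace_torus vB vTTT
          cker_quadlin] linear_maps_closed[OF coB b]]])
next
  fix a assume a: "a \<in> carrier A"
  show "(\<lambda>b. sweedler (tensor torus TT) (coact A a)
    (\<lambda>h a0. sweedler (tensor torus TT) (coact B b) (cker h a0))) \<in> linear_maps B (tensor torus TT)"
    by (rule linear_maps_comp[OF coB bilinear_maps_right[OF dbl_bilinear[OF vspace_torus vA vspace_torus vB vTTT
          cker_quadlin] linear_maps_closed[OF coA a]]])
qed

lemma coact_C_linear: "coact C \<in> linear_maps C (tensor torus C)"
  unfolding linear_C tensor_C coact_C[abs_def]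
  by (rule sweedler_linear[OF vA vB vTTT coact_C_inner])

lemma pt_homogeneous:
  assumes a: "a \<in> homogeneous A m" and b: "b \<in> homogeneous B n"
  shows "pt a b \<in> homogeneous C (m + n)"
proof -
  note c = homogeneous_closed[OF a] homogeneous_closed[OF b]
  have "coact C (pt a b) = sweedler (tensor torus TT) (coact A a)
      (\<lambda>h a0. sweedler (tensor torus TT) (coact B b) (cker h a0))"
    unfolding coact_C by (rule sweedler_pure[OF vA vB vTTT coact_C_inner c])
  also have "\<dots> = sweedler (tensor torus TT) (pure_tensor torus A (tbasis m) a)
      (\<lambda>h a0. sweedler (tensor torus TT) (pure_tensor torus B (tbasis n) b) (cker h a0))"
    using a b by (simp add: homogeneous_def)
  also have "\<dots> = cker (tbasis m) a (tbasis n) b"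
    by (rule dbl_pure[OF vspace_torus vA vspace_torus vB vTTT cker_quadlin]) (simp_all add: c)
  finally show ?thesis using ptc[OF c] unfolding homogeneous_def tensor_C
    by (simp add: C_simps(1) cker_def tbasis_add)
qed

lemma PD_homogeneous: "PD k \<subseteq> homogeneous C k"
  by (auto simp: PD_def pt_homogeneous)

lemma C_span: "x \<in> carrier C \<Longrightarrow> x \<in> vspan C (\<Union>k. PD k)"
  unfolding vspan_C C_simps(1) by (rule TT_span)

lemma PD_E2:
  assumes "x \<in> PD k"
  obtains a b m n where "x = pt a b" "a \<in> homogeneous A m" "b \<in> homogeneous B n" "k = m + n"
  using assms by (auto simp: PD_def)

lemma comodule_algebra_C: "comodule_algebra C"
proof (rule comodule_algebraI[OF alg_C coact_C_linear PD_homogeneous C_span])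
  fix x y k l assume "x \<in> PD k" "y \<in> PD l"
  from \<open>x \<in> PD k\<close> obtain a b m n where x: "x = pt a b" "a \<in> homogeneous A m" "b \<in> homogeneous B n" "k = m + n"
    by (rule PD_E2)
  from \<open>y \<in> PD l\<close> obtain a' b' m' n' where y: "y = pt a' b'" "a' \<in> homogeneous A m'" "b' \<in> homogeneous B n'" "l = m' + n'"
    by (rule PD_E2)
  have e: "k + l = (m + m') + (n + n')" by (simp add: x(4) y(4) algebra_simps)
  show "x \<otimes>\<^bsub>C\<^esub> y \<in> homogeneous C (k + l)"
    unfolding e x(1) y(1) mult_pt_homogeneous[OF x(2,3) y(2,3)] C_simps(4)[symmetric]
    by (intro homogeneous_smult[OF vC coact_C_linear] pt_homogeneous homogeneous_mult[OF cA x(2) y(2)]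
        homogeneous_mult[OF cB x(3) y(3)])
next
  show "\<one>\<^bsub>C\<^esub> \<in> homogeneous C 0"
    unfolding C_simps(6) using pt_homogeneous[OF oneA oneB] by simp
qed

lemma HA_obj_C: "HA_obj R C"
proof (rule HA_objI[OF R_linear comodule_algebra_C PD_homogeneous C_span])
  fix x y k l assume "x \<in> PD k" "y \<in> PD l"
  from \<open>x \<in> PD k\<close> obtain a b m n where x: "x = pt a b" "a \<in> homogeneous A m" "b \<in> homogeneous B n" "k = m + n"
    by (rule PD_E2)
  from \<open>y \<in> PD l\<close> obtain a' b' m' n' where y: "y = pt a' b'" "a' \<in> homogeneous A m'" "b' \<in> homogeneous B n'" "l = m' + n'"
    by (rule PD_E2)
  note xc = homogeneous_closed[OF x(2)] homogeneous_closed[OF x(3)]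
    and yc = homogeneous_closed[OF y(2)] homogeneous_closed[OF y(3)]
  have c: "a' \<otimes>\<^bsub>A\<^esub> a \<in> carrier A" "b' \<otimes>\<^bsub>B\<^esub> b \<in> carrier B" using xc yc by auto
  have pc: "pt (a' \<otimes>\<^bsub>A\<^esub> a) (b' \<otimes>\<^bsub>B\<^esub> b) \<in> carrier TT" by (rule ptc[OF c])
  have "pt (a \<otimes>\<^bsub>A\<^esub> a') (b \<otimes>\<^bsub>B\<^esub> b') = pt (r m' m \<odot>\<^bsub>A\<^esub> (a' \<otimes>\<^bsub>A\<^esub> a)) (r n' n \<odot>\<^bsub>B\<^esub> (b' \<otimes>\<^bsub>B\<^esub> b))"
    using HA_obj_comm[OF R_linear HA x(2) y(2)] HA_obj_comm[OF R_linear HB x(3) y(3)] by simp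
  also have "\<dots> = r m' m \<odot>\<^bsub>TT\<^esub> (r n' n \<odot>\<^bsub>TT\<^esub> pt (a' \<otimes>\<^bsub>A\<^esub> a) (b' \<otimes>\<^bsub>B\<^esub> b))"
    by (simp add: pure_tensor_smult_left[OF vA vB c(1) B.smult_cl[OF c(2)]] pure_tensor_smult_right[OF vA vB c])
  finally have 1: "x \<otimes>\<^bsub>C\<^esub> y = (r m' n * (r m' m * r n' n)) \<odot>\<^bsub>TT\<^esub> pt (a' \<otimes>\<^bsub>A\<^esub> a) (b' \<otimes>\<^bsub>B\<^esub> b)"
    unfolding x(1) y(1) mult_pt_homogeneous[OF x(2,3) y(2,3)] using pc by (simp add: TT.smult_mult)
  have 2: "r l k \<odot>\<^bsub>C\<^esub> (y \<otimes>\<^bsub>C\<^esub> x) = (r l k * r m n') \<odot>\<^bsub>TT\<^esub> pt (a' \<otimes>\<^bsub>A\<^esub> a) (b' \<otimes>\<^bsub>B\<^esub> b)"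
    unfolding x(1) y(1) mult_pt_homogeneous[OF y(2,3) x(2,3)] C_simps(4) using pc by (simp add: TT.smult_mult)
  \<comment> \<open>Expanding \<open>r l k\<close> gives the four factors of the pairs of degrees.
    Three of them occur on the left-hand product; the remaining \<open>r n' m\<close> cancels
    against \<open>r m n'\<close>, which arises from the exchange inside \<open>y\<close> times
    \<open>x\<close>.\<close>
  have "r l k * r m n' = r m' n * (r m' m * r n' n) * (r n' m * r m n')"
    unfolding x(4) y(4) r_add_left r_add_right by (simp add: algebra_simps)
  then show "x \<otimes>\<^bsub>C\<^esub> y = r l k \<odot>\<^bsub>C\<^esub> (y \<otimes>\<^bsub>C\<^esub> x)"
    unfolding 1 2 by (simp add: r_inverse)
qed

section \<open>The universal property of the coproduct\<close>

definition inl where "inl a = pt a \<one>\<^bsub>B\<^esub>"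
definition inr where "inr b = pt \<one>\<^bsub>A\<^esub> b"

lemma inl_HA_hom: "inl \<in> HA_hom A C"
proof (rule HA_homI_homogeneous[OF cA comodule_algebra_C])
  show "inl \<in> linear_maps A C" unfolding inl_def[abs_def] linear_C by (rule pt_left[OF RB.one_closed])
  show "inl \<one>\<^bsub>A\<^esub> = \<one>\<^bsub>C\<^esub>" by (simp add: inl_def C_simps)
  show "inl (a \<otimes>\<^bsub>A\<^esub> b) = inl a \<otimes>\<^bsub>C\<^esub> inl b" if "a \<in> carrier A" "b \<in> carrier A" for a b
    unfolding inl_def mult_pure_0_left[OF that(1) oneB that(2) RB.one_closed] by simp
  show "inl v \<in> homogeneous C m" if "v \<in> homogeneous A m" for m v
    using pt_homogeneous[OF that oneB] by (simp add: inl_def)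
qed

lemma inr_HA_hom: "inr \<in> HA_hom B C"
proof (rule HA_homI_homogeneous[OF cB comodule_algebra_C])
  show "inr \<in> linear_maps B C" unfolding inr_def[abs_def] linear_C by (rule pt_right[OF RA.one_closed])
  show "inr \<one>\<^bsub>B\<^esub> = \<one>\<^bsub>C\<^esub>" by (simp add: inr_def C_simps)
  show "inr (a \<otimes>\<^bsub>B\<^esub> b) = inr a \<otimes>\<^bsub>C\<^esub> inr b" if "a \<in> carrier B" "b \<in> carrier B" for a b
    unfolding inr_def mult_pure_0_right[OF RA.one_closed that(1) oneA that(2)] by simp
  show "inr v \<in> homogeneous C m" if "v \<in> homogeneous B m" for m v
    using pt_homogeneous[OF oneA that] by (simp add: inr_def)
qed

text \<open>Hence the two inclusions generate the coproduct, which gives uniqueness in its universal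
  property.\<close>

lemma inl_mult_inr: "a \<in> carrier A \<Longrightarrow> b \<in> carrier B \<Longrightarrow> inl a \<otimes>\<^bsub>C\<^esub> inr b = pt a b"
  unfolding inl_def inr_def by (simp add: mult_pure_0_left[OF _ oneB RA.one_closed])

text \<open>The pure tensor of \<open>a\<close> and \<open>b\<close> must go to \<open>f a\<close>
  times \<open>g b\<close>. This is multiplicative because the factor in the product of the
  coproduct is the one by which images of \<open>B\<close> and \<open>A\<close> commute in
  \<open>D\<close>.\<close>

lemma C_hom_exists:
  assumes D: "HA_obj R D" and f: "f \<in> HA_hom A D" and g: "g \<in> HA_hom B D"
  obtains h where "h \<in> HA_hom C D" "\<And>a. a \<in> carrier A \<Longrightarrow> h (inl a) = f a" "\<And>b. b \<in> carrier B \<Longrightarrow> h (inr b) = g b"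
proof -
  note cD = HA_obj_comodule_algebra[OF D]
  note vD = comodule_algebra_vspace[OF cD] and aD = comodule_algebra_alg[OF cD]
  interpret D: vsp D by (intro vsp.intro vD)
  interpret RD: ring D by (rule comodule_algebra_ring[OF cD])
  note fl = HA_homD(1)[OF f] and gl = HA_homD(1)[OF g]
  note fc = HA_homD(4)[OF f] and gc = HA_homD(4)[OF g]
  have b: "(\<lambda>a b. f a \<otimes>\<^bsub>D\<^esub> g b) \<in> bilinear_maps A B D"
  proof (rule bilinear_mapsI)
    fix w assume w: "w \<in> carrier B"
    show "(\<lambda>v. f v \<otimes>\<^bsub>D\<^esub> g w) \<in> linear_maps A D"
      by (rule linear_maps_comp[OF fl alg_mult_left_linear[OF aD gc[OF w]]])
  next
    fix v assume v: "v \<in> carrier A"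
    show "(\<lambda>w. f v \<otimes>\<^bsub>D\<^esub> g w) \<in> linear_maps B D"
      by (rule linear_maps_comp[OF gl alg_mult_right_linear[OF aD fc[OF v]]])
  qed
  define h where "h S = sweedler D S (\<lambda>a b. f a \<otimes>\<^bsub>D\<^esub> g b)" for S
  have hl: "h \<in> linear_maps TT D" unfolding h_def[abs_def] by (rule sweedler_linear[OF vA vB vD b])
  have hp: "h (pt a b) = f a \<otimes>\<^bsub>D\<^esub> g b" if "a \<in> carrier A" "b \<in> carrier B" for a b
    unfolding h_def by (rule sweedler_pure[OF vA vB vD b that])
  have "h \<in> HA_hom C D"
  proof (rule HA_homI[OF comodule_algebra_C cD _ _ _ PD_homogeneous C_span])
    show "h \<in> linear_maps C D" unfolding linear_C by (rule hl)
    show "h \<one>\<^bsub>C\<^esub> = \<one>\<^bsub>D\<^esub>" unfolding C_simps(6) by (simp add: hp HA_homD(6)[OF f] HA_homD(6)[OF g])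
    fix x y assume x: "x \<in> carrier C" and y: "y \<in> carrier C"
    then have xy: "x \<in> carrier TT" "y \<in> carrier TT" by (simp_all only: C_simps(1))
    have b1: "(\<lambda>x y. h (x \<otimes>\<^bsub>C\<^esub> y)) \<in> bilinear_maps TT TT D"
      by (rule bilinear_maps_comp[OF C_mult_bilinear hl])
    have b2: "(\<lambda>x y. h x \<otimes>\<^bsub>D\<^esub> h y) \<in> bilinear_maps TT TT D"
    proof (rule bilinear_mapsI)
      fix w assume w: "w \<in> carrier TT"
      show "(\<lambda>v. h v \<otimes>\<^bsub>D\<^esub> h w) \<in> linear_maps TT D"
        by (rule linear_maps_comp[OF hl alg_mult_left_linear[OF aD linear_maps_closed[OF hl w]]])
    next
      fix v assume v: "v \<in> carrier TT"
      show "(\<lambda>w. h v \<otimes>\<^bsub>D\<^esub> h w) \<in> linear_maps TT D"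
        by (rule linear_maps_comp[OF hl alg_mult_right_linear[OF aD linear_maps_closed[OF hl v]]])
    qed
    show "h (x \<otimes>\<^bsub>C\<^esub> y) = h x \<otimes>\<^bsub>D\<^esub> h y"
    proof (rule bilinear_maps_vspan_eqI[OF vTT vTT vD b1 b2 PD_closed PD_closed TT_span[OF xy(1)] TT_span[OF xy(2)]])
      fix x y assume "x \<in> (\<Union>k. PD k)" "y \<in> (\<Union>k. PD k)"
      from \<open>x \<in> (\<Union>k. PD k)\<close> obtain a b m n where x: "x = pt a b" "a \<in> homogeneous A m" "b \<in> homogeneous B n"
        by (rule PD_E)
      from \<open>y \<in> (\<Union>k. PD k)\<close> obtain a' b' m' n' where y: "y = pt a' b'" "a' \<in> homogeneous A m'" "b' \<in> homogeneous B n'"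
        by (rule PD_E)
      note xc = homogeneous_closed[OF x(2)] homogeneous_closed[OF x(3)]
        and yc = homogeneous_closed[OF y(2)] homogeneous_closed[OF y(3)]
      note ic = fc[OF xc(1)] fc[OF yc(1)] gc[OF xc(2)] gc[OF yc(2)]
      have c: "a \<otimes>\<^bsub>A\<^esub> a' \<in> carrier A" "b \<otimes>\<^bsub>B\<^esub> b' \<in> carrier B" using xc yc by auto
      have "h (x \<otimes>\<^bsub>C\<^esub> y) = r m' n \<odot>\<^bsub>D\<^esub> (f (a \<otimes>\<^bsub>A\<^esub> a') \<otimes>\<^bsub>D\<^esub> g (b \<otimes>\<^bsub>B\<^esub> b'))"
        unfolding x(1) y(1) mult_pt_homogeneous[OF x(2,3) y(2,3)] linear_maps_smult[OF hl ptc[OF c]] hp[OF c] ..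
      also have "\<dots> = f a \<otimes>\<^bsub>D\<^esub> (r m' n \<odot>\<^bsub>D\<^esub> (f a' \<otimes>\<^bsub>D\<^esub> g b)) \<otimes>\<^bsub>D\<^esub> g b'"
        using ic xc yc by (simp add: HA_homD(5)[OF f] HA_homD(5)[OF g] alg_smult_left[OF aD] alg_smult_right[OF aD] RD.m_assoc)
      \<comment> \<open>Braided commutativity of \<open>D\<close>, applied to \<open>g b\<close> of
        degree \<open>n\<close> and \<open>f a'\<close> of degree \<open>m'\<close>, absorbs the
        scalar.\<close>
      also have "\<dots> = f a \<otimes>\<^bsub>D\<^esub> (g b \<otimes>\<^bsub>D\<^esub> f a') \<otimes>\<^bsub>D\<^esub> g b'"
        unfolding HA_obj_comm[OF R_linear D HA_hom_homogeneous[OF cB cD g x(3)] HA_hom_homogeneous[OF cA cD f y(2)]] ..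
      also have "\<dots> = h x \<otimes>\<^bsub>D\<^esub> h y"
        using ic unfolding x(1) y(1) hp[OF xc] hp[OF yc] by (simp add: RD.m_assoc)
      finally show "h (x \<otimes>\<^bsub>C\<^esub> y) = h x \<otimes>\<^bsub>D\<^esub> h y" .
    qed
  next
    fix k x assume "x \<in> PD k"
    then obtain a b m n where x: "x = pt a b" "a \<in> homogeneous A m" "b \<in> homogeneous B n" "k = m + n"
      by (rule PD_E2)
    show "h x \<in> homogeneous D k"
      unfolding x(1,4) hp[OF homogeneous_closed[OF x(2)] homogeneous_closed[OF x(3)]]
      by (rule homogeneous_mult[OF cD HA_hom_homogeneous[OF cA cD f x(2)] HA_hom_homogeneous[OF cB cD g x(3)]])
  qed
  moreover have "h (inl a) = f a" if "a \<in> carrier A" for a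
    using that fc[OF that] by (simp add: inl_def hp HA_homD(6)[OF g])
  moreover have "h (inr b) = g b" if "b \<in> carrier B" for b
    using that gc[OF that] by (simp add: inr_def hp HA_homD(6)[OF f])
  ultimately show ?thesis by (rule that)
qed

lemma C_hom_ext:
  assumes D: "comodule_algebra D" and f: "f \<in> HA_hom C D" and g: "g \<in> HA_hom C D"
    and l: "\<And>a. a \<in> carrier A \<Longrightarrow> f (inl a) = g (inl a)" and r: "\<And>b. b \<in> carrier B \<Longrightarrow> f (inr b) = g (inr b)"
    and x: "x \<in> carrier C"
  shows "f x = g x"
proof (rule linear_maps_tensor_eqI[OF vA vB x[unfolded C_simps(1)] HA_homD(1)[OF f, unfolded linear_C] HA_homD(1)[OF g, unfolded linear_C]])
  fix a b assume ab: "a \<in> carrier A" "b \<in> carrier B"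
  have c: "inl a \<in> carrier C" "inr b \<in> carrier C"
    using HA_homD(4)[OF inl_HA_hom ab(1)] HA_homD(4)[OF inr_HA_hom ab(2)] by auto
  show "f (pt a b) = g (pt a b)"
    unfolding inl_mult_inr[OF ab, symmetric] HA_homD(5)[OF f c] HA_homD(5)[OF g c] l[OF ab(1)] r[OF ab(2)] ..
qed

end

subsection \<open>Localizations\<close>

locale localized = cotri R for R :: "('k::field, 'n::finite) braiding" +
  fixes A :: "('k, 'n, 'a) halg" and s :: 'a
  assumes HA: "HA_obj R A" and s: "s \<in> homogeneous A 0"
begin

sublocale F0: free_braided R "[0]" ..

sublocale Cp: coprod R A "free_HA R [0]"
  by unfold_locales (rule HA, rule F0.HA_obj_F)

abbreviation "x0 \<equiv> gen R [0] 0"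

lemma x0_homogeneous: "x0 \<in> homogeneous (free_HA R [0]) 0"
  using F0.gen_homogeneous[of 0] by simp

lemma s_closed: "s \<in> carrier A" using s by (rule homogeneous_closed)
lemma x0_closed: "x0 \<in> carrier (free_HA R [0])" using x0_homogeneous by (rule homogeneous_closed)

definition "lrel = Cp.pt s x0 \<ominus>\<^bsub>Cp.C\<^esub> \<one>\<^bsub>Cp.C\<^esub>"

lemma loc_ideal_eq: "loc_ideal R A s = Idl\<^bsub>Cp.C\<^esub> {lrel}"
  by (simp add: loc_ideal_def lrel_def)

lemma pt_s_homogeneous: "Cp.pt s x0 \<in> homogeneous Cp.C 0"
  using Cp.pt_homogeneous[OF s x0_homogeneous] by simp

lemma lrel_homogeneous: "lrel \<in> homogeneous Cp.C 0"
  unfolding lrel_def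
  by (rule homogeneous_minus[OF Cp.vC Cp.coact_C_linear pt_s_homogeneous homogeneous_one[OF Cp.comodule_algebra_C]])

lemma hom_ideal_loc: "hom_ideal Cp.C (loc_ideal R A s)"
  unfolding loc_ideal_eq
  by (rule genideal_hom_ideal_homogeneous[OF Cp.comodule_algebra_C]) (use lrel_homogeneous in auto)

sublocale q: quot Cp.C "loc_ideal R A s"
  by (rule quot.intro[OF Cp.comodule_algebra_C hom_ideal_loc])

abbreviation L where "L \<equiv> localization R A s"
abbreviation lm where "lm \<equiv> loc_map R A s"
definition lx where "lx = q.proj (Cp.inr x0)"

lemma L_eq: "L = q.Q" by (simp add: localization_def)

lemma lm_eq: "lm a = q.proj (Cp.inl a)" by (simp add: loc_map_def Cp.inl_def)

lemma HA_obj_L: "HA_obj R L"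
  unfolding L_eq by (rule q.HA_obj_Q[OF R_linear Cp.HA_obj_C])

lemma proj_hom: "(\<lambda>a. q.proj a) \<in> HA_hom Cp.C L"
  unfolding L_eq by (rule q.proj_HA_hom)

lemma lm_HA_hom: "lm \<in> HA_hom A L"
proof -
  have "(\<lambda>a. q.proj (Cp.inl a)) \<in> HA_hom A L"
    by (rule HA_hom_comp[OF Cp.cA Cp.comodule_algebra_C HA_obj_comodule_algebra[OF HA_obj_L] Cp.inl_HA_hom proj_hom])
  then show ?thesis by (simp add: lm_eq[abs_def])
qed

lemma inr_x0: "Cp.inr x0 \<in> homogeneous Cp.C 0"
  by (rule HA_hom_homogeneous[OF Cp.cB Cp.comodule_algebra_C Cp.inr_HA_hom x0_homogeneous])

lemma lx_homogeneous: "lx \<in> homogeneous L 0"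
  unfolding lx_def L_eq by (rule q.proj_homogeneous[OF inr_x0])

lemma lm_s_lx: "lm s \<otimes>\<^bsub>L\<^esub> lx = \<one>\<^bsub>L\<^esub>"
proof -
  note c = HA_homD(4)[OF Cp.inl_HA_hom s_closed] HA_homD(4)[OF Cp.inr_HA_hom x0_closed]
  have "lm s \<otimes>\<^bsub>L\<^esub> lx = q.proj (Cp.pt s x0)"
    unfolding lm_eq lx_def L_eq q.Q_mult[OF c] Cp.inl_mult_inr[OF s_closed x0_closed] ..
  also have "\<dots> = q.proj \<one>\<^bsub>Cp.C\<^esub>"
  proof -
    have "{lrel} \<subseteq> carrier Cp.C" using homogeneous_closed[OF lrel_homogeneous] by simp
    then have "lrel \<in> loc_ideal R A s" using q.J.genideal_self[of "{lrel}"] by (auto simp: loc_ideal_eq)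
    then show ?thesis
      using q.proj_eq_iff[OF homogeneous_closed[OF pt_s_homogeneous] q.J.one_closed] by (simp add: lrel_def)
  qed
  finally show ?thesis by (simp add: L_eq q.Q_one)
qed

text \<open>The element \<open>y\<close> must be coinvariant because the adjoined generator has
  degree 0, and the equation required of it is the defining relation of the localization.\<close>

lemma L_hom_exists:
  assumes D: "HA_obj R D" and f: "f \<in> HA_hom A D" and y: "y \<in> homogeneous D 0"
    and inv: "f s \<otimes>\<^bsub>D\<^esub> y = \<one>\<^bsub>D\<^esub>"
  obtains h where "h \<in> HA_hom L D" "\<And>a. a \<in> carrier A \<Longrightarrow> h (lm a) = f a" "h lx = y"
proof -
  note cD = HA_obj_comodule_algebra[OF D]
  interpret D: vsp D by (intro vsp.intro comodule_algebra_vspace[OF cD])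
  interpret RD: ring D by (rule comodule_algebra_ring[OF cD])
  obtain g where g: "g \<in> HA_hom (free_HA R [0]) D" and "\<And>i. i < length [0::int ^ 'n] \<Longrightarrow> g (gen R [0] i) = y"
    by (rule F0.F_hom_exists[OF D, of "\<lambda>_. y"]) (use y in auto)
  then have gx: "g x0 = y" by simp
  obtain h where h: "h \<in> HA_hom Cp.C D" "\<And>a. a \<in> carrier A \<Longrightarrow> h (Cp.inl a) = f a"
    "\<And>b. b \<in> carrier (free_HA R [0]) \<Longrightarrow> h (Cp.inr b) = g b"
    using Cp.C_hom_exists[OF D f g] by metis
  note c = HA_homD(4)[OF Cp.inl_HA_hom s_closed] HA_homD(4)[OF Cp.inr_HA_hom x0_closed]
  have hpt: "h (Cp.pt s x0) = \<one>\<^bsub>D\<^esub>"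
    unfolding Cp.inl_mult_inr[OF s_closed x0_closed, symmetric] HA_homD(5)[OF h(1) c]
      h(2)[OF s_closed] h(3)[OF x0_closed] gx inv ..
  have "h lrel = \<zero>\<^bsub>D\<^esub>"
    unfolding lrel_def linear_maps_minus[OF Cp.vC comodule_algebra_vspace[OF cD] HA_homD(1)[OF h(1)]
        homogeneous_closed[OF pt_s_homogeneous] q.J.one_closed] hpt HA_homD(6)[OF h(1)]
    by (simp add: a_minus_def D.r_neg)
  then have k0: "h x = \<zero>\<^bsub>D\<^esub>" if "x \<in> {lrel}" for x using that by simp
  have "{lrel} \<subseteq> carrier Cp.C" using homogeneous_closed[OF lrel_homogeneous] by simp
  from HA_hom_kills_genideal[OF Cp.comodule_algebra_C cD h(1) this k0]
  have k: "\<And>j. j \<in> loc_ideal R A s \<Longrightarrow> h j = \<zero>\<^bsub>D\<^esub>"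
    unfolding loc_ideal_eq .
  obtain H where H: "H \<in> HA_hom L D" "\<And>z. z \<in> carrier Cp.C \<Longrightarrow> H (q.proj z) = h z"
    unfolding L_eq using q.lift[OF cD h(1) k] by metis
  show ?thesis
  proof (rule that[OF H(1)])
    show "H (lm a) = f a" if "a \<in> carrier A" for a
      unfolding lm_eq H(2)[OF HA_homD(4)[OF Cp.inl_HA_hom that]] by (rule h(2)[OF that])
    show "H lx = y"
      unfolding lx_def H(2)[OF c(2)] h(3)[OF x0_closed] gx ..
  qed
qed

text \<open>The localization is generated by the image of \<open>A\<close> and \<open>lx\<close>: it
  is a quotient of a coproduct whose second leg is generated by \<open>x0\<close>.\<close>

lemma L_hom_ext:
  assumes D: "comodule_algebra D" and f: "f \<in> HA_hom L D" and g: "g \<in> HA_hom L D"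
    and l: "\<And>a. a \<in> carrier A \<Longrightarrow> f (lm a) = g (lm a)" and r: "f lx = g lx" and z: "z \<in> carrier L"
  shows "f z = g z"
proof -
  obtain c where c: "c \<in> carrier Cp.C" "z = q.proj c" using z unfolding L_eq by (rule q.Q_carrierE)
  note cL = HA_obj_comodule_algebra[OF HA_obj_L]
  have f': "(\<lambda>c. f (q.proj c)) \<in> HA_hom Cp.C D"
    by (rule HA_hom_comp[OF Cp.comodule_algebra_C cL D proj_hom f])
  have g': "(\<lambda>c. g (q.proj c)) \<in> HA_hom Cp.C D"
    by (rule HA_hom_comp[OF Cp.comodule_algebra_C cL D proj_hom g])
  have "(\<lambda>c. f (q.proj c)) c = (\<lambda>c. g (q.proj c)) c"
  proof (rule Cp.C_hom_ext[OF D f' g' _ _ c(1)])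
    show "f (q.proj (Cp.inl a)) = g (q.proj (Cp.inl a))" if "a \<in> carrier A" for a
      using l[OF that] by (simp add: lm_eq)
    fix b assume b: "b \<in> carrier (free_HA R [0])"
    have "(\<lambda>b. f (q.proj (Cp.inr b))) b = (\<lambda>b. g (q.proj (Cp.inr b))) b"
    proof (rule F0.F_hom_ext[OF D _ _ _ b])
      show "(\<lambda>b. f (q.proj (Cp.inr b))) \<in> HA_hom (free_HA R [0]) D"
        by (rule HA_hom_comp[OF Cp.cB Cp.comodule_algebra_C D Cp.inr_HA_hom f'])
      show "(\<lambda>b. g (q.proj (Cp.inr b))) \<in> HA_hom (free_HA R [0]) D"
        by (rule HA_hom_comp[OF Cp.cB Cp.comodule_algebra_C D Cp.inr_HA_hom g'])
      fix i assume "i < length [0::int ^ 'n]"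
      then show "f (q.proj (Cp.inr (gen R [0] i))) = g (q.proj (Cp.inr (gen R [0] i)))"
        using r by (simp add: lx_def)
    qed
    then show "f (q.proj (Cp.inr b)) = g (q.proj (Cp.inr b))" .
  qed
  then show ?thesis by (simp add: c)
qed

end

subsection \<open>Pushouts\<close>

lemma linear_maps_diff:
  assumes "vspace V" "vspace W" "f \<in> linear_maps V W" "g \<in> linear_maps V W"
  shows "(\<lambda>v. f v \<ominus>\<^bsub>W\<^esub> g v) \<in> linear_maps V W"
proof -
  interpret V: vsp V by (rule vsp.intro) fact
  interpret W: vsp W by (rule vsp.intro) fact
  note c = linear_maps_closed[OF assms(3)] linear_maps_closed[OF assms(4)]
  show ?thesis
  proof (rule linear_mapsI)
    fix v v' assume v: "v \<in> carrier V" "v' \<in> carrier V"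
    show "f (v \<oplus>\<^bsub>V\<^esub> v') \<ominus>\<^bsub>W\<^esub> g (v \<oplus>\<^bsub>V\<^esub> v') = (f v \<ominus>\<^bsub>W\<^esub> g v) \<oplus>\<^bsub>W\<^esub> (f v' \<ominus>\<^bsub>W\<^esub> g v')"
      using v c by (simp add: linear_maps_add[OF assms(3)] linear_maps_add[OF assms(4)] a_minus_def
          W.minus_add W.add.m_ac)
  next
    fix k v assume v: "v \<in> carrier V"
    show "f (k \<odot>\<^bsub>V\<^esub> v) \<ominus>\<^bsub>W\<^esub> g (k \<odot>\<^bsub>V\<^esub> v) = k \<odot>\<^bsub>W\<^esub> (f v \<ominus>\<^bsub>W\<^esub> g v)"
      using v c by (simp add: linear_maps_smult[OF assms(3)] linear_maps_smult[OF assms(4)]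
          W.minus_smult W.smult_radd W.smult_mult[symmetric] mult.commute)
  qed (use c in simp)
qed

locale pushed = cotri R for R :: "('k::field, 'n::finite) braiding" +
  fixes K :: "('k, 'n, 'c) halg" and A :: "('k, 'n, 'a) halg" and B :: "('k, 'n, 'b) halg"
    and \<kappa> :: "'c \<Rightarrow> 'a" and \<zeta> :: "'c \<Rightarrow> 'b"
  assumes HK: "comodule_algebra K" and HA: "HA_obj R A" and HB: "HA_obj R B"
    and \<kappa>: "\<kappa> \<in> HA_hom K A" and \<zeta>: "\<zeta> \<in> HA_hom K B"
begin

sublocale Cp: coprod R A B
  by unfold_locales (rule HA, rule HB)

definition \<delta> where "\<delta> c = Cp.inl (\<kappa> c) \<ominus>\<^bsub>Cp.C\<^esub> Cp.inr (\<zeta> c)"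

lemma ideal_eq: "pushout_ideal R K A B \<kappa> \<zeta> = Idl\<^bsub>Cp.C\<^esub> (\<delta> ` carrier K)"
  by (simp add: pushout_ideal_def \<delta>_def Cp.inl_def Cp.inr_def image_def Setcompr_eq_image)

lemma inl\<kappa>: "(\<lambda>c. Cp.inl (\<kappa> c)) \<in> HA_hom K Cp.C"
  by (rule HA_hom_comp[OF HK Cp.cA Cp.comodule_algebra_C \<kappa> Cp.inl_HA_hom])

lemma inr\<zeta>: "(\<lambda>c. Cp.inr (\<zeta> c)) \<in> HA_hom K Cp.C"
  by (rule HA_hom_comp[OF HK Cp.cB Cp.comodule_algebra_C \<zeta> Cp.inr_HA_hom])

lemma \<delta>_linear: "\<delta> \<in> linear_maps K Cp.C"
  unfolding \<delta>_def[abs_def]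
  by (rule linear_maps_diff[OF comodule_algebra_vspace[OF HK] Cp.vC HA_homD(1)[OF inl\<kappa>] HA_homD(1)[OF inr\<zeta>]])

lemma \<delta>_homogeneous: "c \<in> homogeneous K m \<Longrightarrow> \<delta> c \<in> homogeneous Cp.C m"
  unfolding \<delta>_def
  by (rule homogeneous_minus[OF Cp.vC Cp.coact_C_linear
        HA_hom_homogeneous[OF HK Cp.comodule_algebra_C inl\<kappa>] HA_hom_homogeneous[OF HK Cp.comodule_algebra_C inr\<zeta>]])

lemma \<delta>_closed: "\<delta> ` carrier K \<subseteq> carrier Cp.C"
  using linear_maps_closed[OF \<delta>_linear] by auto

interpretation RC: ring Cp.C by (rule Cp.ring_C)

text \<open>A generator \<open>\<delta> c\<close> is homogeneous for homogeneous \<open>c\<close>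
  but not in general. Since \<open>\<delta>\<close> is linear and preserves degrees, though not
  multiplicative, every generator is still a combination of homogeneous ones.\<close>

lemma hom_ideal_pushout: "hom_ideal Cp.C (pushout_ideal R K A B \<kappa> \<zeta>)"
  unfolding ideal_eq
proof (rule genideal_hom_ideal[OF Cp.comodule_algebra_C \<delta>_closed], rule subsetI)
  let ?I = "Idl\<^bsub>Cp.C\<^esub> (\<delta> ` carrier K)"
  fix x assume "x \<in> \<delta> ` carrier K"
  then obtain c where c: "c \<in> carrier K" "x = \<delta> c" by auto
  have "\<delta> c \<in> vspan Cp.C (\<delta> ` (\<Union>m. homogeneous K m))"
    by (rule vspan_linear_image[OF comodule_algebra_vspace[OF HK] Cp.vC \<delta>_linear homogeneous_subset
          comodule_vspan[OF comodule_algebra_comodule[OF HK] c(1)]])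
  moreover have "\<delta> ` (\<Union>m. homogeneous K m) \<subseteq> vspan Cp.C (\<Union>m. homogeneous Cp.C m \<inter> ?I)"
  proof
    fix z assume "z \<in> \<delta> ` (\<Union>m. homogeneous K m)"
    then obtain c m where z: "z = \<delta> c" "c \<in> homogeneous K m" by auto
    have "z \<in> ?I" using RC.genideal_self[OF \<delta>_closed] homogeneous_closed[OF z(2)] by (auto simp: z(1))
    moreover have "z \<in> homogeneous Cp.C m" unfolding z(1) by (rule \<delta>_homogeneous[OF z(2)])
    ultimately show "z \<in> vspan Cp.C (\<Union>m. homogeneous Cp.C m \<inter> ?I)" by (blast intro: vspan.base)
  qed
  ultimately show "x \<in> vspan Cp.C (\<Union>m. homogeneous Cp.C m \<inter> ?I)"
    unfolding c(2) by (rule vspan_mono)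
qed

sublocale q: quot Cp.C "pushout_ideal R K A B \<kappa> \<zeta>"
  by (rule quot.intro[OF Cp.comodule_algebra_C hom_ideal_pushout])

abbreviation P where "P \<equiv> pushout R K A B \<kappa> \<zeta>"
abbreviation pinl where "pinl \<equiv> pushout_inl R K A B \<kappa> \<zeta>"
definition pinr where "pinr b = q.proj (Cp.inr b)"

lemma P_eq: "P = q.Q" by (simp add: pushout_def)

lemma pinl_eq: "pinl a = q.proj (Cp.inl a)" by (simp add: pushout_inl_def Cp.inl_def)

lemma HA_obj_P: "HA_obj R P"
  unfolding P_eq by (rule q.HA_obj_Q[OF R_linear Cp.HA_obj_C])

lemma proj_hom: "(\<lambda>a. q.proj a) \<in> HA_hom Cp.C P"
  unfolding P_eq by (rule q.proj_HA_hom)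

lemmas cP = HA_obj_comodule_algebra[OF HA_obj_P]

lemma pinl_HA_hom: "pinl \<in> HA_hom A P"
proof -
  have "(\<lambda>a. q.proj (Cp.inl a)) \<in> HA_hom A P"
    by (rule HA_hom_comp[OF Cp.cA Cp.comodule_algebra_C cP Cp.inl_HA_hom proj_hom])
  then show ?thesis by (simp add: pinl_eq[abs_def])
qed

lemma pinr_HA_hom: "pinr \<in> HA_hom B P"
  unfolding pinr_def[abs_def]
  by (rule HA_hom_comp[OF Cp.cB Cp.comodule_algebra_C cP Cp.inr_HA_hom proj_hom])

lemma commute: "c \<in> carrier K \<Longrightarrow> pinl (\<kappa> c) = pinr (\<zeta> c)"
proof -
  assume c: "c \<in> carrier K"
  then have "\<delta> c \<in> pushout_ideal R K A B \<kappa> \<zeta>"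
    using RC.genideal_self[OF \<delta>_closed] by (auto simp: ideal_eq)
  then show ?thesis
    using q.proj_eq_iff[OF HA_homD(4)[OF inl\<kappa> c] HA_homD(4)[OF inr\<zeta> c]]
    by (simp add: pinl_eq pinr_def \<delta>_def)
qed

lemma P_hom_exists:
  assumes D: "HA_obj R D" and f: "f \<in> HA_hom A D" and g: "g \<in> HA_hom B D"
    and fg: "\<And>c. c \<in> carrier K \<Longrightarrow> f (\<kappa> c) = g (\<zeta> c)"
  obtains h where "h \<in> HA_hom P D" "\<And>a. a \<in> carrier A \<Longrightarrow> h (pinl a) = f a"
    "\<And>b. b \<in> carrier B \<Longrightarrow> h (pinr b) = g b"
proof -
  note cD = HA_obj_comodule_algebra[OF D]
  interpret RD: ring D by (rule comodule_algebra_ring[OF cD])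
  obtain h where h: "h \<in> HA_hom Cp.C D" "\<And>a. a \<in> carrier A \<Longrightarrow> h (Cp.inl a) = f a"
    "\<And>b. b \<in> carrier B \<Longrightarrow> h (Cp.inr b) = g b"
    using Cp.C_hom_exists[OF D f g] by metis
  have k0: "h x = \<zero>\<^bsub>D\<^esub>" if xk: "x \<in> \<delta> ` carrier K" for x
  proof -
    obtain c where c: "c \<in> carrier K" and x: "x = \<delta> c" using xk by auto
    note kc = HA_homD(4)[OF \<kappa> c] HA_homD(4)[OF \<zeta> c]
    show ?thesis
      unfolding x \<delta>_def linear_maps_minus[OF Cp.vC comodule_algebra_vspace[OF cD] HA_homD(1)[OF h(1)]
          HA_homD(4)[OF inl\<kappa> c] HA_homD(4)[OF inr\<zeta> c]] h(2)[OF kc(1)] h(3)[OF kc(2)] fg[OF c]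
      using HA_homD(4)[OF g kc(2)] by (simp add: a_minus_def RD.r_neg)
  qed
  have k: "\<And>j. j \<in> pushout_ideal R K A B \<kappa> \<zeta> \<Longrightarrow> h j = \<zero>\<^bsub>D\<^esub>"
    unfolding ideal_eq
    by (rule HA_hom_kills_genideal[OF Cp.comodule_algebra_C cD h(1) \<delta>_closed k0])
  obtain H where H: "H \<in> HA_hom P D" "\<And>z. z \<in> carrier Cp.C \<Longrightarrow> H (q.proj z) = h z"
    unfolding P_eq using q.lift[OF cD h(1) k] by metis
  show ?thesis
  proof (rule that[OF H(1)])
    show "H (pinl a) = f a" if "a \<in> carrier A" for a
      unfolding pinl_eq H(2)[OF HA_homD(4)[OF Cp.inl_HA_hom that]] by (rule h(2)[OF that])
    show "H (pinr b) = g b" if "b \<in> carrier B" for b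
      unfolding pinr_def H(2)[OF HA_homD(4)[OF Cp.inr_HA_hom that]] by (rule h(3)[OF that])
  qed
qed

lemma P_hom_ext:
  assumes D: "comodule_algebra D" and f: "f \<in> HA_hom P D" and g: "g \<in> HA_hom P D"
    and l: "\<And>a. a \<in> carrier A \<Longrightarrow> f (pinl a) = g (pinl a)"
    and r: "\<And>b. b \<in> carrier B \<Longrightarrow> f (pinr b) = g (pinr b)" and z: "z \<in> carrier P"
  shows "f z = g z"
proof -
  obtain c where c: "c \<in> carrier Cp.C" "z = q.proj c" using z unfolding P_eq by (rule q.Q_carrierE)
  have f': "(\<lambda>c. f (q.proj c)) \<in> HA_hom Cp.C D"
    by (rule HA_hom_comp[OF Cp.comodule_algebra_C cP D proj_hom f])
  have g': "(\<lambda>c. g (q.proj c)) \<in> HA_hom Cp.C D"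
    by (rule HA_hom_comp[OF Cp.comodule_algebra_C cP D proj_hom g])
  have "(\<lambda>c. f (q.proj c)) c = (\<lambda>c. g (q.proj c)) c"
    by (rule Cp.C_hom_ext[OF D f' g' l[unfolded pinl_eq] r[unfolded pinr_def] c(1)])
  then show ?thesis by (simp add: c)
qed

end

subsection \<open>Finite presentation\<close>

lemma finitely_presented_iso:
  assumes R: "cotriangular R" and A: "comodule_algebra A" and B: "comodule_algebra B"
    and iso: "\<phi> \<in> HA_iso A B" and fp: "finitely_presented R B"
  shows "finitely_presented R A"
proof -
  obtain ms G where G: "finite G" "\<forall>f\<in>G. \<exists>m. f \<in> homogeneous (free_HA R ms) m"
    and ne: "HA_iso B (quotient (free_HA R ms) (Idl\<^bsub>free_HA R ms\<^esub> G)) \<noteq> {}"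
    using fp unfolding finitely_presented_def by blast
  then obtain \<psi> where \<psi>: "\<psi> \<in> HA_iso B (quotient (free_HA R ms) (Idl\<^bsub>free_HA R ms\<^esub> G))" by blast
  interpret F: free_braided R ms using R by (intro free_braided.intro cotri.intro)
  interpret q: quot "free_HA R ms" "Idl\<^bsub>free_HA R ms\<^esub> G"
    using G(2) by (intro quot.intro F.comodule_algebra_F genideal_hom_ideal_homogeneous) auto
  have "(\<lambda>a. \<psi> (\<phi> a)) \<in> HA_iso A q.Q"
    by (rule HA_iso_comp[OF A B q.comodule_algebra_Q iso \<psi>])
  then show ?thesis unfolding finitely_presented_def using G by blast
qed

lemma HA_hom_id: "comodule_algebra A \<Longrightarrow> (\<lambda>a. a) \<in> HA_hom A A"
  by (rule HA_homI_homogeneous) (simp_all add: linear_maps_id)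

context localized
begin

text \<open>The presentation of \<open>A\<close> is given only up to an isomorphism
  \<open>\<phi>\<close>, so elements are moved along \<open>\<phi>\<close> and its inverse. The
  mutually inverse maps come from the universal properties of \<open>L\<close> and of the larger
  free algebra, and it is enough to compare composites on generators.\<close>

lemma finitely_presented_L:
  assumes fp: "finitely_presented R A"
  shows "finitely_presented R L"
proof -
  obtain ms G where G: "finite G" "\<forall>f\<in>G. \<exists>m. f \<in> homogeneous (free_HA R ms) m"
    and ne: "HA_iso A (quotient (free_HA R ms) (Idl\<^bsub>free_HA R ms\<^esub> G)) \<noteq> {}"
    using fp unfolding finitely_presented_def by blast
  then obtain \<phi> where \<phi>: "\<phi> \<in> HA_iso A (quotient (free_HA R ms) (Idl\<^bsub>free_HA R ms\<^esub> G))" by blast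
  \<comment> \<open>\<open>N\<close> is also the index of the additional generator in the list
    \<open>ms @ [0]\<close>.\<close>
  define N where "N = length ms"
  interpret F1: free_braided R ms ..
  interpret F2: free_braided R "ms @ [0]" ..
  let ?F1 = "free_HA R ms" and ?F2 = "free_HA R (ms @ [0])"
  interpret q1: quot ?F1 "Idl\<^bsub>?F1\<^esub> G"
    using G(2) by (intro quot.intro F1.comodule_algebra_F genideal_hom_ideal_homogeneous) auto
  note cL = HA_obj_comodule_algebra[OF HA_obj_L]
  note c1 = F1.comodule_algebra_F and c2 = F2.comodule_algebra_F
  note cA = HA_obj_comodule_algebra[OF HA]
  have Gc: "G \<subseteq> carrier ?F1" using G(2) by (auto dest: homogeneous_closed)

  obtain \<phi>' where \<phi>': "\<phi>' \<in> HA_hom q1.Q A" "\<And>a. a \<in> carrier A \<Longrightarrow> \<phi>' (\<phi> a) = a"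
    "\<And>b. b \<in> carrier q1.Q \<Longrightarrow> \<phi> (\<phi>' b) = b"
    using HA_iso_inverse[OF cA q1.comodule_algebra_Q \<phi>] by blast
  note \<phi>h = HA_iso_hom[OF \<phi>]

  have gen2: "gen R (ms @ [0]) i \<in> homogeneous ?F2 (ms ! i)" if "i < N" for i
    using F2.gen_homogeneous[of i] that by (simp add: N_def nth_append)
  \<comment> \<open>The comparison map between the free algebras, sending each old generator to the
    generator with the same index.\<close>
  obtain \<iota> where \<iota>: "\<iota> \<in> HA_hom ?F1 ?F2" "\<And>i. i < N \<Longrightarrow> \<iota> (gen R ms i) = gen R (ms @ [0]) i"
    using F1.F_hom_exists[OF F2.HA_obj_F, of "gen R (ms @ [0])"] gen2 unfolding N_def by metis
  define x2 where "x2 = gen R (ms @ [0]) N"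
  have x2: "x2 \<in> homogeneous ?F2 0"
    using F2.gen_homogeneous[of N] by (simp add: N_def x2_def)

  \<comment> \<open>a lift of \<open>s\<close> to the free algebra, made coinvariant by taking its degree-0 component\<close>
  have \<phi>s: "\<phi> s \<in> homogeneous q1.Q 0"
    by (rule HA_hom_homogeneous[OF cA q1.comodule_algebra_Q \<phi>h s])
  obtain y where y: "y \<in> carrier ?F1" "\<phi> s = q1.proj y"
    using homogeneous_closed[OF \<phi>s] by (rule q1.Q_carrierE)
  define y0 where "y0 = hom_component ?F1 0 y"
  have y0: "y0 \<in> homogeneous ?F1 0"
    unfolding y0_def by (rule hom_component_homogeneous[OF comodule_algebra_comodule[OF c1] y(1)])
  \<comment> \<open>Passing to the degree-0 component does not spoil the lift: the projection
    commutes with degree components, and \<open>\<phi> s\<close> is already of degree 0.\<close>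
  have py0: "q1.proj y0 = \<phi> s"
    unfolding y0_def
    using hom_component_equivariant[OF comodule_algebra_comodule[OF c1] comodule_algebra_comodule[OF q1.comodule_algebra_Q]
        HA_homD(3)[OF q1.proj_HA_hom] y(1), of 0]
      hom_component_homogeneous_self[OF comodule_algebra_vspace[OF q1.comodule_algebra_Q] \<phi>s]
    by (simp add: y(2))
  note y0c = homogeneous_closed[OF y0]

  interpret R2: ring ?F2 by (rule comodule_algebra_ring[OF c2])
  define rl where "rl = \<iota> y0 \<otimes>\<^bsub>?F2\<^esub> x2 \<ominus>\<^bsub>?F2\<^esub> \<one>\<^bsub>?F2\<^esub>"
  have yx: "\<iota> y0 \<otimes>\<^bsub>?F2\<^esub> x2 \<in> homogeneous ?F2 0"
    using homogeneous_mult[OF c2 HA_hom_homogeneous[OF c1 c2 \<iota>(1) y0] x2] by simp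
  have rl: "rl \<in> homogeneous ?F2 0"
    unfolding rl_def
    by (rule homogeneous_minus[OF comodule_algebra_vspace[OF c2] comodule_algebra_coact[OF c2] yx homogeneous_one[OF c2]])
  define G2 where "G2 = insert rl (\<iota> ` G)"
  have "\<exists>m. \<iota> z \<in> homogeneous ?F2 m" if "z \<in> G" for z
    using bspec[OF G(2) that] HA_hom_homogeneous[OF c1 c2 \<iota>(1)] by blast
  then have G2: "finite G2" "\<forall>f\<in>G2. \<exists>m. f \<in> homogeneous ?F2 m"
    using G(1) rl by (auto simp: G2_def)
  have G2c: "G2 \<subseteq> carrier ?F2" using G2(2) by (auto dest: homogeneous_closed)
  interpret q2: quot ?F2 "Idl\<^bsub>?F2\<^esub> G2"
    using G2(2) by (intro quot.intro c2 genideal_hom_ideal_homogeneous) auto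
  have HQ2: "HA_obj R q2.Q" by (rule q2.HA_obj_Q[OF R_linear F2.HA_obj_F])
  have G2z: "q2.proj z = \<zero>\<^bsub>q2.Q\<^esub>" if "z \<in> G2" for z
    using R2.genideal_self[OF G2c] that by (auto simp: quotient_simps q2.J.a_rcos_const)

  have p1: "(\<lambda>a. q1.proj a) \<in> HA_hom ?F1 q1.Q" by (rule q1.proj_HA_hom)
  \<comment> \<open>The composite from the old free algebra through its quotient and
    \<open>A\<close> to the localization.\<close>
  define \<alpha> where "\<alpha> z = lm (\<phi>' (q1.proj z))" for z
  have \<alpha>: "\<alpha> \<in> HA_hom ?F1 L"
    unfolding \<alpha>_def[abs_def]
    by (rule HA_hom_comp[OF c1 cA cL HA_hom_comp[OF c1 q1.comodule_algebra_Q cA p1 \<phi>'(1)] lm_HA_hom])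
  have \<alpha>gen: "\<alpha> (gen R ms i) \<in> homogeneous L (ms ! i)" if "i < N" for i
    using HA_hom_homogeneous[OF c1 cL \<alpha> F1.gen_homogeneous] that by (simp add: N_def)
  \<comment> \<open>Images of the generators of the larger free algebra: old ones as prescribed by
    \<open>\<alpha>\<close>, the new one becomes the inverse of \<open>s\<close>.\<close>
  define e where "e i = (if i < N then \<alpha> (gen R ms i) else lx)" for i
  have eh: "e i \<in> homogeneous L ((ms @ [0]) ! i)" if "i < length (ms @ [0])" for i
  proof (cases "i < N")
    case True
    then show ?thesis using \<alpha>gen[OF True] by (simp add: e_def nth_append N_def)
  next
    case False
    then have "i = N" using that by (simp add: N_def)
    then show ?thesis using lx_homogeneous by (simp add: e_def N_def)
  qed
  obtain E where E: "E \<in> HA_hom ?F2 L" and Eg: "\<And>i. i < length (ms @ [0]) \<Longrightarrow> E (gen R (ms @ [0]) i) = e i"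
    using F2.F_hom_exists[OF HA_obj_L eh] by metis
  have Ex2: "E x2 = lx" using Eg[of N] by (simp add: x2_def e_def N_def)
  have E\<iota>: "E (\<iota> z) = \<alpha> z" if "z \<in> carrier ?F1" for z
  proof -
    have "(\<lambda>z. E (\<iota> z)) z = \<alpha> z"
    proof (rule F1.F_hom_ext[OF cL HA_hom_comp[OF c1 c2 cL \<iota>(1) E] \<alpha> _ that])
      fix i assume "i < length ms"
      then have i: "i < N" "i < length (ms @ [0])" by (simp_all add: N_def)
      then show "E (\<iota> (gen R ms i)) = \<alpha> (gen R ms i)"
        unfolding \<iota>(2)[OF i(1)] Eg[OF i(2)] by (simp add: e_def)
    qed
    then show ?thesis .
  qed
  interpret VL: vsp L by (rule vsp.intro[OF comodule_algebra_vspace[OF cL]])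
  have Erl: "E rl = \<zero>\<^bsub>L\<^esub>"
  proof -
    have "E (\<iota> y0 \<otimes>\<^bsub>?F2\<^esub> x2) = \<alpha> y0 \<otimes>\<^bsub>L\<^esub> lx"
      unfolding HA_homD(5)[OF E HA_homD(4)[OF \<iota>(1) y0c] homogeneous_closed[OF x2]] Ex2 E\<iota>[OF y0c] ..
    also have "\<dots> = \<one>\<^bsub>L\<^esub>"
      unfolding \<alpha>_def py0 \<phi>'(2)[OF s_closed] by (rule lm_s_lx)
    finally have 1: "E (\<iota> y0 \<otimes>\<^bsub>?F2\<^esub> x2) = \<one>\<^bsub>L\<^esub>" .
    have "\<one>\<^bsub>L\<^esub> \<in> carrier L" by (rule homogeneous_closed[OF homogeneous_one[OF cL]])
    then show ?thesis
      unfolding rl_def linear_maps_minus[OF comodule_algebra_vspace[OF c2] comodule_algebra_vspace[OF cL] HA_homD(1)[OF E]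
          homogeneous_closed[OF yx] R2.one_closed] 1 HA_homD(6)[OF E]
      by (simp add: a_minus_def VL.r_neg)
  qed
  \<comment> \<open>The old relations die because they are already zero in the presentation of
    \<open>A\<close>; the new one dies because \<open>y0\<close> lifts \<open>s\<close> and
    \<open>lx\<close> inverts it.\<close>
  have EG2: "E z = \<zero>\<^bsub>L\<^esub>" if zG2: "z \<in> G2" for z
  proof (cases "z = rl")
    case False
    then obtain g where g: "g \<in> G" "z = \<iota> g" using zG2 unfolding G2_def by blast
    then have gc: "g \<in> carrier ?F1" using Gc by blast
    have "q1.proj g = \<zero>\<^bsub>q1.Q\<^esub>"
      using q1.J.genideal_self[OF Gc] g(1) by (auto simp: quotient_simps q1.J.a_rcos_const)
    then have "\<alpha> g = lm (\<phi>' \<zero>\<^bsub>q1.Q\<^esub>)" by (simp add: \<alpha>_def)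
    also have "\<dots> = \<zero>\<^bsub>L\<^esub>"
      unfolding linear_maps_zero[OF q1.vspace_Q comodule_algebra_vspace[OF cA] HA_homD(1)[OF \<phi>'(1)]]
      by (rule linear_maps_zero[OF comodule_algebra_vspace[OF cA] comodule_algebra_vspace[OF cL] HA_homD(1)[OF lm_HA_hom]])
    finally show ?thesis unfolding g(2) E\<iota>[OF gc] .
  qed (simp add: Erl)
  obtain u where u: "u \<in> HA_hom q2.Q L" "\<And>z. z \<in> carrier ?F2 \<Longrightarrow> u (q2.proj z) = E z"
    using q2.lift[OF cL E HA_hom_kills_genideal[OF c2 cL E G2c EG2]] by metis

  note cQ2 = q2.comodule_algebra_Q
  have p2: "(\<lambda>a. q2.proj a) \<in> HA_hom ?F2 q2.Q" by (rule q2.proj_HA_hom)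
  have \<beta>: "(\<lambda>z. q2.proj (\<iota> z)) \<in> HA_hom ?F1 q2.Q" by (rule HA_hom_comp[OF c1 c2 cQ2 \<iota>(1) p2])
  have \<beta>G: "q2.proj (\<iota> z) = \<zero>\<^bsub>q2.Q\<^esub>" if "z \<in> G" for z
    using that by (intro G2z) (simp add: G2_def)
  obtain \<psi> where \<psi>: "\<psi> \<in> HA_hom q1.Q q2.Q" "\<And>z. z \<in> carrier ?F1 \<Longrightarrow> \<psi> (q1.proj z) = q2.proj (\<iota> z)"
    using q1.lift[OF cQ2 \<beta> HA_hom_kills_genideal[OF c1 cQ2 \<beta> Gc \<beta>G]] by metis
  have \<gamma>: "(\<lambda>a. \<psi> (\<phi> a)) \<in> HA_hom A q2.Q" by (rule HA_hom_comp[OF cA q1.comodule_algebra_Q cQ2 \<phi>h \<psi>(1)])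
  \<comment> \<open>As \<open>y0\<close> lifts \<open>\<phi> s\<close>, the relation
    \<open>rl\<close> says exactly that the class of \<open>x2\<close> inverts the image of
    \<open>s\<close>; this permits the universal property of \<open>L\<close>.\<close>
  have inv: "\<psi> (\<phi> s) \<otimes>\<^bsub>q2.Q\<^esub> q2.proj x2 = \<one>\<^bsub>q2.Q\<^esub>"
  proof -
    have "\<psi> (\<phi> s) \<otimes>\<^bsub>q2.Q\<^esub> q2.proj x2 = q2.proj (\<iota> y0 \<otimes>\<^bsub>?F2\<^esub> x2)"
      unfolding py0[symmetric] \<psi>(2)[OF y0c] q2.Q_mult[OF HA_homD(4)[OF \<iota>(1) y0c] homogeneous_closed[OF x2]] ..
    also have "\<dots> = q2.proj \<one>\<^bsub>?F2\<^esub>"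
      unfolding q2.proj_eq_iff[OF homogeneous_closed[OF yx] R2.one_closed]
      using R2.genideal_self[OF G2c] by (auto simp: G2_def rl_def)
    finally show ?thesis unfolding q2.Q_one .
  qed
  obtain v where v: "v \<in> HA_hom L q2.Q" "\<And>a. a \<in> carrier A \<Longrightarrow> v (lm a) = \<psi> (\<phi> a)" "v lx = q2.proj x2"
    using L_hom_exists[OF HQ2 \<gamma> q2.proj_homogeneous[OF x2] inv] by metis

  have "v \<in> HA_iso L q2.Q"
  proof (rule HA_isoI[OF v(1) u(1)])
    fix z assume z: "z \<in> carrier L"
    have "(\<lambda>z. u (v z)) z = (\<lambda>z. z) z"
    proof (rule L_hom_ext[OF cL HA_hom_comp[OF cL cQ2 cL v(1) u(1)] _ _ _ z])
      show "(\<lambda>z. z) \<in> HA_hom L L"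
        by (rule HA_hom_id[OF cL])
      show "u (v lx) = lx"
        unfolding v(3) u(2)[OF homogeneous_closed[OF x2]] by (rule Ex2)
      fix a assume a: "a \<in> carrier A"
      obtain z where z: "z \<in> carrier ?F1" "\<phi> a = q1.proj z"
        using HA_homD(4)[OF \<phi>h a] by (rule q1.Q_carrierE)
      have "u (v (lm a)) = \<alpha> z"
        unfolding v(2)[OF a] z(2) \<psi>(2)[OF z(1)] u(2)[OF HA_homD(4)[OF \<iota>(1) z(1)]] E\<iota>[OF z(1)] ..
      also have "\<dots> = lm a" unfolding \<alpha>_def z(2)[symmetric] \<phi>'(2)[OF a] ..
      finally show "u (v (lm a)) = lm a" .
    qed
    then show "u (v z) = z" .
  next
    fix w assume "w \<in> carrier q2.Q"
    then obtain z where z: "z \<in> carrier ?F2" "w = q2.proj z" by (rule q2.Q_carrierE)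
    have "(\<lambda>z. v (E z)) z = (\<lambda>z. q2.proj z) z"
    proof (rule F2.F_hom_ext[OF cQ2 HA_hom_comp[OF c2 cL cQ2 E v(1)] p2 _ z(1)])
      fix i assume i: "i < length (ms @ [0])"
      show "v (E (gen R (ms @ [0]) i)) = q2.proj (gen R (ms @ [0]) i)"
      proof (cases "i < N")
        case True
        have g: "gen R ms i \<in> carrier ?F1"
          using True by (intro homogeneous_closed[OF F1.gen_homogeneous]) (simp add: N_def)
        have pg: "q1.proj (gen R ms i) \<in> carrier q1.Q" by (rule q1.proj_closed[OF g])
        have "v (E (gen R (ms @ [0]) i)) = v (lm (\<phi>' (q1.proj (gen R ms i))))"
          unfolding Eg[OF i] using True by (simp add: e_def \<alpha>_def)
        also have "\<dots> = \<psi> (q1.proj (gen R ms i))"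
          unfolding v(2)[OF HA_homD(4)[OF \<phi>'(1) pg]] \<phi>'(3)[OF pg] ..
        also have "\<dots> = q2.proj (gen R (ms @ [0]) i)"
          unfolding \<psi>(2)[OF g] \<iota>(2)[OF True] ..
        finally show ?thesis .
      next
        case False
        then have "i = N" using i by (simp add: N_def)
        then show ?thesis using Ex2 v(3) by (simp add: x2_def)
      qed
    qed
    then show "v (u w) = w" unfolding z(2) u(2)[OF z(1)] .
  qed
  then show ?thesis unfolding finitely_presented_def using G2 by blast
qed

end

subsection \<open>Base change of a localization\<close>

text \<open>A covering family fixes \<open>f\<close> only on the carrier of \<open>A\<close>, so
  \<open>f\<close> is compared with \<open>loc_map\<close> pointwise instead of being replaced by
  it.\<close>

lemma pushout_localization_iso:
  fixes A :: "('k::field, 'n::finite, 'a) halg" and B :: "('k, 'n, 'b) halg"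
  assumes R: "cotriangular R" and HA: "HA_obj R A" and HB: "HA_obj R B"
    and g: "g \<in> HA_hom A B" and s: "s \<in> homogeneous A 0"
    and f: "f \<in> HA_hom A (localization R A s)" and loc: "\<forall>a\<in>carrier A. f a = loc_map R A s a"
  shows "\<exists>u\<in>HA_iso (localization R B (g s)) (pushout R A B (localization R A s) g f).
      \<forall>b\<in>carrier B. u (loc_map R B (g s) b) = pushout_inl R A B (localization R A s) g f b"
    and "HA_obj R (pushout R A B (localization R A s) g f)"
    and "pushout_inl R A B (localization R A s) g f \<in> HA_hom B (pushout R A B (localization R A s) g f)"
proof -
  note fl = bspec[OF loc]
  note cA = HA_obj_comodule_algebra[OF HA] and cB = HA_obj_comodule_algebra[OF HB]
  have gs: "g s \<in> homogeneous B 0" by (rule HA_hom_homogeneous[OF cA cB g s])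
  interpret LA: localized R A s by (intro localized.intro cotri.intro localized_axioms.intro R HA s)
  interpret LB: localized R B "g s" by (intro localized.intro cotri.intro localized_axioms.intro R HB gs)
  interpret P: pushed R A B LA.L g f
    by (intro pushed.intro cotri.intro pushed_axioms.intro R cA HB LA.HA_obj_L g f)
  note cLA = HA_obj_comodule_algebra[OF LA.HA_obj_L] and cLB = HA_obj_comodule_algebra[OF LB.HA_obj_L]

  \<comment> \<open>The pushout identifies \<open>g s\<close> with the image of \<open>s\<close>
    under the localization of \<open>A\<close>, where \<open>LA.lx\<close> is its inverse.\<close>
  have pinv: "P.pinl (g s) \<otimes>\<^bsub>P.P\<^esub> P.pinr LA.lx = \<one>\<^bsub>P.P\<^esub>"
  proof -
    have "P.pinl (g s) \<otimes>\<^bsub>P.P\<^esub> P.pinr LA.lx = P.pinr (LA.lm s \<otimes>\<^bsub>LA.L\<^esub> LA.lx)"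
      unfolding P.commute[OF LA.s_closed] fl[OF LA.s_closed]
      by (rule HA_homD(5)[OF P.pinr_HA_hom HA_homD(4)[OF LA.lm_HA_hom LA.s_closed]
            homogeneous_closed[OF LA.lx_homogeneous], symmetric])
    then show ?thesis unfolding LA.lm_s_lx HA_homD(6)[OF P.pinr_HA_hom] .
  qed
  obtain u where u: "u \<in> HA_hom LB.L P.P" "\<And>b. b \<in> carrier B \<Longrightarrow> u (LB.lm b) = P.pinl b"
    "u LB.lx = P.pinr LA.lx"
    using LB.L_hom_exists[OF P.HA_obj_P P.pinl_HA_hom
        HA_hom_homogeneous[OF cLA P.cP P.pinr_HA_hom LA.lx_homogeneous] pinv] by metis

  have lg: "(\<lambda>a. LB.lm (g a)) \<in> HA_hom A LB.L"
    by (rule HA_hom_comp[OF cA cB cLB g LB.lm_HA_hom])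
  \<comment> \<open>The map between the localizations induced by \<open>g\<close>; together with
    \<open>LB.lm\<close> it forms a cocone on the pushout diagram.\<close>
  obtain w where w: "w \<in> HA_hom LA.L LB.L" "\<And>a. a \<in> carrier A \<Longrightarrow> w (LA.lm a) = LB.lm (g a)"
    "w LA.lx = LB.lx"
    using LA.L_hom_exists[OF LB.HA_obj_L lg LB.lx_homogeneous LB.lm_s_lx] by metis
  have comp: "LB.lm (g c) = w (f c)" if "c \<in> carrier A" for c
    unfolding fl[OF that] w(2)[OF that] ..
  obtain v where v: "v \<in> HA_hom P.P LB.L" "\<And>b. b \<in> carrier B \<Longrightarrow> v (P.pinl b) = LB.lm b"
    "\<And>z. z \<in> carrier LA.L \<Longrightarrow> v (P.pinr z) = w z"
    using P.P_hom_exists[OF LB.HA_obj_L LB.lm_HA_hom w(1) comp] by metis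
  note lxc = homogeneous_closed[OF LA.lx_homogeneous]

  have "u \<in> HA_iso LB.L P.P"
  proof (rule HA_isoI[OF u(1) v(1)])
    fix z assume z: "z \<in> carrier LB.L"
    have "(\<lambda>z. v (u z)) z = (\<lambda>z. z) z"
      by (rule LB.L_hom_ext[OF cLB HA_hom_comp[OF cLB P.cP cLB u(1) v(1)] HA_hom_id[OF cLB] _ _ z])
        (simp_all only: u v(2) v(3)[OF lxc] w(3))
    then show "v (u z) = z" .
  next
    fix z assume z: "z \<in> carrier P.P"
    \<comment> \<open>Elements from the second leg of the pushout are tested by the universal
      property of the localization of \<open>A\<close>: on the image of \<open>A\<close> the claim
      is the commuting square, on \<open>LA.lx\<close> the choice of \<open>u\<close>.\<close>
    have uw: "(\<lambda>y. u (w y)) y = P.pinr y" if y: "y \<in> carrier LA.L" for y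
    proof (rule LA.L_hom_ext[OF P.cP HA_hom_comp[OF cLA cLB P.cP w(1) u(1)] P.pinr_HA_hom _ _ y])
      show "u (w LA.lx) = P.pinr LA.lx" unfolding w(3) u(3) ..
      fix a assume a: "a \<in> carrier A"
      show "u (w (LA.lm a)) = P.pinr (LA.lm a)"
        unfolding w(2)[OF a] u(2)[OF HA_homD(4)[OF g a]] P.commute[OF a] fl[OF a] ..
    qed
    have "(\<lambda>z. u (v z)) z = (\<lambda>z. z) z"
      by (rule P.P_hom_ext[OF P.cP HA_hom_comp[OF P.cP cLB P.cP v(1) u(1)] HA_hom_id[OF P.cP] _ _ z])
        (simp_all only: u(2) v(2,3) uw)
    then show "u (v z) = z" .
  qed
  then show "\<exists>u\<in>HA_iso LB.L P.P. \<forall>b\<in>carrier B. u (LB.lm b) = P.pinl b"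
    using u(2) by blast
  show "HA_obj R P.P" by (rule P.HA_obj_P)
  show "P.pinl \<in> HA_hom B P.P" by (rule P.pinl_HA_hom)
qed

section \<open>The partition of unity in \<open>B\<close> and the stability theorem\<close>

lemma HA_hom_finsum:
  assumes A: "comodule_algebra A" and B: "comodule_algebra B" and f: "f \<in> HA_hom A B"
    and c: "\<And>i. i \<in> I \<Longrightarrow> c i \<in> carrier A"
  shows "f (\<Oplus>\<^bsub>A\<^esub>i\<in>I. c i) = (\<Oplus>\<^bsub>B\<^esub>i\<in>I. f (c i))"
proof -
  interpret ring_hom_ring A B f
    by (rule ring_hom_ringI2[OF comodule_algebra_ring[OF A] comodule_algebra_ring[OF B] HA_homD(2)[OF f]])
  show ?thesis using hom_finsum[of c I] c by (simp add: comp_def Pi_iff)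
qed

theorem proposition4p4:
  fixes R :: "('k::field, 'n::finite) braiding"
    and A :: "('k, 'n, 'a) halg" and B :: "('k, 'n, 'b) halg"
    and I :: "'i set"
    and Y :: "'i \<Rightarrow> ('k, 'n, ('k, 'a) loc) halg" and f :: "'i \<Rightarrow> 'a \<Rightarrow> ('k, 'a) loc"
    and g :: "'a \<Rightarrow> 'b"
  assumes "cotriangular R"
    and "zariski_covering_family R A I Y f"
    and "g \<in> HS_hom R B A"
  shows "\<exists>Z h. zariski_covering_family R B I Z h \<and>
    (\<forall>i\<in>I. HS_iso_over R B
       (pullback R A B (Y i) g (f i)) (pullback_proj R A B (Y i) g (f i))
       (Z i) (h i))"
proof -
  have finI: "finite I" and fh: "\<And>i. i \<in> I \<Longrightarrow> f i \<in> HS_hom R (Y i) A"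
    using assms(2) by (simp_all add: zariski_covering_family_def)
  obtain s a where s: "\<And>i. i \<in> I \<Longrightarrow> s i \<in> coinvariants A" "\<And>i. i \<in> I \<Longrightarrow> Y i = localization R A (s i)"
      "\<And>i b. i \<in> I \<Longrightarrow> b \<in> carrier A \<Longrightarrow> f i b = loc_map R A (s i) b"
    and a: "\<And>i. i \<in> I \<Longrightarrow> a i \<in> carrier A" "(\<Oplus>\<^bsub>A\<^esub>i\<in>I. a i \<otimes>\<^bsub>A\<^esub> s i) = \<one>\<^bsub>A\<^esub>"
    using assms(2) unfolding zariski_covering_family_def by blast
  have gh: "g \<in> HA_hom A B" and SA: "HS_obj R A" and SB: "HS_obj R B"
    using assms(3) by (simp_all add: HS_hom_def)
  have HA: "HA_obj R A" and HB: "HA_obj R B" and fB: "finitely_presented R B"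
    using SA SB by (simp_all add: HS_obj_def)
  note cA = HA_obj_comodule_algebra[OF HA] and cB = HA_obj_comodule_algebra[OF HB]
  have s0: "s i \<in> homogeneous A 0" if "i \<in> I" for i
    using s(1)[OF that] by (simp add: coinvariants_eq)
  have gs: "g (s i) \<in> homogeneous B 0" if "i \<in> I" for i
    by (rule HA_hom_homogeneous[OF cA cB gh s0[OF that]])
  define Z where "Z i = localization R B (g (s i))" for i
  define h where "h i = loc_map R B (g (s i))" for i
  have loc: "localized R B (g (s i))" if "i \<in> I" for i
    by (intro localized.intro cotri.intro localized_axioms.intro assms(1) HB gs[OF that])
  have HZ: "HA_obj R (Z i)" and SZ: "HS_obj R (Z i)" and hh: "h i \<in> HS_hom R (Z i) B" if "i \<in> I" for i
  proof -
    interpret localized R B "g (s i)" by (rule loc[OF that])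
    show H: "HA_obj R (Z i)" unfolding Z_def by (rule HA_obj_L)
    show S: "HS_obj R (Z i)"
      using H finitely_presented_L[OF fB] by (simp add: HS_obj_def Z_def)
    show "h i \<in> HS_hom R (Z i) B"
      using lm_HA_hom S SB by (simp add: HS_hom_def h_def Z_def)
  qed
  have "(\<Oplus>\<^bsub>B\<^esub>i\<in>I. g (a i) \<otimes>\<^bsub>B\<^esub> g (s i)) = (\<Oplus>\<^bsub>B\<^esub>i\<in>I. g (a i \<otimes>\<^bsub>A\<^esub> s i))"
  proof -
    interpret RB: ring B by (rule comodule_algebra_ring[OF cB])
    have sc: "s i \<in> carrier A" if "i \<in> I" for i by (rule homogeneous_closed[OF s0[OF that]])
    show ?thesis
      using a(1) sc HA_homD(4)[OF gh] by (intro RB.finsum_cong') (auto simp: HA_homD(5)[OF gh])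
  qed
  also have "\<dots> = g (\<Oplus>\<^bsub>A\<^esub>i\<in>I. a i \<otimes>\<^bsub>A\<^esub> s i)"
    by (rule HA_hom_finsum[OF cA cB gh, symmetric])
      (rule alg_mult_closed[OF comodule_algebra_alg[OF cA] a(1) homogeneous_closed[OF s0]])
  also have "\<dots> = \<one>\<^bsub>B\<^esub>" unfolding a(2) by (rule HA_homD(6)[OF gh])
  finally have sum: "(\<Oplus>\<^bsub>B\<^esub>i\<in>I. g (a i) \<otimes>\<^bsub>B\<^esub> g (s i)) = \<one>\<^bsub>B\<^esub>" .
  have "zariski_covering_family R B I Z h"
    unfolding zariski_covering_family_def
  proof (intro conjI SB finI)
    show "\<forall>i\<in>I. h i \<in> HS_hom R (Z i) B" using hh by blast
    have c1: "\<forall>i\<in>I. g (s i) \<in> coinvariants B \<and> Z i = localization R B (g (s i)) \<and>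
        (\<forall>b\<in>carrier B. h i b = loc_map R B (g (s i)) b)"
      using gs by (simp add: coinvariants_eq Z_def h_def)
    have c2: "\<forall>i\<in>I. g (a i) \<in> carrier B"
      using HA_homD(4)[OF gh a(1)] by blast
    show "\<exists>s. (\<forall>i\<in>I. s i \<in> coinvariants B \<and> Z i = localization R B (s i) \<and>
        (\<forall>b\<in>carrier B. h i b = loc_map R B (s i) b)) \<and>
      (\<exists>a. (\<forall>i\<in>I. a i \<in> carrier B) \<and> (\<Oplus>\<^bsub>B\<^esub>i\<in>I. a i \<otimes>\<^bsub>B\<^esub> s i) = \<one>\<^bsub>B\<^esub>)"
      by (rule exI[of _ "\<lambda>i. g (s i)"], rule conjI[OF c1], rule exI[of _ "\<lambda>i. g (a i)"],
          rule conjI[OF c2 sum])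
  qed
  moreover have "HS_iso_over R B (pullback R A B (Y i) g (f i)) (pullback_proj R A B (Y i) g (f i)) (Z i) (h i)"
    if i: "i \<in> I" for i
  proof -
    have fi: "f i \<in> HA_hom A (localization R A (s i))"
      using fh[OF i] s(2)[OF i] by (simp add: HS_hom_def)
    have "\<forall>b\<in>carrier A. f i b = loc_map R A (s i) b" using s(3)[OF i] by blast
    note P = pushout_localization_iso[OF assms(1) HA HB gh s0[OF i] fi this, folded s(2)[OF i]]
    obtain u where u: "u \<in> HA_iso (Z i) (pullback R A B (Y i) g (f i))"
      "\<forall>b\<in>carrier B. u (h i b) = pullback_proj R A B (Y i) g (f i) b"
      using P(1) unfolding Z_def h_def by blast
    note HP = P(2) and hP = P(3)
    note cP = HA_obj_comodule_algebra[OF HP] and cZ = HA_obj_comodule_algebra[OF HZ[OF i]]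
    \<comment> \<open>\<open>finitely_presented_iso\<close> needs an isomorphism out of the
      pullback, whereas \<open>u\<close> points into it; hence the inverse.\<close>
    obtain v where v: "v \<in> HA_hom (pullback R A B (Y i) g (f i)) (Z i)"
      "\<And>z. z \<in> carrier (Z i) \<Longrightarrow> v (u z) = z"
      "\<And>p. p \<in> carrier (pullback R A B (Y i) g (f i)) \<Longrightarrow> u (v p) = p"
      using HA_iso_inverse[OF cZ cP u(1)] by blast
    have "v \<in> HA_iso (pullback R A B (Y i) g (f i)) (Z i)"
      by (rule HA_isoI[OF v(1) HA_iso_hom[OF u(1)] v(3,2)])
    then have "finitely_presented R (pullback R A B (Y i) g (f i))"
      using finitely_presented_iso[OF assms(1) cP cZ] SZ[OF i] by (simp add: HS_obj_def)
    then have "pullback_proj R A B (Y i) g (f i) \<in> HS_hom R (pullback R A B (Y i) g (f i)) B"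
      using hP HP SB by (simp add: HS_hom_def HS_obj_def)
    then show ?thesis
      unfolding HS_iso_over_def using hh[OF i] u by blast
  qed
  ultimately show ?thesis by blast
qed

end
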